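(* Let $G$ be a finite directed graph, $F:E\to\mathbb{R}$ a function on its edge set, and $\alpha^F$ the corresponding generalized gauge action on $C^*(G)$. Let $\beta\in\mathbb{R}\setminus\{0\}$. Let $\mathcal{C}(\beta)$ be the set of non-circular KMS components $C$ with $\beta_C=\beta$, $\mathcal{Z}(\beta)$ the set of circular KMS components $D$ with $\beta\in I_D$, and $\mathcal{S}(\beta)$ the set of KMS sinks $s$ with $\beta\in I_s$. For every gauge invariant $\beta$-KMS state $\varphi$ for $\alpha^F$ there are unique functions $f:\mathcal{C}(\beta)\to[0,1]$, $g:\mathcal{Z}(\beta)\to[0,1]$ and $h:\mathcal{S}(\beta)\to[0,1]$ such that $\sum_Cf(C)+\sum_Dg(D)+\sum_sh(s)=1$ and $$\varphi(S_\mu S_\nu^* )=\delta_{\mu,\nu}\,e^{-\beta F(\mu)}\,\phi_{r(\mu)}$$ for all finite paths $\mu,\nu$, where $\phi\in[0,\infty)^V$ is the vector $$\phi_v=\sum_{C\in\mathcal{C}(\beta)}f(C)\phi^C_v+\sum_{D\in\mathcal{Z}(\beta)}g(D)\phi^D_v+\sum_{s\in\mathcal{S}(\beta)}h(s)\phi^s_v.$$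
   Context: **Graph and algebra.** $G$ is a finite directed graph with vertex set $V$, edge set $E$ and maps $r,s:E\to V$; $s(e)$ is the source and $r(e)$ the range of $e$. A sink is a vertex $v$ with $s^{-1}(v)=\emptyset$. $C^*(G)$ is the universal $C^*$-algebra generated by partial isometries $S_e$, $e\in E$, and mutually orthogonal projections $P_v$, $v\in V$, such that $S_e^*S_e=P_{r(e)}$ for all $e\in E$ and $P_v=\sum_{e\in s^{-1}(v)}S_eS_e^*$ for every vertex $v$ that is not a sink. A finite path of length $n=|\mu|\ge 1$ is $\mu=e_1\cdots e_n$ with $r(e_i)=s(e_{i+1})$; $s(\mu)=s(e_1)$, $r(\mu)=r(e_n)$, $S_\mu=S_{e_1}\cdots S_{e_n}$, $F(\mu)=\sum_iF(e_i)$. A vertex $v$ is a path of length $0$ with $s(v)=r(v)=v$, $S_v=P_v$, $F(v)=0$. $\mathcal{A}=\operatorname{span}\{S_\mu S_\nu^*\}$, over all finite paths $\mu,\nu$, is a dense $*$-subalgebra. **Action and KMS states.** $\alpha^F=(\alpha^F_t)_{t\in\mathbb{R}}$ is the one-parameter automorphism group with $\alpha^F_t(P_v)=P_v$ and $\alpha^F_t(S_e)=e^{iF(e)t}S_e$. A $\beta$-KMS state for $\alpha^F$ is a state $\varphi$ on $C^*(G)$ with $\varphi(ab)=\varphi(b\,\alpha^F_{i\beta}(a))$ for all $a,b\in\mathcal{A}$, where $\alpha^F_{i\beta}(S_\mu S_\nu^* )=e^{-\beta(F(\mu)-F(\nu))}S_\mu S_\nu^*$. It is gauge invariant if $\varphi\circ\alpha^1_t=\varphi$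 for all $t\in\mathbb{R}$, where $\alpha^1$ is the action obtained when $F$ is constant $1$. **Matrices and components.** $A(\beta)$ is the matrix over $V$ with $A(\beta)_{vw}=\sum_{e\in s^{-1}(v)\cap r^{-1}(w)}e^{-\beta F(e)}$. For $X\subseteq V$, $A(\beta)^X$ is the restriction of $A(\beta)$ to $X\times X$. $\rho$ is the spectral radius. Write $v\leadsto w$ if there is a finite path (possibly of length $0$) from $v$ to $w$, and $v\sim w$ if $v\leadsto w$ and $w\leadsto v$. A component is a $\sim$-equivalence class $C\subseteq V$ such that there is an edge with both endpoints in $C$. For $X\subseteq V$, $\overline{X}=\{v\in V: v\leadsto w\text{ for some }w\in X\}$. A loop is a finite path $e_1\cdots e_n$, $n\ge1$, with $s(e_1)=r(e_n)$; it is in $X\subseteq V$ if all its vertices are in $X$. A component is circular if it contains only a single loop (up to cyclic rotation and repetition). If $C$ is a component with $F(\mu)>0$ for every loop $\mu$ in $C$, or $F(\mu)<0$ for every loop $\mu$ in $C$, then $\beta_C$ denotes the unique real number with $\rho(A(\beta_C)^C)=1$. **Non-circular KMS components.** A non-circular component $C$ is a KMS component of positive type when $F(\mu)>0$ for every loop $\mu$ in $\overline{C}$ and $\beta_{C'}<\beta_C$ for every component $C'$ in $\overline{C}\setminus C$, if any; it is a KMS component of negative type when $F(\mu)<0$ for every loop $\mu$ in $\overline{C}$ and $\beta_C<\beta_{C'}$ for every component $C'$ in $\overline{C}\setminus C$, if any. A KMS component is one of positive or negative type. **Circular KMS components.** A circular component $C$ with loop $\nu$ is a KMS component of positive (resp.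 negative) type when $F(\nu)=0$ and $F(\mu)>0$ (resp. $F(\mu)<0$) for all loops $\mu$ in $\overline{C}\setminus C$, if any. If there are no components in $\overline{C}\setminus C$, set $I_C=\mathbb{R}$. Otherwise set $I_C=\left]\beta_C,\infty\right[$ with $\beta_C=\max\{\beta_{C'}:C'\text{ a component in }\overline{C}\setminus C\}$ for positive type, and $I_C=\left]-\infty,\beta_C\right[$ with $\beta_C=\min\{\beta_{C'}:C'\text{ a component in }\overline{C}\setminus C\}$ for negative type. **KMS sinks.** A sink $s$ is a KMS sink of positive (resp. negative) type when $F(\mu)>0$ (resp. $F(\mu)<0$) for every loop $\mu$ in $\overline{\{s\}}$, if any. If there are no loops in $\overline{\{s\}}$, $I_s=\mathbb{R}$. Otherwise $I_s=\left]\beta_s,\infty\right[$ with $\beta_s=\max\{\beta_{C'}:C'\text{ a component in }\overline{\{s\}}\}$ for positive type, and $I_s=\left]-\infty,\beta_s\right[$ with $\beta_s=\min\{\beta_{C'}:C'\text{ a component in }\overline{\{s\}}\}$ for negative type. **The vectors.** For $s\in\mathcal{S}(\beta)$ one has $\sum_nA(\beta)^n_{vs}<\infty$ for all $v$, and $$\phi^s_v=\frac{\sum_{n=0}^\infty A(\beta)^n_{vs}}{\sum_{w\in V}\sum_{n=0}^\infty A(\beta)^n_{ws}}.$$ For $C\in\mathcal{C}(\beta)\cup\mathcal{Z}(\beta)$, $\phi^C\in[0,\infty)^V$ is the unique vector with $\sum_v\phi^C_v=1$, $A(\beta)\phi^C=\phi^C$, $A(\beta)^C\phi^C|_C=\phi^C|_C$,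 and $\phi^C_v\neq0\Leftrightarrow v\in\overline{C}$. *)

theory Defs
  imports
    "HOL-Analysis.Analysis"
    "HOL-Algebra.Module"
    "Graph_Theory.Arc_Walk"
    "Jordan_Normal_Form.Spectral_Radius"
begin

section \<open>\<open>C\<^sup>*\<close>-algebras\<close>

text \<open>
  The algebras live on a carrier set, so that one can quantify over all \<open>C\<^sup>*\<close>-algebras on a type.
  They need not be unital: nothing is required of the inherited field \<^const>\<open>one\<close>.
\<close>

record 'a cstar = "(complex, 'a) module" +
  adj :: "'a \<Rightarrow> 'a"
  cnorm :: "'a \<Rightarrow> real"

text \<open>The case distinction is needed since \<^locale>\<open>Metric_space\<close> constrains the distance on the whole type.\<close>

definition cdist :: "'a cstar \<Rightarrow> 'a \<Rightarrow> 'a \<Rightarrow> real" where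
  "cdist A x y = (if x \<in> carrier A \<and> y \<in> carrier A then cnorm A (x \<ominus>\<^bsub>A\<^esub> y) else 0)"

locale cstar_algebra = abelian_group A for A :: "'a cstar" (structure) +
  assumes mult_closed: "\<lbrakk>x \<in> carrier A; y \<in> carrier A\<rbrakk> \<Longrightarrow> x \<otimes> y \<in> carrier A"
    and mult_assoc: "\<lbrakk>x \<in> carrier A; y \<in> carrier A; z \<in> carrier A\<rbrakk> \<Longrightarrow> (x \<otimes> y) \<otimes> z = x \<otimes> (y \<otimes> z)"
    and distrib_right: "\<lbrakk>x \<in> carrier A; y \<in> carrier A; z \<in> carrier A\<rbrakk> \<Longrightarrow> (x \<oplus> y) \<otimes> z = x \<otimes> z \<oplus> y \<otimes> z"
    and distrib_left: "\<lbrakk>x \<in> carrier A; y \<in> carrier A; z \<in> carrier A\<rbrakk> \<Longrightarrow> z \<otimes> (x \<oplus> y) = z \<otimes> x \<oplus> z \<otimes> y"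
    and scale_closed: "x \<in> carrier A \<Longrightarrow> c \<odot> x \<in> carrier A"
    and scale_add_left: "x \<in> carrier A \<Longrightarrow> (c + d) \<odot> x = c \<odot> x \<oplus> d \<odot> x"
    and scale_add_right: "\<lbrakk>x \<in> carrier A; y \<in> carrier A\<rbrakk> \<Longrightarrow> c \<odot> (x \<oplus> y) = c \<odot> x \<oplus> c \<odot> y"
    and scale_scale: "x \<in> carrier A \<Longrightarrow> (c * d) \<odot> x = c \<odot> (d \<odot> x)"
    and scale_one: "x \<in> carrier A \<Longrightarrow> 1 \<odot> x = x"
    and scale_mult_left: "\<lbrakk>x \<in> carrier A; y \<in> carrier A\<rbrakk> \<Longrightarrow> (c \<odot> x) \<otimes> y = c \<odot> (x \<otimes> y)"
    and scale_mult_right: "\<lbrakk>x \<in> carrier A; y \<in> carrier A\<rbrakk> \<Longrightarrow> x \<otimes> (c \<odot> y) = c \<odot> (x \<otimes> y)"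
    and adj_closed: "x \<in> carrier A \<Longrightarrow> adj A x \<in> carrier A"
    and adj_adj: "x \<in> carrier A \<Longrightarrow> adj A (adj A x) = x"
    and adj_add: "\<lbrakk>x \<in> carrier A; y \<in> carrier A\<rbrakk> \<Longrightarrow> adj A (x \<oplus> y) = adj A x \<oplus> adj A y"
    and adj_scale: "x \<in> carrier A \<Longrightarrow> adj A (c \<odot> x) = cnj c \<odot> adj A x"
    and adj_mult: "\<lbrakk>x \<in> carrier A; y \<in> carrier A\<rbrakk> \<Longrightarrow> adj A (x \<otimes> y) = adj A y \<otimes> adj A x"
    and cnorm_nonneg: "x \<in> carrier A \<Longrightarrow> 0 \<le> cnorm A x"
    and cnorm_eq_0: "x \<in> carrier A \<Longrightarrow> cnorm A x = 0 \<longleftrightarrow> x = \<zero>"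
    and cnorm_scale: "x \<in> carrier A \<Longrightarrow> cnorm A (c \<odot> x) = cmod c * cnorm A x"
    and cnorm_add: "\<lbrakk>x \<in> carrier A; y \<in> carrier A\<rbrakk> \<Longrightarrow> cnorm A (x \<oplus> y) \<le> cnorm A x + cnorm A y"
    and cnorm_mult: "\<lbrakk>x \<in> carrier A; y \<in> carrier A\<rbrakk> \<Longrightarrow> cnorm A (x \<otimes> y) \<le> cnorm A x * cnorm A y"
    and cstar_identity: "x \<in> carrier A \<Longrightarrow> cnorm A (adj A x \<otimes> x) = (cnorm A x)\<^sup>2"
    and complete: "Metric_space.mcomplete (carrier A) (cdist A)"

lemma (in cstar_algebra) Metric_space_cdist: "Metric_space (carrier A) (cdist A)"
proof -
  have scale_0: "0 \<odot> x = \<zero>" if x: "x \<in> carrier A" for x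
    using cnorm_scale[OF x, of 0] cnorm_eq_0[of "0 \<odot> x"] scale_closed[OF x] by simp
  have neg: "(- 1) \<odot> x = \<ominus> x" if x: "x \<in> carrier A" for x
  proof -
    have "(- 1) \<odot> x \<oplus> x = \<zero>"
      using scale_add_left[OF x, of "- 1" 1] scale_0[OF x] scale_one[OF x] by (metis add.left_inverse)
    then show ?thesis
      using x scale_closed[OF x, of "- 1"] by (metis minus_equality)
  qed
  have cnorm_neg: "cnorm A (\<ominus> x) = cnorm A x" if "x \<in> carrier A" for x
    using cnorm_scale[OF that, of "- 1"] neg[OF that] by (metis norm_minus_cancel norm_one mult_1)
  have swap: "y \<ominus> x = \<ominus> (x \<ominus> y)" if "x \<in> carrier A" "y \<in> carrier A" for x y
    using that by (simp add: a_minus_def minus_add a_comm)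
  show ?thesis
  proof
    show "0 \<le> cdist A x y" for x y
      by (simp add: cdist_def cnorm_nonneg)
    show "cdist A x y = cdist A y x" for x y
      by (cases "x \<in> carrier A \<and> y \<in> carrier A") (auto simp: cdist_def, metis swap cnorm_neg minus_closed)
    show "cdist A x y = 0 \<longleftrightarrow> x = y" if "x \<in> carrier A" "y \<in> carrier A" for x y
      using that cnorm_eq_0[of "x \<ominus> y"] by (simp add: cdist_def)
    show "cdist A x z \<le> cdist A x y + cdist A y z"
      if "x \<in> carrier A" "y \<in> carrier A" "z \<in> carrier A" for x y z
    proof -
      have "x \<ominus> z = (x \<ominus> y) \<oplus> (y \<ominus> z)"
        using that by (simp add: a_minus_def a_assoc r_neg1)
      then show ?thesis
        using that cnorm_add[of "x \<ominus> y" "y \<ominus> z"] by (simp add: cdist_def)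
    qed
  qed
qed

definition star_hom :: "'a cstar \<Rightarrow> 'b cstar \<Rightarrow> ('a \<Rightarrow> 'b) \<Rightarrow> bool" where
  "star_hom A B \<pi> \<longleftrightarrow>
     \<pi> \<in> carrier A \<rightarrow> carrier B \<and>
     (\<forall>x\<in>carrier A. \<forall>y\<in>carrier A. \<pi> (x \<oplus>\<^bsub>A\<^esub> y) = \<pi> x \<oplus>\<^bsub>B\<^esub> \<pi> y) \<and>
     (\<forall>x\<in>carrier A. \<forall>y\<in>carrier A. \<pi> (x \<otimes>\<^bsub>A\<^esub> y) = \<pi> x \<otimes>\<^bsub>B\<^esub> \<pi> y) \<and>
     (\<forall>c. \<forall>x\<in>carrier A. \<pi> (c \<odot>\<^bsub>A\<^esub> x) = c \<odot>\<^bsub>B\<^esub> \<pi> x) \<and>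
     (\<forall>x\<in>carrier A. \<pi> (adj A x) = adj B (\<pi> x))"

definition closed_star_subalgebra :: "'a cstar \<Rightarrow> 'a set \<Rightarrow> bool" where
  "closed_star_subalgebra A B \<longleftrightarrow>
     B \<subseteq> carrier A \<and> \<zero>\<^bsub>A\<^esub> \<in> B \<and>
     (\<forall>x\<in>B. \<forall>y\<in>B. x \<oplus>\<^bsub>A\<^esub> y \<in> B) \<and>
     (\<forall>x\<in>B. \<forall>y\<in>B. x \<otimes>\<^bsub>A\<^esub> y \<in> B) \<and>
     (\<forall>c. \<forall>x\<in>B. c \<odot>\<^bsub>A\<^esub> x \<in> B) \<and>
     (\<forall>x\<in>B. adj A x \<in> B) \<and>
     closedin (Metric_space.mtopology (carrier A) (cdist A)) B"

definition state :: "'a cstar \<Rightarrow> ('a \<Rightarrow> complex) \<Rightarrow> bool" where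
  "state A \<phi> \<longleftrightarrow>
     (\<forall>x\<in>carrier A. \<forall>y\<in>carrier A. \<phi> (x \<oplus>\<^bsub>A\<^esub> y) = \<phi> x + \<phi> y) \<and>
     (\<forall>c. \<forall>x\<in>carrier A. \<phi> (c \<odot>\<^bsub>A\<^esub> x) = c * \<phi> x) \<and>
     (\<forall>x\<in>carrier A. \<phi> (adj A x \<otimes>\<^bsub>A\<^esub> x) \<in> \<real>\<^sub>\<ge>\<^sub>0) \<and>
     bdd_above ((\<lambda>x. cmod (\<phi> x)) ` {x \<in> carrier A. cnorm A x \<le> 1}) \<and>
     (SUP x \<in> {x \<in> carrier A. cnorm A x \<le> 1}. cmod (\<phi> x)) = 1"


section \<open>The \<open>C\<^sup>*\<close>-algebra of a finite directed graph\<close>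

text \<open>
  A directed graph is a \<^typ>\<open>('v, 'e) pre_digraph\<close>: the vertex set is \<^term>\<open>verts G\<close>, the edge
  set is \<^term>\<open>arcs G\<close>, and the source and range maps are \<^term>\<open>tail G\<close> and \<^term>\<open>head G\<close>.
\<close>

definition sink :: "('v, 'e) pre_digraph \<Rightarrow> 'v \<Rightarrow> bool" where
  "sink G v \<longleftrightarrow> v \<in> verts G \<and> out_arcs G v = {}"

definition ck_family ::
  "('v, 'e) pre_digraph \<Rightarrow> 'a cstar \<Rightarrow> ('v \<Rightarrow> 'a) \<Rightarrow> ('e \<Rightarrow> 'a) \<Rightarrow> bool" where
  "ck_family G A P S \<longleftrightarrow>
     (\<forall>v\<in>verts G. P v \<in> carrier A \<and> adj A (P v) = P v \<and> P v \<otimes>\<^bsub>A\<^esub> P v = P v) \<and>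
     (\<forall>v\<in>verts G. \<forall>w\<in>verts G. v \<noteq> w \<longrightarrow> P v \<otimes>\<^bsub>A\<^esub> P w = \<zero>\<^bsub>A\<^esub>) \<and>
     (\<forall>e\<in>arcs G. S e \<in> carrier A \<and> S e \<otimes>\<^bsub>A\<^esub> adj A (S e) \<otimes>\<^bsub>A\<^esub> S e = S e) \<and>
     (\<forall>e\<in>arcs G. adj A (S e) \<otimes>\<^bsub>A\<^esub> S e = P (head G e)) \<and>
     (\<forall>v\<in>verts G. \<not> sink G v \<longrightarrow> P v = (\<Oplus>\<^bsub>A\<^esub>e\<in>out_arcs G v. S e \<otimes>\<^bsub>A\<^esub> adj A (S e)))"

text \<open>
  \<open>A\<close> with \<open>P\<close>, \<open>S\<close> is (a model of) the universal \<open>C\<^sup>*\<close>-algebra \<open>C\<^sup>*(G)\<close>. The universal property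
  only tests algebras \<open>B\<close> with carrier in the type of \<open>A\<close>. This is no restriction when \<open>A\<close> is
  nonzero: the type then has at least the cardinality of the continuum, and every \<open>C\<^sup>*\<close>-algebra
  generated by a Cuntz-Krieger family of a finite graph is separable, hence isomorphic to one
  with carrier in that type. The zero algebra has no states.
\<close>

definition graph_cstar_algebra ::
  "('v, 'e) pre_digraph \<Rightarrow> 'a cstar \<Rightarrow> ('v \<Rightarrow> 'a) \<Rightarrow> ('e \<Rightarrow> 'a) \<Rightarrow> bool" where
  "graph_cstar_algebra G A P S \<longleftrightarrow>
     cstar_algebra A \<and> ck_family G A P S \<and>
     (\<forall>B. closed_star_subalgebra A B \<and> P ` verts G \<subseteq> B \<and> S ` arcs G \<subseteq> B \<longrightarrow> B = carrier A) \<and>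
     (\<forall>(B :: 'a cstar) P' S'. cstar_algebra B \<and> ck_family G B P' S' \<longrightarrow>
        (\<exists>!\<pi>. \<pi> \<in> extensional (carrier A) \<and> star_hom A B \<pi> \<and>
              (\<forall>v\<in>verts G. \<pi> (P v) = P' v) \<and> (\<forall>e\<in>arcs G. \<pi> (S e) = S' e)))"

text \<open>
  A finite path is a pair of its source vertex and its list of edges. The source vertex only
  carries information when the list is empty, i.e. for the paths of length \<open>0\<close>.
\<close>

definition fpaths :: "('v, 'e) pre_digraph \<Rightarrow> ('v \<times> 'e list) set" where
  "fpaths G = {(u, p). \<exists>w. pre_digraph.awalk G u p w}"

definition path_range :: "('v, 'e) pre_digraph \<Rightarrow> 'v \<times> 'e list \<Rightarrow> 'v" where
  "path_range G \<mu> = pre_digraph.awlast G (fst \<mu>) (snd \<mu>)"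

definition path_weight :: "('e \<Rightarrow> real) \<Rightarrow> 'e list \<Rightarrow> real" where
  "path_weight F p = (\<Sum>e\<leftarrow>p. F e)"

fun path_elem :: "'a cstar \<Rightarrow> ('v \<Rightarrow> 'a) \<Rightarrow> ('e \<Rightarrow> 'a) \<Rightarrow> 'v \<times> 'e list \<Rightarrow> 'a" where
  "path_elem A P S (u, []) = P u"
| "path_elem A P S (u, [e]) = S e"
| "path_elem A P S (u, e # e' # es) = S e \<otimes>\<^bsub>A\<^esub> path_elem A P S (u, e' # es)"

definition path_pair ::
  "'a cstar \<Rightarrow> ('v \<Rightarrow> 'a) \<Rightarrow> ('e \<Rightarrow> 'a) \<Rightarrow> ('v \<times> 'e list) \<times> ('v \<times> 'e list) \<Rightarrow> 'a" where
  "path_pair A P S = (\<lambda>(\<mu>, \<nu>). path_elem A P S \<mu> \<otimes>\<^bsub>A\<^esub> adj A (path_elem A P S \<nu>))"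

definition path_comb ::
  "'a cstar \<Rightarrow> ('v \<Rightarrow> 'a) \<Rightarrow> ('e \<Rightarrow> 'a) \<Rightarrow> (('v \<times> 'e list) \<times> ('v \<times> 'e list) \<Rightarrow> complex)
     \<Rightarrow> (('v \<times> 'e list) \<times> ('v \<times> 'e list)) set \<Rightarrow> 'a" where
  "path_comb A P S c K = (\<Oplus>\<^bsub>A\<^esub>k\<in>K. c k \<odot>\<^bsub>A\<^esub> path_pair A P S k)"

definition path_span :: "('v, 'e) pre_digraph \<Rightarrow> 'a cstar \<Rightarrow> ('v \<Rightarrow> 'a) \<Rightarrow> ('e \<Rightarrow> 'a) \<Rightarrow> 'a set" where
  "path_span G A P S = {path_comb A P S c K | c K. finite K \<and> K \<subseteq> fpaths G \<times> fpaths G}"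


section \<open>Generalized gauge actions and KMS states\<close>

text \<open>The automorphism \<open>\<alpha>\<^sup>F\<^sub>t\<close>; it exists and is unique by the universal property.\<close>

definition gauge_action ::
  "('v, 'e) pre_digraph \<Rightarrow> 'a cstar \<Rightarrow> ('v \<Rightarrow> 'a) \<Rightarrow> ('e \<Rightarrow> 'a) \<Rightarrow> ('e \<Rightarrow> real) \<Rightarrow> real \<Rightarrow> 'a \<Rightarrow> 'a" where
  "gauge_action G A P S F t =
     (THE \<pi>. \<pi> \<in> extensional (carrier A) \<and> star_hom A A \<pi> \<and>
             (\<forall>v\<in>verts G. \<pi> (P v) = P v) \<and>
             (\<forall>e\<in>arcs G. \<pi> (S e) = exp (\<i> * complex_of_real (F e * t)) \<odot>\<^bsub>A\<^esub> S e))"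

lemma gauge_action:
  fixes A :: "'a cstar"
  assumes G: "fin_digraph G" and A: "graph_cstar_algebra G A P S"
  shows "star_hom A A (gauge_action G A P S F t)"
    and "v \<in> verts G \<Longrightarrow> gauge_action G A P S F t (P v) = P v"
    and "e \<in> arcs G \<Longrightarrow>
      gauge_action G A P S F t (S e) = exp (\<i> * complex_of_real (F e * t)) \<odot>\<^bsub>A\<^esub> S e"
proof -
  interpret fin_digraph G by fact
  from A interpret A: cstar_algebra A
    by (simp add: graph_cstar_algebra_def)
  define c where "c e = exp (\<i> * complex_of_real (F e * t))" for e
  have c: "c e * cnj (c e) = 1" "cnj (c e) * c e = 1" for e
    using complex_norm_square[of "c e"] by (simp_all add: c_def mult.commute)
  from A have ck: "ck_family G A P S"
    by (simp add: graph_cstar_algebra_def)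
  have S: "S e \<in> carrier A" "adj A (S e) \<in> carrier A" if "e \<in> arcs G" for e
    using ck that by (auto simp: ck_family_def A.adj_closed)
  have SS: "(c e \<odot>\<^bsub>A\<^esub> S e) \<otimes>\<^bsub>A\<^esub> adj A (c e \<odot>\<^bsub>A\<^esub> S e) = S e \<otimes>\<^bsub>A\<^esub> adj A (S e)"
    "adj A (c e \<odot>\<^bsub>A\<^esub> S e) \<otimes>\<^bsub>A\<^esub> (c e \<odot>\<^bsub>A\<^esub> S e) = adj A (S e) \<otimes>\<^bsub>A\<^esub> S e" if "e \<in> arcs G" for e
    using S[OF that]
    by (simp_all add: A.adj_scale A.scale_mult_left A.scale_mult_right A.scale_closed A.mult_closed
        A.scale_one c flip: A.scale_scale)
  have "ck_family G A P (\<lambda>e. c e \<odot>\<^bsub>A\<^esub> S e)"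
    unfolding ck_family_def
  proof (intro conjI ballI impI)
    fix e assume e: "e \<in> arcs G"
    show "c e \<odot>\<^bsub>A\<^esub> S e \<in> carrier A"
      using S[OF e] by (simp add: A.scale_closed)
    show "c e \<odot>\<^bsub>A\<^esub> S e \<otimes>\<^bsub>A\<^esub> adj A (c e \<odot>\<^bsub>A\<^esub> S e) \<otimes>\<^bsub>A\<^esub> (c e \<odot>\<^bsub>A\<^esub> S e) = c e \<odot>\<^bsub>A\<^esub> S e"
      using S[OF e] ck e SS[OF e] by (simp add: ck_family_def A.scale_mult_right A.mult_closed)
    show "adj A (c e \<odot>\<^bsub>A\<^esub> S e) \<otimes>\<^bsub>A\<^esub> (c e \<odot>\<^bsub>A\<^esub> S e) = P (head G e)"
      using ck e SS[OF e] by (simp add: ck_family_def)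
  next
    fix v assume v: "v \<in> verts G" "\<not> sink G v"
    have "(\<Oplus>\<^bsub>A\<^esub>e\<in>out_arcs G v. (c e \<odot>\<^bsub>A\<^esub> S e) \<otimes>\<^bsub>A\<^esub> adj A (c e \<odot>\<^bsub>A\<^esub> S e)) =
          (\<Oplus>\<^bsub>A\<^esub>e\<in>out_arcs G v. S e \<otimes>\<^bsub>A\<^esub> adj A (S e))"
      by (rule A.finsum_cong') (auto simp: SS S A.mult_closed)
    then show "P v = (\<Oplus>\<^bsub>A\<^esub>e\<in>out_arcs G v. c e \<odot>\<^bsub>A\<^esub> S e \<otimes>\<^bsub>A\<^esub> adj A (c e \<odot>\<^bsub>A\<^esub> S e))"
      using ck v by (simp add: ck_family_def)
  qed (use ck in \<open>auto simp: ck_family_def\<close>)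
  note ck' = this
  from A have "\<forall>(B :: 'a cstar) P' S'. cstar_algebra B \<and> ck_family G B P' S' \<longrightarrow>
        (\<exists>!\<pi>. \<pi> \<in> extensional (carrier A) \<and> star_hom A B \<pi> \<and>
              (\<forall>v\<in>verts G. \<pi> (P v) = P' v) \<and> (\<forall>e\<in>arcs G. \<pi> (S e) = S' e))"
    unfolding graph_cstar_algebra_def by (elim conjE)
  note ex = this[rule_format, OF conjI[OF A.cstar_algebra_axioms ck']]
  have g: "gauge_action G A P S F t \<in> extensional (carrier A) \<and> star_hom A A (gauge_action G A P S F t) \<and>
      (\<forall>v\<in>verts G. gauge_action G A P S F t (P v) = P v) \<and>
      (\<forall>e\<in>arcs G. gauge_action G A P S F t (S e) = exp (\<i> * complex_of_real (F e * t)) \<odot>\<^bsub>A\<^esub> S e)"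
    unfolding gauge_action_def by (rule theI'[OF ex[unfolded c_def]])
  from g show "star_hom A A (gauge_action G A P S F t)"
    by (elim conjE)
  from g show "gauge_action G A P S F t (P v) = P v" if "v \<in> verts G"
    using that by (elim conjE) (rule bspec)
  from g show "gauge_action G A P S F t (S e) = exp (\<i> * complex_of_real (F e * t)) \<odot>\<^bsub>A\<^esub> S e"
    if "e \<in> arcs G"
    using that by (elim conjE) (rule bspec)
qed

definition gauge_invariant ::
  "('v, 'e) pre_digraph \<Rightarrow> 'a cstar \<Rightarrow> ('v \<Rightarrow> 'a) \<Rightarrow> ('e \<Rightarrow> 'a) \<Rightarrow> ('a \<Rightarrow> complex) \<Rightarrow> bool" where
  "gauge_invariant G A P S \<phi> \<longleftrightarrow>
     (\<forall>t. \<forall>x\<in>carrier A. \<phi> (gauge_action G A P S (\<lambda>_. 1) t x) = \<phi> x)"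

text \<open>
  The KMS condition \<open>\<phi>(ab) = \<phi>(b \<alpha>\<^sup>F\<^bsub>i\<beta>\<^esub>(a))\<close> for \<open>a\<close>, \<open>b\<close> in \<^const>\<open>path_span\<close>. The linear map
  \<open>\<alpha>\<^sup>F\<^bsub>i\<beta>\<^esub>\<close> multiplies \<open>S\<^sub>\<mu>S\<^sub>\<nu>\<^sup>*\<close> by \<open>exp (- \<beta> (F(\<mu>) - F(\<nu>)))\<close>, so the condition ranges over all
  ways \<open>c\<close>, \<open>K\<close> of writing \<open>a\<close> as a linear combination of the \<open>S\<^sub>\<mu>S\<^sub>\<nu>\<^sup>*\<close>.
\<close>

definition kms_state ::
  "('v, 'e) pre_digraph \<Rightarrow> 'a cstar \<Rightarrow> ('v \<Rightarrow> 'a) \<Rightarrow> ('e \<Rightarrow> 'a) \<Rightarrow> ('e \<Rightarrow> real) \<Rightarrow> real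
     \<Rightarrow> ('a \<Rightarrow> complex) \<Rightarrow> bool" where
  "kms_state G A P S F \<beta> \<phi> \<longleftrightarrow>
     state A \<phi> \<and>
     (\<forall>c K. \<forall>b \<in> path_span G A P S. finite K \<and> K \<subseteq> fpaths G \<times> fpaths G \<longrightarrow>
        \<phi> (path_comb A P S c K \<otimes>\<^bsub>A\<^esub> b) =
        \<phi> (b \<otimes>\<^bsub>A\<^esub> path_comb A P S
               (\<lambda>(\<mu>, \<nu>). complex_of_real
                   (exp (- \<beta> * (path_weight F (snd \<mu>) - path_weight F (snd \<nu>)))) * c (\<mu>, \<nu>)) K))"


section \<open>The matrices \<open>A(\<beta>)\<close>\<close>

definition wmat :: "('v, 'e) pre_digraph \<Rightarrow> ('e \<Rightarrow> real) \<Rightarrow> real \<Rightarrow> 'v \<Rightarrow> 'v \<Rightarrow> real" where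
  "wmat G F \<beta> v w = (\<Sum>e \<in> out_arcs G v \<inter> in_arcs G w. exp (- \<beta> * F e))"

primrec wmat_pow ::
  "('v, 'e) pre_digraph \<Rightarrow> ('e \<Rightarrow> real) \<Rightarrow> real \<Rightarrow> nat \<Rightarrow> 'v \<Rightarrow> 'v \<Rightarrow> real" where
  "wmat_pow G F \<beta> 0 v w = (if v = w then 1 else 0)"
| "wmat_pow G F \<beta> (Suc n) v w = (\<Sum>u\<in>verts G. wmat G F \<beta> v u * wmat_pow G F \<beta> n u w)"

text \<open>
  The restriction of a matrix to \<open>X \<times> X\<close> for a finite set \<open>X\<close>. The enumeration of \<open>X\<close> is arbitrary;
  a different one conjugates the matrix by a permutation.
\<close>

definition restr_mat :: "'v set \<Rightarrow> ('v \<Rightarrow> 'v \<Rightarrow> real) \<Rightarrow> complex mat" where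
  "restr_mat X M =
     (let xs = (SOME xs. distinct xs \<and> set xs = X)
      in mat (card X) (card X) (\<lambda>(i, j). complex_of_real (M (xs ! i) (xs ! j))))"


section \<open>Components\<close>

definition component :: "('v, 'e) pre_digraph \<Rightarrow> 'v set \<Rightarrow> bool" where
  "component G C \<longleftrightarrow>
     C \<in> verts G // {(v, w). v \<rightarrow>\<^sup>*\<^bsub>G\<^esub> w \<and> w \<rightarrow>\<^sup>*\<^bsub>G\<^esub> v} \<and>
     (\<exists>e\<in>arcs G. tail G e \<in> C \<and> head G e \<in> C)"

definition components_in :: "('v, 'e) pre_digraph \<Rightarrow> 'v set \<Rightarrow> 'v set set" where
  "components_in G X = {C. component G C \<and> C \<subseteq> X}"

definition up_closure :: "('v, 'e) pre_digraph \<Rightarrow> 'v set \<Rightarrow> 'v set" where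
  "up_closure G X = {v \<in> verts G. \<exists>w\<in>X. v \<rightarrow>\<^sup>*\<^bsub>G\<^esub> w}"

definition loops_in :: "('v, 'e) pre_digraph \<Rightarrow> 'v set \<Rightarrow> 'e list set" where
  "loops_in G X = {p. p \<noteq> [] \<and> (\<exists>u. pre_digraph.awalk G u p u) \<and> (\<forall>e\<in>set p. tail G e \<in> X \<and> head G e \<in> X)}"

definition circular_with :: "('v, 'e) pre_digraph \<Rightarrow> 'v set \<Rightarrow> 'e list \<Rightarrow> bool" where
  "circular_with G C \<nu> \<longleftrightarrow>
     \<nu> \<in> loops_in G C \<and> (\<forall>p\<in>loops_in G C. \<exists>k n. p = rotate k (concat (replicate n \<nu>)))"

definition circular :: "('v, 'e) pre_digraph \<Rightarrow> 'v set \<Rightarrow> bool" where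
  "circular G C \<longleftrightarrow> (\<exists>\<nu>. circular_with G C \<nu>)"

definition pos_loops :: "('v, 'e) pre_digraph \<Rightarrow> ('e \<Rightarrow> real) \<Rightarrow> 'v set \<Rightarrow> bool" where
  "pos_loops G F X \<longleftrightarrow> (\<forall>p\<in>loops_in G X. path_weight F p > 0)"

definition neg_loops :: "('v, 'e) pre_digraph \<Rightarrow> ('e \<Rightarrow> real) \<Rightarrow> 'v set \<Rightarrow> bool" where
  "neg_loops G F X \<longleftrightarrow> (\<forall>p\<in>loops_in G X. path_weight F p < 0)"

text \<open>Only meaningful if all loops in \<open>C\<close> have positive weight, or all have negative weight.\<close>

definition comp_beta :: "('v, 'e) pre_digraph \<Rightarrow> ('e \<Rightarrow> real) \<Rightarrow> 'v set \<Rightarrow> real" where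
  "comp_beta G F C = (THE b. spectral_radius (restr_mat C (wmat G F b)) = 1)"

text \<open>
  The intervals \<open>I\<^sub>C\<close> and \<open>I\<^sub>s\<close>, for circular KMS components \<open>C\<close> and KMS sinks \<open>s\<close>. Such a \<open>C\<close> or \<open>s\<close>
  is of both types only when the first case applies.
\<close>

definition circ_interval :: "('v, 'e) pre_digraph \<Rightarrow> ('e \<Rightarrow> real) \<Rightarrow> 'v set \<Rightarrow> real set" where
  "circ_interval G F C =
     (let \<C> = components_in G (up_closure G C - C) in
      if \<C> = {} then UNIV
      else if pos_loops G F (up_closure G C - C) then {Max (comp_beta G F ` \<C>)<..}
      else {..<Min (comp_beta G F ` \<C>)})"

definition sink_interval :: "('v, 'e) pre_digraph \<Rightarrow> ('e \<Rightarrow> real) \<Rightarrow> 'v \<Rightarrow> real set" where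
  "sink_interval G F s =
     (let \<C> = components_in G (up_closure G {s}) in
      if loops_in G (up_closure G {s}) = {} then UNIV
      else if pos_loops G F (up_closure G {s}) then {Max (comp_beta G F ` \<C>)<..}
      else {..<Min (comp_beta G F ` \<C>)})"


section \<open>KMS components and KMS sinks\<close>

definition kms_noncircular_pos :: "('v, 'e) pre_digraph \<Rightarrow> ('e \<Rightarrow> real) \<Rightarrow> 'v set \<Rightarrow> bool" where
  "kms_noncircular_pos G F C \<longleftrightarrow>
     component G C \<and> \<not> circular G C \<and> pos_loops G F (up_closure G C) \<and>
     (\<forall>C'\<in>components_in G (up_closure G C - C). comp_beta G F C' < comp_beta G F C)"

definition kms_noncircular_neg :: "('v, 'e) pre_digraph \<Rightarrow> ('e \<Rightarrow> real) \<Rightarrow> 'v set \<Rightarrow> bool" where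
  "kms_noncircular_neg G F C \<longleftrightarrow>
     component G C \<and> \<not> circular G C \<and> neg_loops G F (up_closure G C) \<and>
     (\<forall>C'\<in>components_in G (up_closure G C - C). comp_beta G F C < comp_beta G F C')"

definition kms_circular :: "('v, 'e) pre_digraph \<Rightarrow> ('e \<Rightarrow> real) \<Rightarrow> 'v set \<Rightarrow> bool" where
  "kms_circular G F C \<longleftrightarrow>
     component G C \<and> (\<exists>\<nu>. circular_with G C \<nu> \<and> path_weight F \<nu> = 0) \<and>
     (pos_loops G F (up_closure G C - C) \<or> neg_loops G F (up_closure G C - C))"

definition kms_sink :: "('v, 'e) pre_digraph \<Rightarrow> ('e \<Rightarrow> real) \<Rightarrow> 'v \<Rightarrow> bool" where
  "kms_sink G F s \<longleftrightarrow>
     sink G s \<and> (pos_loops G F (up_closure G {s}) \<or> neg_loops G F (up_closure G {s}))"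

definition C_set :: "('v, 'e) pre_digraph \<Rightarrow> ('e \<Rightarrow> real) \<Rightarrow> real \<Rightarrow> 'v set set" where
  "C_set G F \<beta> = {C. (kms_noncircular_pos G F C \<or> kms_noncircular_neg G F C) \<and> comp_beta G F C = \<beta>}"

definition Z_set :: "('v, 'e) pre_digraph \<Rightarrow> ('e \<Rightarrow> real) \<Rightarrow> real \<Rightarrow> 'v set set" where
  "Z_set G F \<beta> = {D. kms_circular G F D \<and> \<beta> \<in> circ_interval G F D}"

definition S_set :: "('v, 'e) pre_digraph \<Rightarrow> ('e \<Rightarrow> real) \<Rightarrow> real \<Rightarrow> 'v set" where
  "S_set G F \<beta> = {s. kms_sink G F s \<and> \<beta> \<in> sink_interval G F s}"


section \<open>The vectors\<close>

definition sink_vec :: "('v, 'e) pre_digraph \<Rightarrow> ('e \<Rightarrow> real) \<Rightarrow> real \<Rightarrow> 'v \<Rightarrow> 'v \<Rightarrow> real" where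
  "sink_vec G F \<beta> s v =
     (\<Sum>n. wmat_pow G F \<beta> n v s) / (\<Sum>w\<in>verts G. \<Sum>n. wmat_pow G F \<beta> n w s)"

text \<open>Vectors over \<^term>\<open>verts G\<close> vanish outside of it; here the support condition ensures this.\<close>

definition comp_vec :: "('v, 'e) pre_digraph \<Rightarrow> ('e \<Rightarrow> real) \<Rightarrow> real \<Rightarrow> 'v set \<Rightarrow> 'v \<Rightarrow> real" where
  "comp_vec G F \<beta> C =
     (THE x. (\<forall>v. 0 \<le> x v) \<and> (\<Sum>v\<in>verts G. x v) = 1 \<and>
             (\<forall>v\<in>verts G. (\<Sum>w\<in>verts G. wmat G F \<beta> v w * x w) = x v) \<and>
             (\<forall>v\<in>C. (\<Sum>w\<in>C. wmat G F \<beta> v w * x w) = x v) \<and>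
             (\<forall>v. x v \<noteq> 0 \<longleftrightarrow> v \<in> up_closure G C))"

definition mixed_vec ::
  "('v, 'e) pre_digraph \<Rightarrow> ('e \<Rightarrow> real) \<Rightarrow> real \<Rightarrow> ('v set \<Rightarrow> real) \<Rightarrow> ('v set \<Rightarrow> real) \<Rightarrow> ('v \<Rightarrow> real)
     \<Rightarrow> 'v \<Rightarrow> real" where
  "mixed_vec G F \<beta> f g h v =
     (\<Sum>C\<in>C_set G F \<beta>. f C * comp_vec G F \<beta> C v) +
     (\<Sum>D\<in>Z_set G F \<beta>. g D * comp_vec G F \<beta> D v) +
     (\<Sum>s\<in>S_set G F \<beta>. h s * sink_vec G F \<beta> s v)"

end

theory Submission
  imports Defs
begin

text \<open>
  A gauge invariant \<open>\<beta>\<close>-KMS state \<open>\<phi>\<close> is determined by the vector \<open>\<psi>\<^sub>v = \<phi>(P\<^sub>v)\<close>. If \<open>\<mu>\<close> and \<open>\<nu>\<close> have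
  different lengths, gauge invariance gives \<open>\<phi>(S\<^sub>\<mu> S\<^sub>\<nu>\<^sup>*) = 0\<close>; if they have the same length, the KMS
  condition turns this value into a multiple of \<open>\<phi>(S\<^sub>\<nu>\<^sup>* S\<^sub>\<mu>)\<close>, and \<open>S\<^sub>\<nu>\<^sup>* S\<^sub>\<mu>\<close> is \<open>P\<^sub>r\<^sub>(\<^sub>\<mu>\<^sub>)\<close> or \<open>0\<close>. The
  Cuntz-Krieger relation at a vertex that is not a sink says \<open>(A(\<beta>)\<psi>)\<^sub>v = \<psi>\<^sub>v\<close>, and \<open>\<phi>\<close> having norm
  \<open>1\<close> says that \<open>\<psi>\<close> sums to \<open>1\<close> (\<open>gauge_invariant_kms_state_vector\<close>). The main fact about
  \<open>C\<^sup>*\<close>-algebras behind this is that projections whose sum is a projection are pairwise orthogonal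
  (\<open>projections_sum_orthogonal\<close>). Instead of the order on a \<open>C\<^sup>*\<close>-algebra, the proof uses only that
  a unit \<open>e\<close> cannot be moved in both directions \<open>x\<close> and \<open>-x\<close> inside the unit ball
  (\<open>unit_extreme_point\<close>).

  The remaining problem is to decompose such vectors \<open>\<psi>\<close>. For a component \<open>C\<close> let \<open>\<rho>\<^sub>C(b)\<close> be the
  spectral radius of the restriction of \<open>A(b)\<close> to \<open>C\<close>. It is a Perron-Frobenius eigenvalue, and
  \<open>ln \<rho>\<^sub>C\<close> is convex (\<open>spec_log_convex\<close>). If all loops in \<open>C\<close> have positive weight, this function is
  nonnegative at \<open>0\<close> and negative far to the right, hence it has exactly one zero \<open>\<beta>\<^sub>C\<close>, and
  \<open>\<rho>\<^sub>C(b) < 1\<close> is the same as \<open>b > \<beta>\<^sub>C\<close>; negative weights are symmetric. Conversely, \<open>\<rho>\<^sub>C(\<beta>) < 1\<close>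
  forces all loops in \<open>C\<close> to have weights of the sign of \<open>\<beta>\<close>, and so does \<open>\<rho>\<^sub>C(\<beta>) = 1\<close> unless \<open>C\<close> is
  circular. Therefore the conditions on weights, types and intervals collapse: a component
  belongs to \<open>\<C>(\<beta>) \<union> \<Z>(\<beta>)\<close> iff \<open>\<rho>\<^sub>C(\<beta>) = 1\<close> and all other components in its closure have
  spectral radius below \<open>1\<close>, and a sink belongs to \<open>\<S>(\<beta>)\<close> iff all components in its closure have
  spectral radius below \<open>1\<close> (\<open>C_set_iff\<close>, \<open>Z_set_iff\<close>, \<open>S_set_iff\<close>).

  On a set that is closed under predecessors and has only components with spectral radius below
  \<open>1\<close>, there is a positive vector that \<open>A(\<beta>)\<close> contracts (\<open>subcritical_subsolution\<close>). Hence the powers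
  of \<open>A(\<beta>)\<close> are summable there, and a harmonic vector vanishes there. This makes
  \<open>\<phi>\<^sup>s\<close> and \<open>\<phi>\<^sup>C\<close> well defined (\<open>comp_vec_exists\<close>, \<open>comp_vec_unique\<close>).

  Now consider the support of \<open>\<psi>\<close>, which is closed under predecessors. As \<open>A(\<beta>)\<psi> \<le> \<psi>\<close>, all components
  in it have spectral radius at most \<open>1\<close>. If it is \<open>1\<close> for \<open>C\<close>, then \<open>\<psi>\<close> is invariant on \<open>C\<close>, so no edge
  leads from \<open>C\<close> to the rest of the support; thus \<open>C\<close> belongs to \<open>\<C>(\<beta>) \<union> \<Z>(\<beta>)\<close>, and \<open>\<psi>\<close> is a
  multiple of \<open>\<phi>\<^sup>C\<close> on \<open>C\<close>. In the same way a sink in the support belongs to \<open>\<S>(\<beta>)\<close>. Subtracting these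
  multiples of the \<open>\<phi>\<^sup>C\<close>, and multiples of the \<open>\<phi>\<^sup>s\<close> that agree with \<open>\<psi>\<close> at the sinks, leaves a harmonic
  vector on a set of the kind above, that is, zero (\<open>superharmonic_decomposition\<close>). The
  coefficients are unique because on \<open>C\<close> only \<open>\<phi>\<^sup>C\<close>, and at \<open>s\<close> only \<open>\<phi>\<^sup>s\<close>, does not vanish.
\<close>

section \<open>Irreducible nonnegative matrices\<close>

lemma bounded_family_convergent_subseq:
  fixes f :: "nat \<Rightarrow> 'v \<Rightarrow> real"
  assumes "finite C" "\<And>n v. v \<in> C \<Longrightarrow> \<bar>f n v\<bar> \<le> B"
  shows "\<exists>r l. strict_mono (r :: nat \<Rightarrow> nat) \<and> (\<forall>v\<in>C. (\<lambda>n. f (r n) v) \<longlonglongrightarrow> l v)"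
  using assms
proof (induction C)
  case empty
  show ?case by (rule exI[of _ id]) (auto simp: strict_mono_def)
next
  case (insert a C)
  then obtain r l where r: "strict_mono r" "\<forall>v\<in>C. (\<lambda>n. f (r n) v) \<longlonglongrightarrow> l v"
    by auto
  have "bounded (range (\<lambda>n. f (r n) a))"
    unfolding bounded_iff using insert.prems by auto
  then obtain l' r' where r': "strict_mono r'" "((\<lambda>n. f (r n) a) \<circ> r') \<longlonglongrightarrow> l'"
    using bounded_imp_convergent_subsequence by blast
  have "(\<lambda>n. f (r (r' n)) v) \<longlonglongrightarrow> (l(a := l')) v" if "v \<in> insert a C" for v
  proof (cases "v = a")
    case True
    then show ?thesis using r'(2) by (simp add: o_def)
  next
    case False
    then have "(\<lambda>n. f (r n) v) \<longlonglongrightarrow> l v" using that r(2) by auto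
    from LIMSEQ_subseq_LIMSEQ[OF this r'(1)] False show ?thesis by (simp add: o_def)
  qed
  moreover have "strict_mono (\<lambda>n. r (r' n))"
    using r(1) r'(1) by (simp add: strict_mono_def)
  ultimately show ?case by blast
qed

text \<open>
  The transitive closure is taken without reflexivity, so that a single vertex with entry \<open>0\<close> is not
  irreducible. This matches the requirement that a component contains an edge.
\<close>

definition irreducible_on :: "'v set \<Rightarrow> ('v \<Rightarrow> 'v \<Rightarrow> real) \<Rightarrow> bool" where
  "irreducible_on C M \<longleftrightarrow> finite C \<and> C \<noteq> {} \<and> (\<forall>v\<in>C. \<forall>w\<in>C. 0 \<le> M v w) \<and>
     (\<forall>v\<in>C. \<forall>w\<in>C. (v, w) \<in> {(a, b). a \<in> C \<and> b \<in> C \<and> 0 < M a b}\<^sup>+)"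

definition mvec :: "'v set \<Rightarrow> ('v \<Rightarrow> 'v \<Rightarrow> real) \<Rightarrow> ('v \<Rightarrow> real) \<Rightarrow> 'v \<Rightarrow> real" where
  "mvec C M x v = (\<Sum>w\<in>C. M v w * x w)"

lemma mvec_scaleR: "mvec C M (\<lambda>w. c * x w) v = c * mvec C M x v"
  by (simp add: mvec_def sum_distrib_left mult.left_commute)

lemma mvec_add: "mvec C M (\<lambda>w. x w + y w) v = mvec C M x v + mvec C M y v"
  by (simp add: mvec_def sum.distrib distrib_left)

lemma mvec_diff: "mvec C M (\<lambda>w. x w - y w) v = mvec C M x v - mvec C M y v"
  by (simp add: mvec_def sum_subtractf right_diff_distrib)

lemma mvec_cong: "(\<And>w. w \<in> C \<Longrightarrow> x w = y w) \<Longrightarrow> mvec C M x v = mvec C M y v"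
  by (simp add: mvec_def)

lemma irreducible_onD:
  assumes "irreducible_on C M"
  shows "finite C" "C \<noteq> {}" "\<And>v w. v \<in> C \<Longrightarrow> w \<in> C \<Longrightarrow> 0 \<le> M v w"
  using assms by (auto simp: irreducible_on_def)

lemma irreducible_on_backward_closed:
  assumes M: "irreducible_on C M" and "w \<in> E" "w \<in> C"
    and step: "\<And>v w. v \<in> C \<Longrightarrow> w \<in> C \<Longrightarrow> 0 < M v w \<Longrightarrow> w \<in> E \<Longrightarrow> v \<in> E"
  shows "C \<subseteq> E"
proof
  fix v assume "v \<in> C"
  then have "(v, w) \<in> {(a, b). a \<in> C \<and> b \<in> C \<and> 0 < M a b}\<^sup>+"
    using assms by (auto simp: irreducible_on_def)
  then show "v \<in> E"
    by (induction rule: converse_trancl_induct) (use assms in auto)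
qed

lemma irreducible_on_forward_closed:
  assumes M: "irreducible_on C M" and "v \<in> E" "v \<in> C"
    and step: "\<And>v w. v \<in> C \<Longrightarrow> w \<in> C \<Longrightarrow> 0 < M v w \<Longrightarrow> v \<in> E \<Longrightarrow> w \<in> E"
  shows "C \<subseteq> E"
proof
  fix w assume "w \<in> C"
  then have "(v, w) \<in> {(a, b). a \<in> C \<and> b \<in> C \<and> 0 < M a b}\<^sup>+"
    using assms by (auto simp: irreducible_on_def)
  then show "w \<in> E"
    by (induction rule: trancl_induct) (use assms in auto)
qed

lemma irreducible_on_succ:
  assumes M: "irreducible_on C M" and "v \<in> C"
  obtains w where "w \<in> C" "0 < M v w"
proof -
  have "(v, v) \<in> {(a, b). a \<in> C \<and> b \<in> C \<and> 0 < M a b}\<^sup>+"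
    using assms by (auto simp: irreducible_on_def)
  then show thesis
    by (rule converse_tranclE) (use that in auto)
qed

lemma mvec_ge_entry:
  assumes M: "irreducible_on C M" and x: "\<And>v. v \<in> C \<Longrightarrow> 0 \<le> x v" and vw: "v \<in> C" "w \<in> C"
  shows "M v w * x w \<le> mvec C M x v"
  using member_le_sum[of w C "\<lambda>w. M v w * x w"] irreducible_onD[OF M] x vw by (auto simp: mvec_def)

lemma mvec_nonneg:
  assumes M: "irreducible_on C M" and x: "\<And>v. v \<in> C \<Longrightarrow> 0 \<le> x v" and v: "v \<in> C"
  shows "0 \<le> mvec C M x v"
  unfolding mvec_def using irreducible_onD[OF M] x v by (intro sum_nonneg mult_nonneg_nonneg) auto

lemma subinvariant_pos:
  assumes M: "irreducible_on C M" and x: "\<And>v. v \<in> C \<Longrightarrow> 0 \<le> x v"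
    and sub: "\<And>v. v \<in> C \<Longrightarrow> mvec C M x v \<le> l * x v"
    and w: "w \<in> C" "0 < x w" and v: "v \<in> C"
  shows "0 < x v"
proof -
  have "C \<subseteq> {v. 0 < x v}"
  proof (rule irreducible_on_backward_closed[OF M _ w(1)])
    fix v w assume vw: "v \<in> C" "w \<in> C" "0 < M v w" "w \<in> {v. 0 < x v}"
    then have "0 < M v w * x w" by simp
    also have "\<dots> \<le> mvec C M x v" using M x vw by (intro mvec_ge_entry) auto
    also have "\<dots> \<le> l * x v" using sub vw by auto
    finally have "x v \<noteq> 0" by auto
    with x[of v] vw show "v \<in> {v. 0 < x v}" by auto
  qed (use w in auto)
  with v show ?thesis by auto
qed

text \<open>
  Scale \<open>y\<close> to the smallest multiple \<open>cy\<close> above \<open>u\<close>. At a vertex where the two vectors touch, \<open>M(cy - u) \<le> 0\<close>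
  although \<open>cy - u \<ge> 0\<close>, so they also touch at all successors, and by irreducibility everywhere. All
  comparisons of spectral radii and all uniqueness statements below rest on this argument.
\<close>

lemma sub_super_invariant_proportional:
  assumes M: "irreducible_on C M"
    and y: "\<And>v. v \<in> C \<Longrightarrow> 0 < y v" "\<And>v. v \<in> C \<Longrightarrow> mvec C M y v \<le> y v"
    and u: "\<And>v. v \<in> C \<Longrightarrow> u v \<le> mvec C M u v" and w: "w \<in> C" "0 < u w"
  obtains c where "c > 0" "\<And>v. v \<in> C \<Longrightarrow> u v = c * y v" "\<And>v. v \<in> C \<Longrightarrow> mvec C M y v = y v"
proof -
  note C = irreducible_onD[OF M]
  define c where "c = Max ((\<lambda>v. u v / y v) ` C)"
  have "c \<in> (\<lambda>v. u v / y v) ` C"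
    unfolding c_def using C by (intro Max_in) auto
  then obtain i where i: "i \<in> C" "c = u i / y i" by auto
  then have i: "i \<in> C" "u i = c * y i" using y(1)[of i] by auto
  have le: "u v \<le> c * y v" if "v \<in> C" for v
  proof -
    have "u v / y v \<le> c" unfolding c_def using C that by (intro Max_ge) auto
    then show ?thesis using y(1)[OF that] by (simp add: field_simps)
  qed
  have c: "c > 0"
    using le[OF w(1)] w y(1)[OF w(1)] by (metis less_le_trans zero_less_mult_pos2)
  have "C \<subseteq> {v. u v = c * y v}"
  proof (rule irreducible_on_forward_closed[OF M _ i(1)])
    fix v w assume vw: "v \<in> C" "w \<in> C" "0 < M v w" "v \<in> {v. u v = c * y v}"
    have "c * mvec C M y v - mvec C M u v \<le> 0"
      using mult_left_mono[OF y(2)[OF vw(1)] less_imp_le[OF c]] u[OF vw(1)] vw(4) by simp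
    moreover have "c * mvec C M y v - mvec C M u v = mvec C M (\<lambda>w. c * y w - u w) v"
      by (simp add: mvec_diff mvec_scaleR)
    moreover have "M v w * (c * y w - u w) \<le> mvec C M (\<lambda>w. c * y w - u w) v"
      using M le vw by (intro mvec_ge_entry) auto
    ultimately have "M v w * (c * y w - u w) \<le> 0" by linarith
    then have "c * y w - u w \<le> 0" using vw(3) by (simp add: mult_le_0_iff)
    with le[OF vw(2)] show "w \<in> {v. u v = c * y v}" by auto
  qed (use i in auto)
  then have eq: "u v = c * y v" if "v \<in> C" for v using that by auto
  have "mvec C M y v = y v" if "v \<in> C" for v
  proof -
    have "mvec C M u v = mvec C M (\<lambda>v. c * y v) v" by (intro mvec_cong eq)
    then have "c * y v \<le> c * mvec C M y v" using u[OF that] eq[OF that] by (simp add: mvec_scaleR)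
    then show ?thesis using y(2)[OF that] c by auto
  qed
  with c eq show thesis by (rule that)
qed

lemma irreducible_on_scale:
  assumes "irreducible_on C M" "0 < k"
  shows "irreducible_on C (\<lambda>v w. M v w / k)"
proof -
  have "0 < M a b / k \<longleftrightarrow> 0 < M a b" for a b using assms(2) by (simp add: zero_less_divide_iff)
  with assms show ?thesis by (simp add: irreducible_on_def)
qed

lemma mvec_scale: "mvec C (\<lambda>v w. M v w / k) x v = mvec C M x v / k"
  by (simp add: mvec_def sum_divide_distrib)

lemma eigenvalue_le_subinvariant:
  assumes M: "irreducible_on C M"
    and x: "\<And>v. v \<in> C \<Longrightarrow> 0 < x v" "\<And>v. v \<in> C \<Longrightarrow> mvec C M x v = l * x v"
    and y: "\<And>v. v \<in> C \<Longrightarrow> 0 < y v" "\<And>v. v \<in> C \<Longrightarrow> mvec C M y v \<le> k * y v" and k: "0 < k"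
  shows "l \<le> k"
proof (rule ccontr)
  assume lk: "\<not> l \<le> k"
  obtain w where w: "w \<in> C" using irreducible_onD[OF M] by auto
  have s1: "mvec C (\<lambda>v w. M v w / k) y v \<le> y v" if "v \<in> C" for v
    using y(2)[OF that] k by (simp add: mvec_scale field_simps)
  have s2: "x v \<le> mvec C (\<lambda>v w. M v w / k) x v" if "v \<in> C" for v
    using x(2)[OF that] x(1)[OF that] k lk by (simp add: mvec_scale field_simps)
  obtain c where c: "0 < c" "\<And>v. v \<in> C \<Longrightarrow> x v = c * y v"
    "\<And>v. v \<in> C \<Longrightarrow> mvec C (\<lambda>v w. M v w / k) y v = y v"
    by (rule sub_super_invariant_proportional[OF irreducible_on_scale[OF M k], of y x w])
      (use x y w s1 s2 in auto)
  have "l * x w = mvec C M x w" using x w by simp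
  also have "\<dots> = mvec C M (\<lambda>v. c * y v) w" by (intro mvec_cong c(2))
  also have "\<dots> = c * mvec C M y w" by (rule mvec_scaleR)
  also have "\<dots> = k * x w" using c(3)[OF w] k c(2)[OF w] by (simp add: mvec_scale field_simps)
  finally show False using x(1)[OF w] lk by simp
qed

text \<open>Finiteness of \<open>C\<close> turns strict inequalities into a uniform gap.\<close>

lemma strictly_subinvariant_improve:
  assumes C: "finite C" "C \<noteq> {}"
    and y: "\<And>v. v \<in> C \<Longrightarrow> 0 < y v" "\<And>v. v \<in> C \<Longrightarrow> mvec C M y v < l * y v"
  obtains k where "k < l" "\<And>v. v \<in> C \<Longrightarrow> mvec C M y v \<le> k * y v"
proof
  define k where "k = Max ((\<lambda>v. mvec C M y v / y v) ` C)"
  have "k \<in> (\<lambda>v. mvec C M y v / y v) ` C"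
    unfolding k_def using C by (intro Max_in) auto
  then show "k < l" using y by (auto simp: field_simps)
  fix v assume v: "v \<in> C"
  have "mvec C M y v / y v \<le> k" unfolding k_def using C v by (intro Max_ge) auto
  then show "mvec C M y v \<le> k * y v" using y(1)[OF v] by (simp add: field_simps)
qed

text \<open>
  Take the least \<open>l\<close> for which \<open>Mx \<le> lx\<close> has a nonzero solution \<open>x \<ge> 0\<close>; it exists by compactness of the
  simplex. Among the solutions for this \<open>l\<close>, one with as many strict inequalities as possible cannot
  have strict inequalities everywhere, as \<open>l\<close> could then be decreased. It cannot have a nonempty proper
  set of them either, as \<open>x + Mx\<close> has strict inequalities at the predecessors as well. So it is an
  eigenvector.
\<close>

theorem perron_frobenius_ex:
  assumes M: "irreducible_on C M"
  obtains l x where "0 < l" "\<And>v. v \<in> C \<Longrightarrow> 0 < x v" "\<And>v. v \<in> C \<Longrightarrow> mvec C M x v = l * x v"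
proof -
  note C = irreducible_onD[OF M]
  define adm where "adm l x \<longleftrightarrow> (\<forall>v\<in>C. 0 \<le> x v) \<and> sum x C = 1 \<and> (\<forall>v\<in>C. mvec C M x v \<le> l * x v)"
    for l x
  define L where "L = {l. \<exists>x. adm l x}"
  have nonneg: "0 \<le> l" if "adm l x" for l x
  proof -
    have "0 \<le> (\<Sum>v\<in>C. mvec C M x v)"
      using that by (intro sum_nonneg mvec_nonneg[OF M]) (auto simp: adm_def)
    also have "\<dots> \<le> (\<Sum>v\<in>C. l * x v)" using that by (intro sum_mono) (auto simp: adm_def)
    also have "\<dots> = l" using that by (simp add: sum_distrib_left[symmetric] adm_def)
    finally show ?thesis .
  qed
  have admI: "\<exists>x. adm l x" if y: "\<forall>v\<in>C. 0 \<le> y v" "w \<in> C" "0 < y w" "\<forall>v\<in>C. mvec C M y v \<le> l * y v" for l y w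
  proof
    have s: "0 < sum y C" using y C by (intro sum_pos2[of C w]) auto
    have "mvec C M (\<lambda>v. y v / sum y C) v = mvec C M y v / sum y C" for v
      using mvec_scaleR[of C M "1 / sum y C" y v] by simp
    then show "adm l (\<lambda>v. y v / sum y C)"
      unfolding adm_def using s y by (simp add: sum_divide_distrib[symmetric] divide_right_mono)
  qed
  have L: "bdd_below L" unfolding L_def using nonneg by (intro bdd_belowI[of _ 0]) auto
  obtain w0 where w0: "w0 \<in> C" using C by auto
  have "L \<noteq> {}"
  proof -
    have "mvec C M (\<lambda>_. 1) v \<le> (\<Sum>v\<in>C. \<Sum>w\<in>C. M v w) * 1" if "v \<in> C" for v
      using that C member_le_sum[of v C "\<lambda>v. \<Sum>w\<in>C. M v w"] by (auto intro: sum_nonneg simp: mvec_def)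
    then have "\<exists>x. adm (\<Sum>v\<in>C. \<Sum>w\<in>C. M v w) x"
      using w0 by (intro admI[of "\<lambda>_. 1" w0]) auto
    then show ?thesis unfolding L_def by blast
  qed
  define l where "l = Inf L"
  have "\<exists>k x. k < l + 1 / real (Suc n) \<and> adm k x" for n
    using cInf_lessD[OF \<open>L \<noteq> {}\<close>, of "l + 1 / real (Suc n)"] by (auto simp: l_def L_def)
  then obtain k f where kf: "\<And>n. k n < l + 1 / real (Suc n)" "\<And>n. adm (k n) (f n)" by metis
  have kl: "l \<le> k n" for n
    unfolding l_def using kf(2) by (intro cInf_lower L) (auto simp: L_def)
  have "(\<lambda>n. l + 1 / real (Suc n)) \<longlonglongrightarrow> l + 0"
    by (intro tendsto_intros LIMSEQ_Suc lim_1_over_n)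
  then have k: "k \<longlonglongrightarrow> l"
    by (intro real_tendsto_sandwich[of "\<lambda>_. l" k sequentially "\<lambda>n. l + 1 / real (Suc n)" l])
      (use kl kf(1) in \<open>auto intro!: always_eventually less_imp_le\<close>)
  have "\<bar>f n v\<bar> \<le> 1" if "v \<in> C" for n v
    using kf(2)[of n] that C member_le_sum[of v C "f n"] by (auto simp: adm_def)
  then obtain r x where r: "strict_mono (r :: nat \<Rightarrow> nat)" and x: "\<forall>v\<in>C. (\<lambda>n. f (r n) v) \<longlonglongrightarrow> x v"
    using bounded_family_convergent_subseq[of C f 1] C by auto
  have kr: "(\<lambda>n. k (r n)) \<longlonglongrightarrow> l"
    using LIMSEQ_subseq_LIMSEQ[OF k r] by (simp add: o_def)
  have adm: "adm l x"
    unfolding adm_def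
  proof (intro conjI ballI)
    fix v assume v: "v \<in> C"
    show "0 \<le> x v"
      by (rule LIMSEQ_le_const[of "\<lambda>n. f (r n) v"]) (use x v kf(2) in \<open>auto simp: adm_def\<close>)
    show "mvec C M x v \<le> l * x v"
    proof (rule LIMSEQ_le)
      show "(\<lambda>n. mvec C M (f (r n)) v) \<longlonglongrightarrow> mvec C M x v"
        unfolding mvec_def using x by (intro tendsto_intros) auto
      show "(\<lambda>n. k (r n) * f (r n) v) \<longlonglongrightarrow> l * x v"
        using x v kr by (intro tendsto_intros) auto
    qed (use v kf(2) in \<open>auto simp: adm_def\<close>)
  next
    have "(\<lambda>n. sum (f (r n)) C) \<longlonglongrightarrow> sum x C"
      using x by (intro tendsto_intros) auto
    moreover have "sum (f (r n)) C = 1" for n using kf(2) by (auto simp: adm_def)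
    ultimately show "sum x C = 1" by (simp add: LIMSEQ_const_iff)
  qed
  \<comment> \<open>The strict inequalities in \<open>My \<le> ly\<close>, for the minimal \<open>l\<close>.\<close>
  define strict where "strict y = {v \<in> C. mvec C M y v < l * y v}" for y
  define sol where "sol y \<longleftrightarrow> (\<forall>v\<in>C. 0 < y v) \<and> (\<forall>v\<in>C. mvec C M y v \<le> l * y v)" for y
  have x_pos: "0 < x v" if "v \<in> C" for v
  proof -
    obtain w where "w \<in> C" "0 < x w"
    proof -
      have "\<exists>w\<in>C. x w \<noteq> 0"
      proof (rule ccontr)
        assume "\<not> ?thesis"
        then have "sum x C = 0" by (intro sum.neutral) auto
        with adm show False by (simp add: adm_def)
      qed
      then show thesis using adm that by (force simp: adm_def order.strict_iff_order)
    qed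
    with that adm show ?thesis
      by (intro subinvariant_pos[OF M, of x l w v]) (auto simp: adm_def)
  qed
  have l_pos: "0 < l"
  proof -
    obtain w where w: "w \<in> C" "0 < M w0 w" by (rule irreducible_on_succ[OF M w0])
    then have "0 < M w0 w * x w" using x_pos by simp
    also have "\<dots> \<le> mvec C M x w0" using M x_pos w w0 by (intro mvec_ge_entry) (auto intro: less_imp_le)
    also have "\<dots> \<le> l * x w0" using adm w0 by (auto simp: adm_def)
    finally show ?thesis using x_pos[OF w0] by (simp add: zero_less_mult_iff)
  qed
  have "sol x" using x_pos adm by (auto simp: sol_def adm_def)
  moreover have "\<forall>y. sol y \<longrightarrow> card (strict y) < Suc (card C)"
    using C by (auto simp: strict_def less_Suc_eq_le intro!: card_mono)
  ultimately have "\<exists>y. is_arg_max (\<lambda>y. card (strict y)) sol y"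
    using ex_has_greatest_nat[of sol x "\<lambda>y. card (strict y)" "Suc (card C)"]
    by (auto simp: is_arg_max_linorder)
  then obtain y where y: "sol y" and y_max: "\<And>z. sol z \<Longrightarrow> card (strict z) \<le> card (strict y)"
    by (auto simp: is_arg_max_linorder)
  define z where "z v = y v + mvec C M y v" for v
  have z: "mvec C M z v = mvec C M y v + mvec C M (mvec C M y) v" for v
    unfolding z_def by (rule mvec_add)
  have lz: "l * z v - mvec C M z v = (l * y v - mvec C M y v) + mvec C M (\<lambda>w. l * y w - mvec C M y w) v" for v
    unfolding z by (simp add: z_def mvec_diff mvec_scaleR algebra_simps)
  have d: "0 \<le> l * y w - mvec C M y w" if "w \<in> C" for w using y that by (auto simp: sol_def)
  have d2: "0 \<le> mvec C M (\<lambda>w. l * y w - mvec C M y w) v" if "v \<in> C" for v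
    using d that by (intro mvec_nonneg[OF M]) auto
  have "0 \<le> mvec C M y v" if "v \<in> C" for v
    using y that by (intro mvec_nonneg[OF M]) (auto simp: sol_def intro: less_imp_le)
  then have solz: "sol z"
    unfolding sol_def
  proof (intro conjI ballI)
    fix v assume "v \<in> C"
    then show "mvec C M z v \<le> l * z v" using lz[of v] d[of v] d2[of v] by linarith
  qed (use y in \<open>auto simp: sol_def z_def intro: add_pos_nonneg\<close>)
  have strict_sub: "strict y \<subseteq> strict z"
  proof
    fix v assume "v \<in> strict y"
    then have "v \<in> C" "0 < l * y v - mvec C M y v" by (auto simp: strict_def)
    then show "v \<in> strict z" using lz[of v] d2[of v] unfolding strict_def by simp
  qed
  then have strict_eq: "strict z = strict y"
    using y_max[OF solz] C by (intro card_seteq[symmetric]) (auto simp: strict_def)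
  have "strict y = {}"
  proof (rule ccontr)
    assume "strict y \<noteq> {}"
    then obtain w where w: "w \<in> strict y" by auto
    have "C \<subseteq> strict y"
    proof (rule irreducible_on_backward_closed[OF M w])
      fix v w assume vw: "v \<in> C" "w \<in> C" "0 < M v w" "w \<in> strict y"
      then have "0 < M v w * (l * y w - mvec C M y w)" by (simp add: strict_def)
      also have "\<dots> \<le> mvec C M (\<lambda>w. l * y w - mvec C M y w) v"
        using M d vw by (intro mvec_ge_entry) auto
      finally have "v \<in> strict z" using lz[of v] d[of v] vw(1) unfolding strict_def by simp
      then show "v \<in> strict y" by (simp add: strict_eq)
    qed (use w in \<open>auto simp: strict_def\<close>)
    then have "mvec C M y v < l * y v" if "v \<in> C" for v using that by (auto simp: strict_def)
    then obtain k where k: "k < l" "\<And>v. v \<in> C \<Longrightarrow> mvec C M y v \<le> k * y v"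
      using strictly_subinvariant_improve[of C y M l] C y by (auto simp: sol_def)
    have "\<exists>x. adm k x" using admI[of y w0 k] y k w0 by (auto simp: sol_def intro: less_imp_le)
    then have "l \<le> k" unfolding l_def using L by (intro cInf_lower) (auto simp: L_def)
    with k show False by simp
  qed
  show thesis
  proof (rule that[of l y])
    fix v assume v: "v \<in> C"
    have "v \<notin> strict y" using \<open>strict y = {}\<close> by simp
    then have "\<not> mvec C M y v < l * y v" using v by (simp add: strict_def)
    with y v show "mvec C M y v = l * y v" by (auto simp: sol_def)
  qed (use y l_pos in \<open>auto simp: sol_def\<close>)
qed

text \<open>
  If \<open>m\<close> is an eigenvalue with complex eigenvector \<open>z\<close>, then \<open>|m| |z| \<le> M|z|\<close>. For \<open>|m| > l\<close>, the touching argument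
  makes \<open>|z|\<close> a multiple of the positive eigenvector, and then \<open>|m| = l\<close>.
\<close>

theorem spectral_radius_eq:
  assumes M: "irreducible_on C M"
    and x: "\<And>v. v \<in> C \<Longrightarrow> 0 < x v" "\<And>v. v \<in> C \<Longrightarrow> mvec C M x v = l * x v" and l: "0 < l"
  shows "spectral_radius (restr_mat C M) = l"
proof -
  note C = irreducible_onD[OF M]
  define xs where "xs = (SOME xs. distinct xs \<and> set xs = C)"
  have "distinct xs \<and> set xs = C"
    unfolding xs_def by (rule someI_ex) (use finite_distinct_list[OF C(1)] in auto)
  then have xs: "distinct xs" "set xs = C" "length xs = card C" by (auto simp: distinct_card)
  define n where "n = card C"
  define B where "B = restr_mat C M"
  have B: "B = mat n n (\<lambda>(i, j). complex_of_real (M (xs ! i) (xs ! j)))"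
    by (simp add: B_def restr_mat_def n_def xs_def[symmetric] Let_def)
  have Bc: "B \<in> carrier_mat n n" by (simp add: B)
  have nth: "xs ! i \<in> C" if "i < n" for i using that xs(2,3) nth_mem[of i xs] by (simp add: n_def)
  have n: "0 < n" using C by (simp add: n_def card_gt_0_iff)
  have bij: "bij_betw (\<lambda>i. xs ! i) {0..<n} C"
    using xs by (intro bij_betw_nth) (auto simp: n_def)
  have Bv: "(B *\<^sub>v z) $ i = (\<Sum>j<n. complex_of_real (M (xs ! i) (xs ! j)) * z $ j)"
    if "i < n" "dim_vec z = n" for z i
    using that by (simp add: B scalar_prod_def lessThan_atLeast0)
  have sumC: "mvec C M u v = (\<Sum>j<n. M v (xs ! j) * u (xs ! j))" for u v
    using sum.reindex_bij_betw[OF bij, of "\<lambda>w. M v w * u w"] by (simp add: lessThan_atLeast0 mvec_def)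
  define z where "z = vec n (\<lambda>i. complex_of_real (x (xs ! i)))"
  have "eigenvector B z (complex_of_real l)"
    unfolding eigenvector_def
  proof (intro conjI)
    show "z \<in> carrier_vec (dim_row B)" by (simp add: z_def B)
    have "z $ 0 \<noteq> 0" using n x(1)[OF nth[OF n]] by (simp add: z_def)
    then show "z \<noteq> 0\<^sub>v (dim_row B)" using n by (auto simp: B)
    show "B *\<^sub>v z = complex_of_real l \<cdot>\<^sub>v z"
    proof (rule eq_vecI)
      fix i assume "i < dim_vec (complex_of_real l \<cdot>\<^sub>v z)"
      then have i: "i < n" by (simp add: z_def)
      have "(B *\<^sub>v z) $ i = complex_of_real (mvec C M x (xs ! i))"
        using i by (simp add: Bv z_def sumC del: of_real_mult) (simp add: of_real_mult)
      then show "(B *\<^sub>v z) $ i = (complex_of_real l \<cdot>\<^sub>v z) $ i"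
        using i by (simp add: x(2)[OF nth[OF i]] z_def)
    qed (simp add: z_def B)
  qed
  then have "complex_of_real l \<in> spectrum B"
    unfolding spectrum_def eigenvalue_def by blast
  then have "norm (complex_of_real l) \<in> norm ` spectrum B" by (rule imageI)
  then have mem: "l \<in> norm ` spectrum B" using l by simp
  have le: "norm m \<le> l" if m: "eigenvector B z m" for m z
  proof -
    have z: "dim_vec z = n" "z \<noteq> 0\<^sub>v n" using m by (auto simp: eigenvector_def B)
    define u where "u v = norm (z $ (THE i. i < n \<and> xs ! i = v))" for v
    have the: "(THE i. i < n \<and> xs ! i = xs ! j) = j" if "j < n" for j
      using that xs by (intro the_equality) (auto simp: n_def nth_eq_iff_index_eq)
    have u: "u (xs ! j) = norm (z $ j)" if "j < n" for j
      using that by (simp add: u_def the)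
    have sup: "norm m * u v \<le> mvec C M u v" if "v \<in> C" for v
    proof -
      have "v \<in> (!) xs ` {0..<n}" using bij that by (simp add: bij_betw_def)
      then obtain i where i: "i < n" "v = xs ! i" by auto
      have "norm m * u v = norm ((m \<cdot>\<^sub>v z) $ i)" using i z by (simp add: u norm_mult)
      also have "m \<cdot>\<^sub>v z = B *\<^sub>v z" using m by (simp add: eigenvector_def)
      also have "norm ((B *\<^sub>v z) $ i) \<le> (\<Sum>j<n. norm (complex_of_real (M (xs ! i) (xs ! j)) * z $ j))"
        unfolding Bv[OF i(1) z(1)] by (rule norm_sum)
      also have "\<dots> = mvec C M u v"
        unfolding sumC i(2) using i C(3) nth by (intro sum.cong) (auto simp: u norm_mult)
      finally show ?thesis .
    qed
    obtain i where i: "i < n" "z $ i \<noteq> 0"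
    proof (rule ccontr)
      assume "\<not> thesis"
      then have "z = 0\<^sub>v n" using that z(1) by (intro eq_vecI) auto
      with z(2) show False by simp
    qed
    define w where "w = xs ! i"
    have w: "w \<in> C" "0 < u w" using i nth by (auto simp: w_def u)
    show ?thesis
    proof (rule ccontr)
      assume lt: "\<not> norm m \<le> l"
      have "u v \<le> mvec C (\<lambda>v w. M v w / l) u v" if "v \<in> C" for v
      proof -
        have "0 \<le> u v" by (simp add: u_def)
        then have "l * u v \<le> norm m * u v" using lt by (intro mult_right_mono) auto
        then show ?thesis using sup[OF that] l by (simp add: mvec_scale field_simps)
      qed
      then obtain c where c: "0 < c" "\<And>v. v \<in> C \<Longrightarrow> u v = c * x v"
        using sub_super_invariant_proportional[OF irreducible_on_scale[OF M l], of x u w] w x l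
        by (auto simp: mvec_scale)
      have "mvec C M u w = mvec C M (\<lambda>v. c * x v) w" by (intro mvec_cong c(2))
      then have "mvec C M u w = c * mvec C M x w" by (simp add: mvec_scaleR)
      then have "mvec C M u w = l * u w" using x w c by simp
      with sup[OF w(1)] w lt show False by simp
    qed
  qed
  have "a \<le> l" if "a \<in> norm ` spectrum B" for a
    using that le by (auto simp: spectrum_def eigenvalue_def)
  then have "spectral_radius B = l"
    using spectral_radius_mem_max[OF Bc n] mem by (intro antisym) auto
  then show ?thesis by (simp add: B_def)
qed

lemma perron_frobenius:
  assumes M: "irreducible_on C M"
  obtains x where "0 < spectral_radius (restr_mat C M)" "\<And>v. v \<in> C \<Longrightarrow> 0 < x v"
    "\<And>v. v \<in> C \<Longrightarrow> mvec C M x v = spectral_radius (restr_mat C M) * x v"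
proof -
  obtain l x where lx: "0 < l" "\<And>v. v \<in> C \<Longrightarrow> 0 < x v" "\<And>v. v \<in> C \<Longrightarrow> mvec C M x v = l * x v"
    by (rule perron_frobenius_ex[OF M]) blast
  have "spectral_radius (restr_mat C M) = l" using spectral_radius_eq[OF M, of x l] lx by auto
  with lx that show thesis by auto
qed

lemma spectral_radius_le_subinvariant:
  assumes M: "irreducible_on C M"
    and y: "\<And>v. v \<in> C \<Longrightarrow> 0 < y v" "\<And>v. v \<in> C \<Longrightarrow> mvec C M y v \<le> k * y v" and k: "0 < k"
  shows "spectral_radius (restr_mat C M) \<le> k"
proof -
  obtain x where x: "\<And>v. v \<in> C \<Longrightarrow> 0 < x v"
    "\<And>v. v \<in> C \<Longrightarrow> mvec C M x v = spectral_radius (restr_mat C M) * x v"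
    by (rule perron_frobenius[OF M]) blast
  show ?thesis by (rule eigenvalue_le_subinvariant[OF M x y k])
qed

lemma spectral_radius_eq_1_subinvariant:
  assumes M: "irreducible_on C M" and 1: "spectral_radius (restr_mat C M) = 1"
    and y: "\<And>v. v \<in> C \<Longrightarrow> 0 < y v" "\<And>v. v \<in> C \<Longrightarrow> mvec C M y v \<le> y v"
    and v: "v \<in> C"
  shows "mvec C M y v = y v"
proof -
  obtain x where x: "\<And>v. v \<in> C \<Longrightarrow> 0 < x v" "\<And>v. v \<in> C \<Longrightarrow> mvec C M x v = x v"
    by (rule perron_frobenius[OF M]) (use 1 in auto)
  show ?thesis
    by (rule sub_super_invariant_proportional[OF M y, of x v]) (use x v in auto)
qed

section \<open>Projections in a \<open>C\<^sup>*\<close>-algebra\<close>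

context cstar_algebra
begin

lemma scale_zero_left: "x \<in> carrier A \<Longrightarrow> 0 \<odot> x = \<zero>"
  using cnorm_scale[of x 0] cnorm_eq_0[of "0 \<odot> x"] scale_closed[of x 0] by simp

lemma scale_left_commute: "x \<in> carrier A \<Longrightarrow> c \<odot> (d \<odot> x) = d \<odot> (c \<odot> x)"
  by (metis scale_scale mult.commute)

lemma scale_zero_right: "c \<odot> \<zero> = \<zero>"
  by (metis scale_zero_left scale_scale zero_closed mult_zero_right)

lemma add_neg_scale: "x \<in> carrier A \<Longrightarrow> x \<oplus> (- 1) \<odot> x = \<zero>"
  using scale_add_left[of x 1 "- 1"] by (simp add: scale_zero_left scale_one)

lemma neg_scale: "x \<in> carrier A \<Longrightarrow> (- 1) \<odot> x = \<ominus> x"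
  using add_neg_scale[of x] by (metis scale_closed minus_equality a_comm)

lemma add_neg_scale_eq_0: "x \<in> carrier A \<Longrightarrow> y \<in> carrier A \<Longrightarrow> x \<oplus> (- 1) \<odot> y = \<zero> \<Longrightarrow> x = y"
  by (metis neg_scale minus_equality minus_minus a_inv_closed)

lemma mult_zero_left: "x \<in> carrier A \<Longrightarrow> \<zero> \<otimes> x = \<zero>"
  by (metis scale_zero_left scale_mult_left zero_closed mult_closed)

lemma mult_zero_right: "x \<in> carrier A \<Longrightarrow> x \<otimes> \<zero> = \<zero>"
  by (metis scale_zero_left scale_mult_right zero_closed mult_closed)

lemma adj_zero: "adj A \<zero> = \<zero>"
  by (metis adj_scale scale_zero_left adj_closed zero_closed complex_cnj_zero)

lemma cnorm_zero: "cnorm A \<zero> = 0"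
  using cnorm_eq_0[OF zero_closed] by simp

lemma adj_mult_self_eq_0: "x \<in> carrier A \<Longrightarrow> adj A x \<otimes> x = \<zero> \<Longrightarrow> x = \<zero>"
  using cstar_identity[of x] cnorm_eq_0[of x] by (simp add: cnorm_zero)

lemma finsum_scale:
  assumes "finite I" "f \<in> I \<rightarrow> carrier A"
  shows "finsum A (\<lambda>i. c \<odot> f i) I = c \<odot> finsum A f I"
  using assms by (induction I) (auto simp: scale_zero_right scale_add_right scale_closed Pi_iff)

lemma finsum_mult_left:
  assumes "finite I" "f \<in> I \<rightarrow> carrier A" "x \<in> carrier A"
  shows "finsum A (\<lambda>i. x \<otimes> f i) I = x \<otimes> finsum A f I"
  using assms by (induction I) (auto simp: mult_zero_right distrib_left mult_closed Pi_iff)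

lemma finsum_mult_right:
  assumes "finite I" "f \<in> I \<rightarrow> carrier A" "x \<in> carrier A"
  shows "finsum A (\<lambda>i. f i \<otimes> x) I = finsum A f I \<otimes> x"
  using assms by (induction I) (auto simp: mult_zero_left distrib_right mult_closed Pi_iff)

lemma finsum_adj:
  assumes "finite I" "f \<in> I \<rightarrow> carrier A"
  shows "finsum A (\<lambda>i. adj A (f i)) I = adj A (finsum A f I)"
  using assms by (induction I) (auto simp: adj_zero adj_add adj_closed Pi_iff)

lemma cnorm_finsum:
  assumes "finite I" "f \<in> I \<rightarrow> carrier A"
  shows "cnorm A (finsum A f I) \<le> (\<Sum>i\<in>I. cnorm A (f i))"
  using assms
proof (induction I)
  case (insert i I)
  then have "cnorm A (finsum A f (insert i I)) = cnorm A (f i \<oplus> finsum A f I)" by simp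
  also have "\<dots> \<le> cnorm A (f i) + cnorm A (finsum A f I)"
    using insert by (intro cnorm_add) auto
  finally show ?case using insert by auto
qed (simp add: cnorm_zero)

lemma finsum_const:
  assumes "finite I" "x \<in> carrier A"
  shows "finsum A (\<lambda>i. x) I = of_nat (card I) \<odot> x"
  using assms by (induction I) (auto simp: scale_zero_left scale_add_left scale_one)

definition proj :: "'a \<Rightarrow> bool" where
  "proj p \<longleftrightarrow> p \<in> carrier A \<and> adj A p = p \<and> p \<otimes> p = p"

lemma projD: assumes "proj p" shows "p \<in> carrier A" "adj A p = p" "p \<otimes> p = p"
  using assms by (auto simp: proj_def)

lemma cnorm_proj: "proj p \<Longrightarrow> cnorm A p \<le> 1"
  using cstar_identity[of p] cnorm_nonneg[of p] by (auto simp: proj_def power2_eq_square)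

text \<open>
  The value at \<open>x\<close> of a polynomial of degree at most three; \<open>e\<close> plays the role of the unit.
\<close>

definition cubic :: "'a \<Rightarrow> 'a \<Rightarrow> complex \<Rightarrow> complex \<Rightarrow> complex \<Rightarrow> complex \<Rightarrow> 'a" where
  "cubic e x a b c d = a \<odot> e \<oplus> (b \<odot> x \<oplus> (c \<odot> (x \<otimes> x) \<oplus> d \<odot> (x \<otimes> (x \<otimes> x))))"

context
  fixes e x
  assumes e: "proj e" and x: "x \<in> carrier A" "adj A x = x" "e \<otimes> x = x" "x \<otimes> e = x"
begin

lemma cubic_closed: "cubic e x a b c d \<in> carrier A"
  using e x by (simp add: cubic_def proj_def scale_closed mult_closed)

lemma cubic_add: "cubic e x a b c d \<oplus> cubic e x a' b' c' d' = cubic e x (a + a') (b + b') (c + c') (d + d')"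
  using projD[OF e] x by (simp add: cubic_def scale_closed mult_closed scale_add_left a_ac)

lemma cubic_scale: "k \<odot> cubic e x a b c d = cubic e x (k * a) (k * b) (k * c) (k * d)"
  using projD[OF e] x by (simp add: cubic_def scale_closed mult_closed scale_add_right scale_scale)

lemma cubic_mult: "cubic e x a b c 0 \<otimes> cubic e x a' b' 0 0 = cubic e x (a * a') (a * b' + b * a') (b * b' + c * a') (c * b')"
  using projD[OF e] x
  by (simp add: cubic_def scale_closed mult_closed scale_add_right scale_add_left scale_zero_left
      scale_scale distrib_left distrib_right scale_mult_left scale_mult_right scale_left_commute a_ac mult_assoc)

lemma cubic_adj: "adj A (cubic e x a b c d) = cubic e x (cnj a) (cnj b) (cnj c) (cnj d)"
  using projD[OF e] x
  by (simp add: cubic_def scale_closed mult_closed adj_add adj_scale adj_mult mult_assoc)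

lemma cnorm_cubic_mult_le:
  assumes "cnorm A (cubic e x a b c 0) \<le> 1" "cnorm A (cubic e x a' b' 0 0) \<le> 1"
  shows "cnorm A (cubic e x (a * a') (a * b' + b * a') (b * b' + c * a') (c * b')) \<le> 1"
proof -
  have "cnorm A (cubic e x a b c 0 \<otimes> cubic e x a' b' 0 0) \<le> 1 * 1"
    using assms cnorm_mult[OF cubic_closed cubic_closed, of a b c 0 a' b' 0 0]
    by (meson mult_mono order_trans cnorm_nonneg cubic_closed zero_le_one)
  then show ?thesis by (simp add: cubic_mult)
qed

lemma cnorm_cubic_convex:
  assumes "cnorm A (cubic e x a b c d) \<le> 1" "cnorm A (cubic e x a' b' c' d') \<le> 1" "0 \<le> s" "s \<le> (1 :: real)"
  shows "cnorm A (cubic e x (s * a + (1 - s) * a') (s * b + (1 - s) * b') (s * c + (1 - s) * c') (s * d + (1 - s) * d')) \<le> 1"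
proof -
  have "cnorm A (complex_of_real s \<odot> cubic e x a b c d \<oplus> complex_of_real (1 - s) \<odot> cubic e x a' b' c' d')
      \<le> s * cnorm A (cubic e x a b c d) + (1 - s) * cnorm A (cubic e x a' b' c' d')"
    using cnorm_add[of "complex_of_real s \<odot> cubic e x a b c d" "complex_of_real (1 - s) \<odot> cubic e x a' b' c' d'"] assms(3,4)
    by (simp add: cnorm_scale cubic_closed scale_closed norm_of_real del: of_real_diff)
  also have "\<dots> \<le> 1" using assms by (intro convex_bound_le) auto
  finally show ?thesis by (simp add: cubic_add cubic_scale)
qed

text \<open>
  The factor \<open>3/2\<close> comes from \<open>3/4 (e + x)\<^sup>2 + 1/4 (e - 3x\<^sup>2) = e + 3/2 x\<close>, applied to \<open>tx\<close>. To bound the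
  second term, average the squares of \<open>e + x\<close> and \<open>e - x\<close> to see that \<open>e + x\<^sup>2\<close> is a contraction. By the
  \<open>C\<^sup>*\<close>-identity so are \<open>e + ix\<close> and \<open>e - ix\<close>, and the average of their cubes is \<open>e - 3x\<^sup>2\<close>.
\<close>

lemma cubic_expand:
  fixes t :: real
  assumes p: "cnorm A (cubic e x 1 t 0 0) \<le> 1" and m: "cnorm A (cubic e x 1 (- t) 0 0) \<le> 1"
  shows "cnorm A (cubic e x 1 (3 / 2 * t) 0 0) \<le> 1"
proof -
  have pp: "cnorm A (cubic e x 1 (2 * t) (t * t) 0) \<le> 1"
    using cnorm_cubic_mult_le[OF p p] by simp
  have mm: "cnorm A (cubic e x 1 (- (2 * t)) (t * t) 0) \<le> 1"
    using cnorm_cubic_mult_le[OF m m] by simp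
  have q: "cnorm A (cubic e x 1 0 (t * t) 0) \<le> 1"
    using cnorm_cubic_convex[OF pp mm, of "1/2"] by simp
  have im: "cnorm A (cubic e x 1 (\<i> * s) 0 0) \<le> 1" if "s * s = t * t" for s :: real
  proof -
    have "of_real s * of_real s = (of_real t * of_real t :: complex)"
      using that by (simp flip: of_real_mult)
    then have "adj A (cubic e x 1 (\<i> * s) 0 0) \<otimes> cubic e x 1 (\<i> * s) 0 0 = cubic e x 1 0 (t * t) 0"
      by (simp add: cubic_adj cubic_mult algebra_simps)
    then have "(cnorm A (cubic e x 1 (\<i> * s) 0 0))\<^sup>2 \<le> 1"
      using cstar_identity[OF cubic_closed, of 1 "\<i> * s" 0 0] q by simp
    then show ?thesis using power2_le_imp_le[of "cnorm A (cubic e x 1 (\<i> * s) 0 0)" 1] by simp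
  qed
  have cube: "cnorm A (cubic e x 1 (\<i> * (3 * s)) (- 3 * (s * s)) (- \<i> * (s * s * s))) \<le> 1" if "s * s = t * t" for s :: real
    using cnorm_cubic_mult_le[OF _ im[OF that], of 1 "2 * \<i> * s" "- (s * s)"]
      cnorm_cubic_mult_le[OF im im, OF that that] by (simp add: algebra_simps)
  have "cnorm A (cubic e x 1 0 (- 3 * (t * t)) 0) \<le> 1"
    using cnorm_cubic_convex[OF cube[of t] cube[of "- t"], of "1/2"] by (simp add: algebra_simps)
  from cnorm_cubic_convex[OF pp this, of "3/4"] show ?thesis by simp
qed

lemma cubic_linear: "cubic e x 1 b 0 0 = e \<oplus> b \<odot> x"
  using projD[OF e] x by (simp add: cubic_def scale_one scale_zero_left mult_closed scale_closed)

text \<open>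
  Iterating \<open>cubic_expand\<close> shows that all multiples \<open>(3/2)\<^sup>n x\<close> have norm at most \<open>1\<close>.
\<close>

theorem unit_extreme_point:
  assumes "cnorm A (e \<oplus> x) \<le> 1" "cnorm A (e \<oplus> (- 1) \<odot> x) \<le> 1"
  shows "x = \<zero>"
proof -
  have K: "cnorm A (cubic e x 1 ((3 / 2) ^ n) 0 0) \<le> 1 \<and> cnorm A (cubic e x 1 (- ((3 / 2) ^ n)) 0 0) \<le> 1" for n
  proof (induction n)
    case 0
    then show ?case using assms x by (simp add: cubic_linear scale_one)
  next
    case (Suc n)
    then show ?case
      using cubic_expand[of "(3 / 2) ^ n"] cubic_expand[of "- ((3 / 2) ^ n)"] by simp
  qed
  have bound: "(3 / 2) ^ n * cnorm A x \<le> 1" for n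
  proof -
    have "cnorm A (complex_of_real ((3 / 2) ^ n) \<odot> x) \<le> 1"
    proof -
      have "cubic e x 0 ((3 / 2) ^ n) 0 0 =
          (1 / 2) \<odot> cubic e x 1 ((3 / 2) ^ n) 0 0 \<oplus> (- 1 / 2) \<odot> cubic e x 1 (- ((3 / 2) ^ n)) 0 0"
        by (simp add: cubic_add cubic_scale)
      then have "cnorm A (cubic e x 0 ((3 / 2) ^ n) 0 0) \<le> 1 / 2 * 1 + 1 / 2 * 1"
        using K[of n] cnorm_add[of "(1 / 2) \<odot> cubic e x 1 ((3 / 2) ^ n) 0 0" "(- 1 / 2) \<odot> cubic e x 1 (- ((3 / 2) ^ n)) 0 0"]
        by (simp add: cnorm_scale cubic_closed scale_closed)
      moreover have "cubic e x 0 ((3 / 2) ^ n) 0 0 = complex_of_real ((3 / 2) ^ n) \<odot> x"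
        using projD[OF e] x by (simp add: cubic_def scale_zero_left mult_closed scale_closed)
      ultimately show ?thesis by simp
    qed
    then show ?thesis using x by (simp add: cnorm_scale norm_power)
  qed
  have "cnorm A x = 0"
  proof (rule ccontr)
    assume "cnorm A x \<noteq> 0"
    then have "0 < cnorm A x" using cnorm_nonneg[OF x(1)] by simp
    then obtain n where "1 / cnorm A x < (3 / 2) ^ n" using real_arch_pow[of "3 / 2"] by force
    then show False using bound[of n] \<open>0 < cnorm A x\<close> by (simp add: field_simps)
  qed
  then show ?thesis using cnorm_eq_0 x by simp
qed

end

text \<open>
  The condition \<open>\<parallel>e - h\<parallel> \<le> 1\<close> is a substitute for \<open>0 \<le> h \<le> 2e\<close>. With \<open>n\<close> the number of the other indices, it bounds
  \<open>ne - h k\<close>, and also \<open>ne + h k\<close>, because \<open>h k\<close> is minus the sum of the other \<open>h i\<close>. After division by \<open>n\<close>,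
  \<open>unit_extreme_point\<close> applies.
\<close>

lemma contractive_sum_zero:
  assumes e: "proj e" and I: "finite I"
    and h: "\<And>i. i \<in> I \<Longrightarrow> h i \<in> carrier A" "\<And>i. i \<in> I \<Longrightarrow> adj A (h i) = h i"
      "\<And>i. i \<in> I \<Longrightarrow> e \<otimes> h i = h i" "\<And>i. i \<in> I \<Longrightarrow> h i \<otimes> e = h i"
    and le: "\<And>i. i \<in> I \<Longrightarrow> cnorm A (e \<oplus> (- 1) \<odot> h i) \<le> 1"
    and sum: "finsum A h I = \<zero>" and k: "k \<in> I"
  shows "h k = \<zero>"
proof (cases "I = {k}")
  case True
  then show ?thesis using sum h(1) by simp
next
  case False
  note e' = projD[OF e]
  define n where "n = card (I - {k})"
  have fin: "finite (I - {k})" using I by simp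
  have "I - {k} \<noteq> {}" using False k by auto
  then have n: "0 < n" unfolding n_def card_gt_0_iff using fin by simp
  have hk: "h k \<in> carrier A" using h(1) k by simp
  have rest: "finsum A h (I - {k}) \<in> carrier A" using h by (intro finsum_closed) auto
  have "finsum A h I = h k \<oplus> finsum A h (I - {k})"
    using I k h(1) finsum_insert[of "I - {k}" k h] by (simp add: insert_absorb Pi_iff)
  then have "h k = (- 1) \<odot> finsum A h (I - {k})"
    using sum hk rest by (metis neg_scale minus_equality)
  moreover have "finsum A (\<lambda>i. e \<oplus> (- 1) \<odot> h i) (I - {k}) = of_nat n \<odot> e \<oplus> (- 1) \<odot> finsum A h (I - {k})"
    using h e' fin by (subst finsum_addf) (auto simp: n_def finsum_const finsum_scale scale_closed Pi_iff)
  ultimately have "of_nat n \<odot> e \<oplus> h k = finsum A (\<lambda>i. e \<oplus> (- 1) \<odot> h i) (I - {k})" by simp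
  also have "cnorm A \<dots> \<le> (\<Sum>i\<in>I - {k}. cnorm A (e \<oplus> (- 1) \<odot> h i))"
    using h e' fin by (intro cnorm_finsum) (auto simp: scale_closed)
  also have "\<dots> \<le> (\<Sum>i\<in>I - {k}. 1)" using le by (intro sum_mono) auto
  finally have up: "cnorm A (of_nat n \<odot> e \<oplus> h k) \<le> n" by (simp add: n_def)
  have "of_nat n \<odot> e = of_nat (n - 1) \<odot> e \<oplus> e"
    using n scale_add_left[of e "of_nat (n - 1)" 1] e' by (simp add: scale_one of_nat_diff)
  then have "of_nat n \<odot> e \<oplus> (- 1) \<odot> h k = of_nat (n - 1) \<odot> e \<oplus> (e \<oplus> (- 1) \<odot> h k)"
    using e' hk by (simp add: a_ac scale_closed)
  then have "cnorm A (of_nat n \<odot> e \<oplus> (- 1) \<odot> h k) \<le> cnorm A (of_nat (n - 1) \<odot> e) + cnorm A (e \<oplus> (- 1) \<odot> h k)"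
    using e' hk by (simp add: cnorm_add scale_closed)
  also have "\<dots> \<le> real (n - 1) * 1 + 1"
    using e' le[OF k] mult_left_mono[OF cnorm_proj[OF e], of "real (n - 1)"]
    by (intro add_mono) (auto simp: cnorm_scale)
  finally have down: "cnorm A (of_nat n \<odot> e \<oplus> (- 1) \<odot> h k) \<le> n" using n by (simp add: of_nat_diff)
  define c where "c = (1 / of_nat n :: complex)"
  have c: "c * of_nat n = 1" "cmod c * n = 1" using n by (auto simp: c_def norm_divide)
  have sc: "cnorm A (c \<odot> y) \<le> 1" if "cnorm A y \<le> n" "y \<in> carrier A" for y
    using mult_left_mono[OF that(1), of "cmod c"] that(2) c by (simp add: cnorm_scale)
  have "c \<odot> h k = \<zero>"
  proof (rule unit_extreme_point[OF e])
    have "c \<odot> (of_nat n \<odot> e \<oplus> h k) = e \<oplus> c \<odot> h k"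
      using e' hk c by (simp add: scale_add_right scale_closed scale_one flip: scale_scale)
    then show "cnorm A (e \<oplus> c \<odot> h k) \<le> 1"
      using sc[OF up] e' hk by (simp add: scale_closed)
    have "c \<odot> (of_nat n \<odot> e \<oplus> (- 1) \<odot> h k) = e \<oplus> (- 1) \<odot> (c \<odot> h k)"
      using e' hk c by (simp add: scale_add_right scale_closed scale_one flip: scale_scale)
    then show "cnorm A (e \<oplus> (- 1) \<odot> (c \<odot> h k)) \<le> 1"
      using sc[OF down] e' hk by (simp add: scale_closed)
  qed (use h k hk e' in \<open>auto simp: scale_closed adj_scale scale_mult_left scale_mult_right c_def\<close>)
  then show ?thesis
    using hk n by (metis cnorm_eq_0 cnorm_scale c(1) mult_eq_0_iff norm_eq_zero scale_closed zero_neq_one)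
qed

text \<open>
  With \<open>y = e - pe\<close> one has \<open>py = 0\<close>, hence \<open>y\<^sup>*y = ey\<close>. The \<open>C\<^sup>*\<close>-identity then gives \<open>\<parallel>y\<parallel>\<^sup>2 \<le> \<parallel>y\<parallel>\<close>.
\<close>

lemma compression_contractive:
  assumes e: "proj e" and p: "proj p"
  shows "adj A (e \<oplus> (- 1) \<odot> (p \<otimes> e)) \<otimes> (e \<oplus> (- 1) \<odot> (p \<otimes> e)) = e \<oplus> (- 1) \<odot> (e \<otimes> p \<otimes> e)"
    and "cnorm A (e \<oplus> (- 1) \<odot> (e \<otimes> p \<otimes> e)) \<le> 1"
proof -
  note e' = projD[OF e] and p' = projD[OF p]
  define y where "y = e \<oplus> (- 1) \<odot> (p \<otimes> e)"
  have pe: "p \<otimes> e \<in> carrier A" "e \<otimes> p \<in> carrier A" "e \<otimes> p \<otimes> e \<in> carrier A"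
    using e' p' by (auto intro: mult_closed)
  have y: "y \<in> carrier A" using e' pe by (simp add: y_def scale_closed)
  have adjy: "adj A y = e \<oplus> (- 1) \<odot> (e \<otimes> p)"
    using e' p' pe by (simp add: y_def adj_add adj_scale adj_mult scale_closed)
  have 1: "e \<otimes> y = e \<oplus> (- 1) \<odot> (e \<otimes> p \<otimes> e)"
    using e' p' pe by (simp add: y_def distrib_left scale_mult_right scale_closed mult_assoc)
  have "p \<otimes> (p \<otimes> e) = p \<otimes> e" using p' e' by (metis mult_assoc)
  then have "p \<otimes> y = p \<otimes> e \<oplus> (- 1) \<odot> (p \<otimes> e)"
    using e' p' pe by (simp add: y_def distrib_left scale_mult_right scale_closed)
  then have py: "p \<otimes> y = \<zero>" using pe by (simp add: add_neg_scale)
  have "adj A y \<otimes> y = e \<otimes> y \<oplus> (- 1) \<odot> (e \<otimes> (p \<otimes> y))"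
    unfolding adjy using e' p' pe y by (simp add: distrib_right scale_mult_left scale_closed mult_assoc)
  then have 2: "adj A y \<otimes> y = e \<otimes> y"
    using py e' y by (simp add: mult_zero_right scale_zero_right mult_closed)
  with 1 show "adj A (e \<oplus> (- 1) \<odot> (p \<otimes> e)) \<otimes> (e \<oplus> (- 1) \<odot> (p \<otimes> e)) = e \<oplus> (- 1) \<odot> (e \<otimes> p \<otimes> e)"
    by (simp add: y_def)
  have "(cnorm A y)\<^sup>2 = cnorm A (e \<otimes> y)" using cstar_identity[OF y] 2 by simp
  also have "\<dots> \<le> cnorm A e * cnorm A y" using e' y by (intro cnorm_mult) auto
  also have "\<dots> \<le> 1 * cnorm A y" using cnorm_proj[OF e] cnorm_nonneg[OF y] by (rule mult_right_mono)
  finally have le1: "cnorm A y \<le> 1" using cnorm_nonneg[OF y]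
    by (cases "cnorm A y = 0") (auto simp: power2_eq_square)
  have "cnorm A (e \<otimes> y) = (cnorm A y)\<^sup>2" using cstar_identity[OF y] 2 by simp
  also have "\<dots> \<le> 1" using le1 cnorm_nonneg[OF y] by (simp add: power_le_one)
  finally show "cnorm A (e \<oplus> (- 1) \<odot> (e \<otimes> p \<otimes> e)) \<le> 1" by (simp add: 1)
qed

text \<open>
  With \<open>e = p i\<close>, compressing \<open>q = \<Sum>p j\<close> by \<open>e\<close> yields \<open>(e - eqe) + \<Sum>\<^sub>j\<^sub>\<noteq>\<^sub>i e p\<^sub>j e = 0\<close>. Every summand \<open>h\<close> has the form
  \<open>y\<^sup>*y\<close> and satisfies \<open>\<parallel>e - h\<parallel> \<le> 1\<close>, so all of them vanish, and so do the \<open>y\<close>, which are \<open>e - qe\<close> and \<open>p\<^sub>j e\<close>.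
\<close>

theorem projections_sum_orthogonal:
  assumes J: "finite J" and p: "\<And>j. j \<in> J \<Longrightarrow> proj (p j)" and q: "proj q" "q = finsum A p J" and i: "i \<in> J"
  shows "q \<otimes> p i = p i" and "\<And>j. j \<in> J \<Longrightarrow> j \<noteq> i \<Longrightarrow> p j \<otimes> p i = \<zero>"
proof -
  define e where "e = p i"
  have e: "proj e" using p i by (simp add: e_def)
  note e' = projD[OF e] and q' = projD[OF q(1)]
  have p': "p j \<in> carrier A" "adj A (p j) = p j" "p j \<otimes> p j = p j" if "j \<in> J" for j
    using projD[OF p[OF that]] by auto
  define h where "h j = (if j = i then e \<oplus> (- 1) \<odot> (e \<otimes> q \<otimes> e) else e \<otimes> p j \<otimes> e)" for j
  have eqe: "e \<otimes> q \<otimes> e \<in> carrier A" using e' q' by (auto intro: mult_closed)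
  have epe: "e \<otimes> p j \<otimes> e \<in> carrier A" if "j \<in> J" for j using e' p'[OF that] by (auto intro: mult_closed)
  have hc: "h j \<in> carrier A" if "j \<in> J" for j
    using that e' eqe epe by (auto simp: h_def scale_closed)
  have sandwich: "e \<otimes> (e \<otimes> x \<otimes> e) = e \<otimes> x \<otimes> e" "(e \<otimes> x \<otimes> e) \<otimes> e = e \<otimes> x \<otimes> e"
    if "x \<in> carrier A" for x
    using that e' by (simp_all add: mult_closed mult_assoc) (simp add: mult_closed flip: mult_assoc)
  have adj_sandwich: "adj A (e \<otimes> x \<otimes> e) = e \<otimes> x \<otimes> e" if "proj x" for x
    using projD[OF that] e' by (simp add: adj_mult mult_closed mult_assoc)
  have zero: "h k = \<zero>" if k: "k \<in> J" for k
  proof (rule contractive_sum_zero[OF e J _ _ _ _ _ _ k, of h])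
    fix j assume j: "j \<in> J"
    show "h j \<in> carrier A" using hc[OF j] .
    show "adj A (h j) = h j"
      using e' q j p eqe epe by (simp add: h_def adj_add adj_scale adj_sandwich scale_closed)
    show "e \<otimes> h j = h j" "h j \<otimes> e = h j"
      using e' q' p' j eqe epe
      by (auto simp: h_def distrib_left distrib_right scale_mult_right scale_mult_left sandwich scale_closed)
    show "cnorm A (e \<oplus> (- 1) \<odot> h j) \<le> 1"
    proof (cases "j = i")
      case True
      have "e \<oplus> (- 1) \<odot> h j = e \<oplus> ((- 1) \<odot> e \<oplus> e \<otimes> q \<otimes> e)"
        using True e' eqe by (simp add: h_def scale_add_right scale_closed scale_one flip: scale_scale)
      also have "\<dots> = e \<otimes> q \<otimes> e" using e' eqe
        by (simp add: scale_closed add_neg_scale flip: a_assoc)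
      also have "cnorm A \<dots> \<le> cnorm A (e \<otimes> q) * cnorm A e" using e' q' by (intro cnorm_mult mult_closed)
      also have "\<dots> \<le> (cnorm A e * cnorm A q) * cnorm A e"
        using e' q' by (intro mult_right_mono cnorm_mult cnorm_nonneg)
      also have "\<dots> \<le> (1 * 1) * 1"
        using e' q' cnorm_proj[OF e] cnorm_proj[OF q(1)] by (intro mult_mono cnorm_nonneg) auto
      finally show ?thesis by simp
    next
      case False
      then show ?thesis using compression_contractive(2)[OF e p[OF j]] by (simp add: h_def)
    qed
  next
    have fin: "finite (J - {i})" using J by simp
    have q_eq: "q = p i \<oplus> finsum A p (J - {i})"
      using J i p'(1) finsum_insert[of "J - {i}" i p] q(2) by (simp add: insert_absorb Pi_iff)
    have c: "finsum A p (J - {i}) \<in> carrier A" using p' by (intro finsum_closed) auto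
    have "e \<otimes> q \<otimes> e = e \<oplus> e \<otimes> finsum A p (J - {i}) \<otimes> e"
      unfolding q_eq e_def[symmetric] using e' c by (simp add: distrib_left distrib_right mult_closed)
    also have "e \<otimes> finsum A p (J - {i}) \<otimes> e = finsum A (\<lambda>j. e \<otimes> p j \<otimes> e) (J - {i})"
    proof -
      have "finsum A (\<lambda>j. e \<otimes> p j \<otimes> e) (J - {i}) = finsum A (\<lambda>j. e \<otimes> p j) (J - {i}) \<otimes> e"
        using e' p' fin by (intro finsum_mult_right) (auto intro: mult_closed)
      also have "finsum A (\<lambda>j. e \<otimes> p j) (J - {i}) = e \<otimes> finsum A p (J - {i})"
        using e' p' fin by (intro finsum_mult_left) auto
      finally show ?thesis by (rule sym)
    qed
    also have "finsum A (\<lambda>j. e \<otimes> p j \<otimes> e) (J - {i}) = finsum A h (J - {i})"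
      using epe by (intro finsum_cong') (auto simp: h_def hc)
    finally have eqe_eq: "e \<otimes> q \<otimes> e = e \<oplus> finsum A h (J - {i})" .
    have hJ: "finsum A h J = h i \<oplus> finsum A h (J - {i})"
      using J i hc finsum_insert[of "J - {i}" i h] by (simp add: insert_absorb Pi_iff)
    have c2: "finsum A h (J - {i}) \<in> carrier A"
      using hc by (intro finsum_closed) auto
    have "finsum A h J = e \<oplus> (- 1) \<odot> (e \<oplus> finsum A h (J - {i})) \<oplus> finsum A h (J - {i})"
      unfolding hJ by (simp only: h_def eqe_eq simp_thms if_True)
    also have "\<dots> = (e \<oplus> finsum A h (J - {i})) \<oplus> (- 1) \<odot> (e \<oplus> finsum A h (J - {i}))"
      using e' c2 by (simp add: a_ac scale_closed)
    also have "\<dots> = \<zero>" using e' c2 by (intro add_neg_scale) auto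
    finally show "finsum A h J = \<zero>" .
  qed
  have "e \<oplus> (- 1) \<odot> (q \<otimes> e) = \<zero>"
    by (rule adj_mult_self_eq_0)
      (use zero[OF i] compression_contractive(1)[OF e q(1)] e' q' in \<open>auto simp: h_def scale_closed mult_closed\<close>)
  then show "q \<otimes> p i = p i"
    using add_neg_scale_eq_0[of e "q \<otimes> e"] e' q' by (simp add: e_def mult_closed)
  fix j assume j: "j \<in> J" "j \<noteq> i"
  have "adj A (p j \<otimes> e) \<otimes> (p j \<otimes> e) = e \<otimes> (p j \<otimes> p j) \<otimes> e"
    using e' p'(1,2)[OF j(1)] by (simp add: adj_mult mult_closed mult_assoc)
  then have "adj A (p j \<otimes> e) \<otimes> (p j \<otimes> e) = \<zero>"
    using zero[OF j(1)] j(2) p'(3)[OF j(1)] by (simp add: h_def)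
  moreover have "p j \<otimes> e \<in> carrier A" using e'(1) p'(1)[OF j(1)] by (rule mult_closed[rotated])
  ultimately have "p j \<otimes> e = \<zero>" by (rule adj_mult_self_eq_0[rotated])
  then show "p j \<otimes> p i = \<zero>" unfolding e_def .
qed

section \<open>States\<close>

text \<open>
  Write \<open>s = \<phi>(u)\<close>. For \<open>x\<close> in the unit ball, positivity of \<open>\<phi>\<close> at \<open>x - \<phi>(x)u\<close> gives
  \<open>|\<phi>(x)|\<^sup>2 (2 - s) \<le> 1\<close>. If \<open>s < 1\<close>, this keeps \<open>|\<phi>|\<close> away from \<open>1\<close> on the unit ball.
\<close>

lemma state_unit:
  assumes st: "state A \<phi>" and u: "proj u" and neutral: "\<And>x. x \<in> carrier A \<Longrightarrow> u \<otimes> x = x" "\<And>x. x \<in> carrier A \<Longrightarrow> x \<otimes> u = x"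
  shows "\<phi> u = 1"
proof -
  note u' = projD[OF u]
  let ?U = "{x \<in> carrier A. cnorm A x \<le> 1}"
  have add: "\<phi> (x \<oplus> y) = \<phi> x + \<phi> y" if "x \<in> carrier A" "y \<in> carrier A" for x y
    using st that by (auto simp: state_def)
  have scale: "\<phi> (c \<odot> x) = c * \<phi> x" if "x \<in> carrier A" for c x
    using st that by (auto simp: state_def)
  have pos: "\<phi> (adj A x \<otimes> x) \<in> \<real>\<^sub>\<ge>\<^sub>0" if "x \<in> carrier A" for x
    using st that by (auto simp: state_def)
  have bdd: "bdd_above ((\<lambda>x. cmod (\<phi> x)) ` ?U)" and sup: "(SUP x\<in>?U. cmod (\<phi> x)) = 1"
    using st by (auto simp: state_def)
  have le1: "cmod (\<phi> x) \<le> 1" if "x \<in> carrier A" "cnorm A x \<le> 1" for x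
    using cSUP_upper[OF _ bdd, of x] sup that by auto
  define s where "s = Re (\<phi> u)"
  have phi_u: "\<phi> u = of_real s" "0 \<le> s"
    using pos[OF u'(1)] u' by (auto simp: s_def nonneg_Reals_def)
  have expand: "\<phi> (adj A (x \<oplus> t \<odot> u) \<otimes> (x \<oplus> t \<odot> u)) =
      \<phi> (adj A x \<otimes> x) + t * \<phi> (adj A x) + cnj t * \<phi> x + cnj t * t * s" if x: "x \<in> carrier A" for x t
  proof -
    have "adj A (x \<oplus> t \<odot> u) \<otimes> (x \<oplus> t \<odot> u) =
        (adj A x \<otimes> x \<oplus> t \<odot> adj A x) \<oplus> (cnj t \<odot> x \<oplus> cnj t \<odot> (t \<odot> u))"
      using x u' neutral adj_closed[OF x]
      by (simp add: adj_add adj_scale scale_closed mult_closed distrib_left distrib_right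
          scale_mult_left scale_mult_right scale_add_right scale_left_commute a_ac)
    then show ?thesis
      using x u' adj_closed[OF x] by (simp add: add scale scale_closed mult_closed phi_u)
  qed
  have herm: "\<phi> (adj A x) = cnj (\<phi> x)" if x: "x \<in> carrier A" for x
  proof -
    have im: "Im (\<phi> (adj A x \<otimes> x)) = 0" using pos[OF x] by (auto simp: nonneg_Reals_def)
    have "Im (\<phi> (adj A (x \<oplus> t \<odot> u) \<otimes> (x \<oplus> t \<odot> u))) = 0" for t
      using pos[of "x \<oplus> t \<odot> u"] x u' by (auto simp: nonneg_Reals_def scale_closed)
    from this[of 1] this[of \<i>] show ?thesis
      unfolding expand[OF x] using im by (simp add: complex_eq_iff)
  qed
  have ineq: "(cmod (\<phi> x))\<^sup>2 * (2 - s) \<le> 1" if x: "x \<in> carrier A" "cnorm A x \<le> 1" for x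
  proof -
    define a where "a = (cmod (\<phi> x))\<^sup>2"
    have "cnorm A (adj A x \<otimes> x) \<le> 1"
      unfolding cstar_identity[OF x(1)] using x(2) cnorm_nonneg[OF x(1)] by (rule power_le_one[rotated])
    then have m: "Re (\<phi> (adj A x \<otimes> x)) \<le> 1"
      using le1[of "adj A x \<otimes> x"] x complex_Re_le_cmod[of "\<phi> (adj A x \<otimes> x)"] by (simp add: mult_closed adj_closed)
    have a: "cnj (\<phi> x) * \<phi> x = of_real a"
      by (simp add: a_def complex_norm_square[symmetric] mult.commute)
    have "0 \<le> Re (\<phi> (adj A (x \<oplus> (- \<phi> x) \<odot> u) \<otimes> (x \<oplus> (- \<phi> x) \<odot> u)))"
      using pos[of "x \<oplus> (- \<phi> x) \<odot> u"] x u' by (auto simp: nonneg_Reals_def scale_closed)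
    also have "\<dots> = Re (\<phi> (adj A x \<otimes> x)) - a - a + a * s"
      unfolding expand[OF x(1)] herm[OF x(1)] using a by (simp add: mult.commute[of "\<phi> x"] flip: minus_mult_left)
    finally show ?thesis using m by (simp add: a_def algebra_simps)
  qed
  have "s \<le> 1" using le1[OF u'(1) cnorm_proj[OF u]] phi_u by simp
  moreover have "\<not> s < 1"
  proof
    assume s: "s < 1"
    have "cmod (\<phi> x) \<le> sqrt (1 / (2 - s))" if "x \<in> ?U" for x
      using ineq[of x] that s by (intro real_le_rsqrt) (simp add: field_simps)
    moreover have "\<zero> \<in> ?U" by (simp add: cnorm_zero)
    then have "?U \<noteq> {}" by blast
    ultimately have "(SUP x\<in>?U. cmod (\<phi> x)) \<le> sqrt (1 / (2 - s))"
      by (intro cSUP_least) auto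
    also have "\<dots> < 1" using s by (simp add: real_sqrt_less_iff)
    finally show False using sup by simp
  qed
  ultimately show ?thesis using phi_u by simp
qed

end

section \<open>Cuntz-Krieger families\<close>

lemma path_elem_Cons: "path_elem A P S (u, e # es) = path_elem A P S (v, e # es)"
  by (induction es arbitrary: e) auto

locale ck_algebra = cstar_algebra A + G: fin_digraph G
  for A :: "'a cstar" (structure) and G :: "('v, 'e) pre_digraph" +
  fixes P :: "'v \<Rightarrow> 'a" and S :: "'e \<Rightarrow> 'a"
  assumes ck: "ck_family G A P S"
begin

lemma P_proj: "v \<in> verts G \<Longrightarrow> proj (P v)"
  and P_orth: "v \<in> verts G \<Longrightarrow> w \<in> verts G \<Longrightarrow> v \<noteq> w \<Longrightarrow> P v \<otimes> P w = \<zero>"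
  and S_closed: "e \<in> arcs G \<Longrightarrow> S e \<in> carrier A"
  and S_partial: "e \<in> arcs G \<Longrightarrow> S e \<otimes> adj A (S e) \<otimes> S e = S e"
  and S_initial: "e \<in> arcs G \<Longrightarrow> adj A (S e) \<otimes> S e = P (head G e)"
  and P_final: "v \<in> verts G \<Longrightarrow> \<not> sink G v \<Longrightarrow> P v = (\<Oplus>e\<in>out_arcs G v. S e \<otimes> adj A (S e))"
  using ck by (auto simp: ck_family_def proj_def)

lemma P_closed: "v \<in> verts G \<Longrightarrow> P v \<in> carrier A"
  using P_proj by (simp add: proj_def)

lemma S_mult_range: "e \<in> arcs G \<Longrightarrow> S e \<otimes> P (head G e) = S e"
  using S_partial[of e] S_initial[of e] S_closed[of e] adj_closed[OF S_closed, of e]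
  by (simp add: mult_assoc)

lemma final_proj: "e \<in> arcs G \<Longrightarrow> proj (S e \<otimes> adj A (S e))"
  using S_closed[of e] adj_closed[OF S_closed, of e] S_partial[of e]
  by (simp add: proj_def mult_closed adj_mult adj_adj flip: mult_assoc)

lemma S_mult_source:
  assumes e: "e \<in> arcs G"
  shows "P (tail G e) \<otimes> S e = S e"
proof -
  have v: "tail G e \<in> verts G" "\<not> sink G (tail G e)" "e \<in> out_arcs G (tail G e)"
    using e by (auto simp: sink_def out_arcs_def)
  have Se: "S e \<in> carrier A" "adj A (S e) \<in> carrier A" using S_closed[OF e] by (auto intro: adj_closed)
  have "P (tail G e) \<otimes> (S e \<otimes> adj A (S e)) = S e \<otimes> adj A (S e)"
    by (rule projections_sum_orthogonal(1)[where J = "out_arcs G (tail G e)" and p = "\<lambda>e. S e \<otimes> adj A (S e)"])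
      (use v P_proj[OF v(1)] P_final[OF v(1,2)] final_proj in \<open>auto simp: G.finite_out_arcs\<close>)
  then have "P (tail G e) \<otimes> (S e \<otimes> adj A (S e)) \<otimes> S e = S e \<otimes> adj A (S e) \<otimes> S e" by simp
  then show ?thesis
    using Se P_closed[OF v(1)] S_partial[OF e] by (simp add: mult_assoc mult_closed)
qed

text \<open>
  For equal sources the final projections are orthogonal, being summands of the vertex projection; for
  different sources they lie under orthogonal vertex projections.
\<close>

lemma S_orth:
  assumes e: "e \<in> arcs G" "f \<in> arcs G" "e \<noteq> f"
  shows "adj A (S e) \<otimes> S f = \<zero>"
proof -
  note c = S_closed[OF e(1)] S_closed[OF e(2)]
  note c' = adj_closed[OF c(1)] adj_closed[OF c(2)]
  show ?thesis
  proof (cases "tail G e = tail G f")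
    case True
    have v: "tail G f \<in> verts G" "\<not> sink G (tail G f)" "f \<in> out_arcs G (tail G f)" "e \<in> out_arcs G (tail G f)"
      using e True by (auto simp: sink_def out_arcs_def)
    have "(S e \<otimes> adj A (S e)) \<otimes> (S f \<otimes> adj A (S f)) = \<zero>"
      by (rule projections_sum_orthogonal(2)[where J = "out_arcs G (tail G f)" and p = "\<lambda>e. S e \<otimes> adj A (S e)" and q = "P (tail G f)"])
        (use v e P_proj[OF v(1)] P_final[OF v(1,2)] final_proj in \<open>auto simp: G.finite_out_arcs\<close>)
    then have "adj A (S e) \<otimes> ((S e \<otimes> adj A (S e)) \<otimes> (S f \<otimes> adj A (S f))) \<otimes> S f = \<zero>"
      using c c' by (simp add: mult_zero_left mult_zero_right)
    moreover have "adj A (S e) \<otimes> ((S e \<otimes> adj A (S e)) \<otimes> (S f \<otimes> adj A (S f))) \<otimes> S f =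
        adj A (S e \<otimes> adj A (S e) \<otimes> S e) \<otimes> (S f \<otimes> adj A (S f) \<otimes> S f)"
      using c c' by (simp add: adj_mult adj_adj mult_closed mult_assoc)
    ultimately show ?thesis using S_partial e by simp
  next
    case False
    have "adj A (S e) \<otimes> S f = adj A (P (tail G e) \<otimes> S e) \<otimes> (P (tail G f) \<otimes> S f)"
      using S_mult_source e by simp
    also have "\<dots> = adj A (S e) \<otimes> (P (tail G e) \<otimes> P (tail G f)) \<otimes> S f"
      using c c' P_closed e projD(2)[OF P_proj] by (simp add: adj_mult mult_closed mult_assoc)
    also have "\<dots> = \<zero>" using P_orth[OF _ _ False] e c c' by (simp add: mult_zero_left mult_zero_right)
    finally show ?thesis .
  qed
qed

abbreviation spath :: "'v \<Rightarrow> 'e list \<Rightarrow> 'a" where "spath u p \<equiv> path_elem A P S (u, p)"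

lemma spath_Cons:
  assumes "G.awalk u (e # es) w"
  shows "spath u (e # es) = S e \<otimes> spath (head G e) es"
proof (cases es)
  case Nil
  then show ?thesis using S_mult_range assms by (auto simp: G.awalk_Cons_iff)
next
  case (Cons f fs)
  then show ?thesis using path_elem_Cons[of A P S u f fs "head G e"] by simp
qed

lemma spath_props:
  assumes "G.awalk u p w"
  shows "spath u p \<in> carrier A \<and> spath u p \<otimes> P w = spath u p \<and> P u \<otimes> spath u p = spath u p \<and>
    adj A (spath u p) \<otimes> spath u p = P w"
  using assms
proof (induction p arbitrary: u)
  case Nil
  then show ?case using P_proj[of u] by (auto simp: G.awalk_Nil_iff proj_def)
next
  case (Cons e es)
  then have e: "e \<in> arcs G" "G.awalk (head G e) es w" "u = tail G e" by (auto simp: G.awalk_Cons_iff)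
  note IH = Cons.IH[OF e(2)]
  have w: "w \<in> verts G" using e(2) by (rule G.awalk_last_in_verts)
  have Se: "S e \<in> carrier A" "adj A (S e) \<in> carrier A" using S_closed[OF e(1)] by (auto intro: adj_closed)
  have c: "spath (head G e) es \<in> carrier A" using IH by simp
  note eq = spath_Cons[OF Cons.prems]
  have "adj A (spath u (e # es)) \<otimes> spath u (e # es) =
      adj A (spath (head G e) es) \<otimes> ((adj A (S e) \<otimes> S e) \<otimes> spath (head G e) es)"
    unfolding eq using Se c by (simp add: adj_mult mult_closed adj_closed mult_assoc)
  then have "adj A (spath u (e # es)) \<otimes> spath u (e # es) = P w"
    using IH S_initial[OF e(1)] by simp
  moreover have "P u \<otimes> (S e \<otimes> spath (head G e) es) = S e \<otimes> spath (head G e) es"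
    using S_mult_source[OF e(1)] Se c P_closed[of u] e by (simp flip: mult_assoc)
  ultimately show ?case
    using IH Se P_closed[OF w] c by (simp add: eq mult_closed mult_assoc)
qed

lemma spath_orth:
  assumes "G.awalk u p w" "G.awalk u' p' w'" "length p = length p'" "(u, p) \<noteq> (u', p')"
  shows "adj A (spath u p) \<otimes> spath u' p' = \<zero>"
  using assms(3,1,2,4)
proof (induction p p' arbitrary: u u' rule: list_induct2)
  case Nil
  then show ?case using P_orth[of u u'] projD(2)[OF P_proj] by (auto simp: G.awalk_Nil_iff)
next
  case (Cons e es f fs)
  then have e: "e \<in> arcs G" "G.awalk (head G e) es w" "u = tail G e"
    and f: "f \<in> arcs G" "G.awalk (head G f) fs w'" "u' = tail G f" by (auto simp: G.awalk_Cons_iff)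
  have c: "spath (head G e) es \<in> carrier A" "spath (head G f) fs \<in> carrier A"
    using spath_props[OF e(2)] spath_props[OF f(2)] by auto
  have Se: "S e \<in> carrier A" "adj A (S e) \<in> carrier A" "S f \<in> carrier A"
    using S_closed[OF e(1)] S_closed[OF f(1)] by (auto intro: adj_closed)
  have eq: "adj A (spath u (e # es)) \<otimes> spath u' (f # fs) =
      adj A (spath (head G e) es) \<otimes> ((adj A (S e) \<otimes> S f) \<otimes> spath (head G f) fs)"
    unfolding spath_Cons[OF Cons.prems(1)] spath_Cons[OF Cons.prems(2)]
    using Se c by (simp add: adj_mult mult_closed adj_closed mult_assoc)
  show ?case
  proof (cases "e = f")
    case True
    then have "adj A (spath u (e # es)) \<otimes> spath u' (f # fs) = adj A (spath (head G e) es) \<otimes> spath (head G f) fs"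
      using eq S_initial[OF f(1)] spath_props[OF f(2)] by simp
    also have "\<dots> = \<zero>" using Cons.IH[OF e(2) f(2)] Cons.prems(3) True e f by auto
    finally show ?thesis .
  next
    case False
    then show ?thesis using eq S_orth[OF e(1) f(1)] c by (simp add: mult_zero_left mult_zero_right adj_closed)
  qed
qed

definition unit :: 'a where "unit = (\<Oplus>v\<in>verts G. P v)"

lemma unit_mult_P: "v \<in> verts G \<Longrightarrow> unit \<otimes> P v = P v"
  and P_mult_unit: "v \<in> verts G \<Longrightarrow> P v \<otimes> unit = P v"
proof -
  assume v: "v \<in> verts G"
  have P: "P w \<in> carrier A" "P w \<otimes> P v = (if w = v then P v else \<zero>)" "P v \<otimes> P w = (if w = v then P v else \<zero>)"
    if "w \<in> verts G" for w
    using that v P_closed P_orth[of w v] P_orth[of v w] projD(3)[OF P_proj] by auto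
  have "unit \<otimes> P v = (\<Oplus>w\<in>verts G. P w \<otimes> P v)"
    unfolding unit_def using P v by (intro finsum_mult_right[symmetric]) auto
  also have "\<dots> = (\<Oplus>w\<in>verts G. if v = w then P w else \<zero>)"
    using P by (intro finsum_cong') auto
  also have "\<dots> = P v" using P_closed v by (intro finsum_singleton) auto
  finally show "unit \<otimes> P v = P v" .
  have "P v \<otimes> unit = (\<Oplus>w\<in>verts G. P v \<otimes> P w)"
    unfolding unit_def using P v by (intro finsum_mult_left[symmetric]) auto
  also have "\<dots> = (\<Oplus>w\<in>verts G. if v = w then P w else \<zero>)"
    using P by (intro finsum_cong') auto
  also have "\<dots> = P v" using P_closed v by (intro finsum_singleton) auto
  finally show "P v \<otimes> unit = P v" .
qed

lemma unit_proj: "proj unit"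
proof -
  have "unit \<otimes> unit = (\<Oplus>v\<in>verts G. unit \<otimes> P v)"
    using P_closed by (subst finsum_mult_left) (auto simp: unit_def)
  also have "\<dots> = (\<Oplus>v\<in>verts G. P v)"
    using P_closed unit_mult_P by (intro finsum_cong') auto
  finally have "unit \<otimes> unit = unit" by (simp add: unit_def)
  moreover have "adj A unit = (\<Oplus>v\<in>verts G. adj A (P v))"
    unfolding unit_def using P_closed by (intro finsum_adj[symmetric]) auto
  then have "adj A unit = unit"
    using P_closed projD(2)[OF P_proj] by (auto simp: unit_def intro!: finsum_cong')
  ultimately show ?thesis using P_closed by (auto simp: proj_def unit_def intro!: finsum_closed)
qed

lemma unit_mult_S:
  assumes e: "e \<in> arcs G"
  shows "unit \<otimes> S e = S e" "S e \<otimes> unit = S e"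
proof -
  have v: "tail G e \<in> verts G" "head G e \<in> verts G" using e by auto
  have "unit \<otimes> (P (tail G e) \<otimes> S e) = (unit \<otimes> P (tail G e)) \<otimes> S e"
    using mult_assoc projD(1)[OF unit_proj] P_closed[OF v(1)] S_closed[OF e] by simp
  then show "unit \<otimes> S e = S e" using S_mult_source[OF e] unit_mult_P[OF v(1)] by simp
  have "S e \<otimes> P (head G e) \<otimes> unit = S e \<otimes> (P (head G e) \<otimes> unit)"
    using mult_assoc projD(1)[OF unit_proj] P_closed[OF v(2)] S_closed[OF e] by simp
  then show "S e \<otimes> unit = S e" using S_mult_range[OF e] P_mult_unit[OF v(2)] by simp
qed

text \<open>
  The elements on which \<open>unit\<close> acts as an identity form a closed \<open>*\<close>-subalgebra containing the generators.
\<close>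

lemma unit_neutral:
  assumes gen: "\<And>B. closed_star_subalgebra A B \<Longrightarrow> P ` verts G \<subseteq> B \<Longrightarrow> S ` arcs G \<subseteq> B \<Longrightarrow> B = carrier A"
    and x: "x \<in> carrier A"
  shows "unit \<otimes> x = x" "x \<otimes> unit = x"
proof -
  note u = projD[OF unit_proj]
  define B where "B = {x \<in> carrier A. unit \<otimes> x = x \<and> x \<otimes> unit = x}"
  interpret M: Metric_space "carrier A" "cdist A" by (rule Metric_space_cdist)
  have lim: "unit \<otimes> x = x \<and> x \<otimes> unit = x" if lim: "limitin M.mtopology s x sequentially" and s: "range s \<subseteq> B" for s x
  proof -
    have x: "x \<in> carrier A" using lim by (rule M.limitin_mspace)
    have sB: "s n \<in> carrier A" "unit \<otimes> s n = s n" "s n \<otimes> unit = s n" for n using s by (auto simp: B_def)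
    have near: "\<exists>y\<in>B. cnorm A (x \<ominus> y) < d" if "d > 0" for d
    proof -
      have "\<forall>\<^sub>F n in sequentially. s n \<in> carrier A \<and> cdist A (s n) x < d"
        using lim that by (simp add: M.limitin_metric)
      then obtain n where "cdist A (s n) x < d" by (auto simp: eventually_sequentially)
      then have "cdist A x (s n) < d" by (simp add: M.commute)
      then show ?thesis using s x sB by (auto simp: cdist_def)
    qed
    have le: "cnorm A (unit \<otimes> x \<ominus> x) \<le> 2 * cnorm A (x \<ominus> y)" "cnorm A (x \<otimes> unit \<ominus> x) \<le> 2 * cnorm A (x \<ominus> y)"
      if y: "y \<in> B" for y
    proof -
      have y: "y \<in> carrier A" "unit \<otimes> y = y" "y \<otimes> unit = y" using y by (auto simp: B_def)
      define d where "d = x \<ominus> y"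
      have d: "d \<in> carrier A" "x = d \<oplus> y" using x y by (auto simp: d_def a_minus_def a_assoc l_neg)
      have "(- 1) \<odot> d \<in> carrier A" "cnorm A ((- 1) \<odot> d) = cnorm A d" using d by (simp_all add: scale_closed cnorm_scale)
      note nd = this
      have cancel: "(a \<oplus> y) \<oplus> (b \<oplus> (- 1) \<odot> y) = a \<oplus> b" if "a \<in> carrier A" "b \<in> carrier A" for a b
      proof -
        have "(a \<oplus> y) \<oplus> (b \<oplus> (- 1) \<odot> y) = (a \<oplus> b) \<oplus> (y \<oplus> (- 1) \<odot> y)"
          using that y by (simp add: a_ac scale_closed)
        then show ?thesis using that y by (simp add: add_neg_scale)
      qed
      have e1: "unit \<otimes> x \<ominus> x = unit \<otimes> d \<oplus> (- 1) \<odot> d"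
        unfolding a_minus_def d(2) using d(1) y u cancel[of "unit \<otimes> d" "(- 1) \<odot> d"] nd
        by (simp add: distrib_left scale_add_right mult_closed flip: neg_scale)
      have e2: "x \<otimes> unit \<ominus> x = d \<otimes> unit \<oplus> (- 1) \<odot> d"
        unfolding a_minus_def d(2) using d(1) y u cancel[of "d \<otimes> unit" "(- 1) \<odot> d"] nd
        by (simp add: distrib_right scale_add_right mult_closed flip: neg_scale)
      have "cnorm A (unit \<otimes> d) \<le> 1 * cnorm A d"
        using cnorm_mult[OF u(1) d(1)] mult_right_mono[OF cnorm_proj[OF unit_proj] cnorm_nonneg[OF d(1)]] by linarith
      then show "cnorm A (unit \<otimes> x \<ominus> x) \<le> 2 * cnorm A (x \<ominus> y)"
        unfolding e1 d_def[symmetric] using cnorm_add[of "unit \<otimes> d" "(- 1) \<odot> d"] u(1) d(1) nd by (simp add: mult_closed)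
      have "cnorm A (d \<otimes> unit) \<le> cnorm A d * 1"
        using cnorm_mult[OF d(1) u(1)] mult_left_mono[OF cnorm_proj[OF unit_proj] cnorm_nonneg[OF d(1)]] by linarith
      then show "cnorm A (x \<otimes> unit \<ominus> x) \<le> 2 * cnorm A (x \<ominus> y)"
        unfolding e2 d_def[symmetric] using cnorm_add[of "d \<otimes> unit" "(- 1) \<odot> d"] u(1) d(1) nd by (simp add: mult_closed)
    qed
    have zero: "z = \<zero>" if "z \<in> carrier A" "\<And>y. y \<in> B \<Longrightarrow> cnorm A z \<le> 2 * cnorm A (x \<ominus> y)" for z
    proof -
      have "cnorm A z \<le> 0"
      proof (rule field_le_epsilon)
        fix d :: real assume "d > 0"
        then obtain y where "y \<in> B" "cnorm A (x \<ominus> y) < d / 2" using near[of "d / 2"] by auto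
        with that(2)[of y] show "cnorm A z \<le> 0 + d" by simp
      qed
      then show ?thesis using cnorm_nonneg[OF that(1)] cnorm_eq_0[OF that(1)] by simp
    qed
    have "unit \<otimes> x \<ominus> x = \<zero>" "x \<otimes> unit \<ominus> x = \<zero>"
      by (rule zero; use le x u in \<open>auto intro: mult_closed minus_closed\<close>)+
    then show ?thesis using x u by (simp add: mult_closed)
  qed
  have closedB: "closedin M.mtopology B"
    unfolding M.metric_closedin_iff_sequentially_closed
  proof (intro conjI allI impI)
    fix s l assume sl: "range s \<subseteq> B \<and> limitin M.mtopology s l sequentially"
    then have "l \<in> carrier A" using M.limitin_mspace by blast
    moreover have "unit \<otimes> l = l \<and> l \<otimes> unit = l" by (rule lim) (use sl in auto)
    ultimately show "l \<in> B" by (simp add: B_def)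
  qed (auto simp: B_def)
  have adjB: "adj A x \<in> B" if "x \<in> B" for x
    using that u adj_mult[of unit x] adj_mult[of x unit] by (auto simp: B_def adj_closed)
  have multB: "x \<otimes> y \<in> B" if "x \<in> B" "y \<in> B" for x y
  proof -
    have "unit \<otimes> (x \<otimes> y) = (unit \<otimes> x) \<otimes> y" "(x \<otimes> y) \<otimes> unit = x \<otimes> (y \<otimes> unit)"
      using that u mult_assoc[of unit x y] mult_assoc[of x y unit] by (auto simp: B_def)
    then show ?thesis using that by (auto simp: B_def mult_closed)
  qed
  have addB: "x \<oplus> y \<in> B" if "x \<in> B" "y \<in> B" for x y
    using that u by (auto simp: B_def distrib_left distrib_right)
  have scaleB: "c \<odot> x \<in> B" if "x \<in> B" for c x
    using that u by (auto simp: B_def scale_closed scale_mult_left scale_mult_right)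
  have zeroB: "\<zero> \<in> B" "B \<subseteq> carrier A"
    using u by (auto simp: B_def mult_zero_left mult_zero_right)
  have "closed_star_subalgebra A B"
    unfolding closed_star_subalgebra_def using closedB adjB multB addB scaleB zeroB by simp
  moreover have "P ` verts G \<subseteq> B" "S ` arcs G \<subseteq> B"
    using P_closed S_closed unit_mult_P P_mult_unit unit_mult_S by (auto simp: B_def)
  ultimately have "B = carrier A" by (rule gen)
  then have "x \<in> B" using x by simp
  then show "unit \<otimes> x = x" "x \<otimes> unit = x" unfolding B_def by simp_all
qed

section \<open>Gauge invariant KMS states\<close>

lemma path_pair_range:
  assumes "G.awalk u p w"
  shows "path_pair A P S ((u, p), (w, [])) = spath u p"
    "path_pair A P S ((w, []), (u, p)) = adj A (spath u p)"
proof -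
  have w: "w \<in> verts G" using assms by (rule G.awalk_last_in_verts)
  note P = projD[OF P_proj[OF w]]
  note sp = spath_props[OF assms]
  show "path_pair A P S ((u, p), (w, [])) = spath u p"
    using P sp by (simp add: path_pair_def)
  show "path_pair A P S ((w, []), (u, p)) = adj A (spath u p)"
    using adj_mult[of "spath u p" "P w"] P sp by (simp add: path_pair_def)
qed

lemma path_comb_singleton:
  assumes "path_pair A P S k \<in> carrier A"
  shows "path_comb A P S c {k} = c k \<odot> path_pair A P S k"
  using assms by (simp add: path_comb_def scale_closed)

text \<open>
  The KMS condition for \<open>a = S\<^sub>\<mu> P\<^sub>r\<^sub>(\<^sub>\<mu>\<^sub>)\<^sup>*\<close> and \<open>b = P\<^sub>r\<^sub>(\<^sub>\<nu>\<^sub>) S\<^sub>\<nu>\<^sup>*\<close>, with vertices as paths of length \<open>0\<close>.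
\<close>

lemma kms_swap:
  assumes kms: "kms_state G A P S F \<beta> \<phi>" and p: "G.awalk u p w" and q: "G.awalk u' q w'"
  shows "\<phi> (spath u p \<otimes> adj A (spath u' q)) =
    complex_of_real (exp (- \<beta> * path_weight F p)) * \<phi> (adj A (spath u' q) \<otimes> spath u p)"
proof -
  have w: "w \<in> verts G" "w' \<in> verts G" using p q by (auto dest: G.awalk_last_in_verts)
  let ?k = "((u, p), (w, []))" and ?l = "((w', []), (u', q))"
  have mem: "?k \<in> fpaths G \<times> fpaths G" "?l \<in> fpaths G \<times> fpaths G"
    using p q w by (auto simp: fpaths_def G.awalk_Nil_iff)
  have c: "spath u p \<in> carrier A" "adj A (spath u' q) \<in> carrier A"
    using spath_props[OF p] spath_props[OF q] by (auto intro: adj_closed)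
  define b where "b = path_comb A P S (\<lambda>_. 1) {?l}"
  have b: "b = adj A (spath u' q)"
    using c path_pair_range[OF q] by (simp add: b_def path_comb_singleton scale_one)
  have "b \<in> path_span G A P S"
    unfolding path_span_def b_def using mem by (auto intro!: exI[of _ "{?l}"])
  with kms mem(1) have "\<phi> (path_comb A P S (\<lambda>_. 1) {?k} \<otimes> b) =
    \<phi> (b \<otimes> path_comb A P S (\<lambda>(\<mu>, \<nu>). complex_of_real
       (exp (- \<beta> * (path_weight F (snd \<mu>) - path_weight F (snd \<nu>)))) * 1) {?k})"
    unfolding kms_state_def by blast
  then have "\<phi> (spath u p \<otimes> adj A (spath u' q)) =
      \<phi> (adj A (spath u' q) \<otimes> (complex_of_real (exp (- \<beta> * path_weight F p)) \<odot> spath u p))"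
    using c path_pair_range[OF p] by (simp add: b path_comb_singleton scale_one path_weight_def)
  also have "\<dots> = complex_of_real (exp (- \<beta> * path_weight F p)) * \<phi> (adj A (spath u' q) \<otimes> spath u p)"
    using c kms by (simp add: scale_mult_right kms_state_def state_def mult_closed)
  finally show ?thesis .
qed

lemma star_hom_spath:
  assumes hom: "star_hom A A \<pi>" and P: "\<And>v. v \<in> verts G \<Longrightarrow> \<pi> (P v) = P v"
    and S: "\<And>e. e \<in> arcs G \<Longrightarrow> \<pi> (S e) = c \<odot> S e" and p: "G.awalk u p w"
  shows "\<pi> (spath u p) = c ^ length p \<odot> spath u p"
  using p
proof (induction p arbitrary: u)
  case Nil
  then show ?case using P[of u] P_closed[of u] by (auto simp: G.awalk_Nil_iff scale_one)
next
  case (Cons e es)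
  then have e: "e \<in> arcs G" "G.awalk (head G e) es w" by (auto simp: G.awalk_Cons_iff)
  have cl: "S e \<in> carrier A" "spath (head G e) es \<in> carrier A"
    using S_closed[OF e(1)] spath_props[OF e(2)] by auto
  have "\<pi> (spath u (e # es)) = \<pi> (S e) \<otimes> \<pi> (spath (head G e) es)"
    unfolding spath_Cons[OF Cons.prems] using hom cl by (simp add: star_hom_def)
  also have "\<dots> = c ^ length (e # es) \<odot> (S e \<otimes> spath (head G e) es)"
    using cl by (simp add: S[OF e(1)] Cons.IH[OF e(2)] scale_mult_left scale_mult_right scale_closed mult_closed scale_scale scale_left_commute)
  finally show ?case by (simp add: spath_Cons[OF Cons.prems])
qed

text \<open>
  The gauge action at time \<open>\<pi> / (|\<mu>| - |\<nu>|)\<close> multiplies \<open>S\<^sub>\<mu> S\<^sub>\<nu>\<^sup>*\<close> by \<open>-1\<close>.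
\<close>

lemma gauge_invariant_zero:
  assumes A: "graph_cstar_algebra G A P S" and lin: "state A \<phi>" and inv: "gauge_invariant G A P S \<phi>"
    and p: "G.awalk u p w" and q: "G.awalk u' q w'" and len: "length p \<noteq> length q"
  shows "\<phi> (spath u p \<otimes> adj A (spath u' q)) = 0"
proof -
  define d where "d = real (length p) - real (length q)"
  define t where "t = pi / d"
  have d: "d \<noteq> 0" using len by (simp add: d_def)
  define c where "c = exp (\<i> * complex_of_real t)"
  let ?\<pi> = "gauge_action G A P S (\<lambda>_. 1) t"
  have hom: "star_hom A A ?\<pi>" and P: "\<And>v. v \<in> verts G \<Longrightarrow> ?\<pi> (P v) = P v"
    and S: "\<And>e. e \<in> arcs G \<Longrightarrow> ?\<pi> (S e) = c \<odot> S e"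
    using gauge_action[OF G.fin_digraph_axioms A, where F = "\<lambda>_. 1" and t = t] by (auto simp: c_def)
  have cl: "spath u p \<in> carrier A" "spath u' q \<in> carrier A" "adj A (spath u' q) \<in> carrier A"
    using spath_props[OF p] spath_props[OF q] by (auto intro: adj_closed)
  have e: "?\<pi> (spath u p) = c ^ length p \<odot> spath u p" "?\<pi> (spath u' q) = c ^ length q \<odot> spath u' q"
    by (rule star_hom_spath[OF hom P S p] star_hom_spath[OF hom P S q]; assumption)+
  have "?\<pi> (spath u p \<otimes> adj A (spath u' q)) = ?\<pi> (spath u p) \<otimes> adj A (?\<pi> (spath u' q))"
    using hom cl by (simp add: star_hom_def)
  also have "\<dots> = (c ^ length p * cnj c ^ length q) \<odot> (spath u p \<otimes> adj A (spath u' q))"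
    unfolding e
    using cl by (simp add: adj_scale scale_mult_left scale_mult_right scale_closed mult_closed scale_scale scale_left_commute)
  also have "c ^ length p * cnj c ^ length q = - 1"
  proof -
    have "cnj c = exp (- (\<i> * complex_of_real t))" by (simp add: c_def exp_cnj)
    then have "c ^ length p * cnj c ^ length q = exp (\<i> * complex_of_real (d * t))"
      by (simp add: c_def d_def algebra_simps flip: exp_of_nat_mult exp_add)
    also have "d * t = pi" using d by (simp add: t_def)
    finally show ?thesis using exp_pi_i' by simp
  qed
  finally have "\<phi> (?\<pi> (spath u p \<otimes> adj A (spath u' q))) = - \<phi> (spath u p \<otimes> adj A (spath u' q))"
    using cl lin by (simp add: state_def mult_closed)
  moreover have "\<phi> (?\<pi> (spath u p \<otimes> adj A (spath u' q))) = \<phi> (spath u p \<otimes> adj A (spath u' q))"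
    using inv cl by (simp add: gauge_invariant_def mult_closed)
  ultimately show ?thesis by (simp add: eq_neg_iff_add_eq_0)
qed

end

lemma wmat_sum:
  assumes "fin_digraph G" "finite X"
  shows "(\<Sum>w\<in>X. wmat G F b v w * x w) =
    (\<Sum>e\<in>{e \<in> out_arcs G v. head G e \<in> X}. exp (- b * F e) * x (head G e))"
proof -
  interpret fin_digraph G by fact
  have fin: "finite (out_arcs G v)" by (simp add: finite_out_arcs)
  have "(\<Sum>w\<in>X. wmat G F b v w * x w) =
      (\<Sum>w\<in>X. \<Sum>e\<in>{e \<in> {e \<in> out_arcs G v. head G e \<in> X}. head G e = w}. exp (- b * F e) * x (head G e))"
    unfolding wmat_def sum_distrib_right
    by (intro sum.cong refl) (auto simp: in_arcs_def out_arcs_def)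
  also have "\<dots> = (\<Sum>e\<in>{e \<in> out_arcs G v. head G e \<in> X}. exp (- b * F e) * x (head G e))"
    by (rule sum.group) (use fin assms(2) in auto)
  finally show ?thesis .
qed

text \<open>The analytic half of the argument: it leaves a question about nonnegative vectors only.\<close>

theorem gauge_invariant_kms_state_vector:
  fixes G :: "('v, 'e) pre_digraph" and A :: "'a cstar"
  assumes G: "fin_digraph G" and A: "graph_cstar_algebra G A P S"
    and kms: "kms_state G A P S F \<beta> \<phi>" and inv: "gauge_invariant G A P S \<phi>"
  obtains \<psi> where "\<And>v. v \<in> verts G \<Longrightarrow> 0 \<le> \<psi> v" "(\<Sum>v\<in>verts G. \<psi> v) = 1"
    "\<And>v. v \<in> verts G \<Longrightarrow> \<not> sink G v \<Longrightarrow> (\<Sum>w\<in>verts G. wmat G F \<beta> v w * \<psi> w) = \<psi> v"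
    "\<And>\<mu> \<nu>. \<mu> \<in> fpaths G \<Longrightarrow> \<nu> \<in> fpaths G \<Longrightarrow>
       \<phi> (path_elem A P S \<mu> \<otimes>\<^bsub>A\<^esub> adj A (path_elem A P S \<nu>)) =
       (if \<mu> = \<nu> then complex_of_real (exp (- \<beta> * path_weight F (snd \<mu>)) * \<psi> (path_range G \<mu>)) else 0)"
proof -
  interpret G: fin_digraph G by fact
  from A interpret cstar_algebra A by (simp add: graph_cstar_algebra_def)
  from A have ck: "ck_family G A P S" by (simp add: graph_cstar_algebra_def)
  interpret ck_algebra A G P S by unfold_locales (rule ck)
  have gen: "B = carrier A" if "closed_star_subalgebra A B" "P ` verts G \<subseteq> B" "S ` arcs G \<subseteq> B" for B
    using A that by (auto simp: graph_cstar_algebra_def)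
  have st: "state A \<phi>" using kms by (simp add: kms_state_def)
  have add: "\<phi> (x \<oplus>\<^bsub>A\<^esub> y) = \<phi> x + \<phi> y" if "x \<in> carrier A" "y \<in> carrier A" for x y
    using st that by (auto simp: state_def)
  have zero: "\<phi> \<zero>\<^bsub>A\<^esub> = 0" using add[of "\<zero>\<^bsub>A\<^esub>" "\<zero>\<^bsub>A\<^esub>"] by simp
  have sum: "\<phi> (finsum A f I) = (\<Sum>i\<in>I. \<phi> (f i))" if "finite I" "f \<in> I \<rightarrow> carrier A" for f and I :: "'i set"
    using that by (induction I) (auto simp: zero add Pi_iff)
  define \<psi> where "\<psi> v = Re (\<phi> (P v))" for v
  have \<psi>: "\<phi> (P v) = of_real (\<psi> v)" "0 \<le> \<psi> v" if v: "v \<in> verts G" for v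
  proof -
    have "\<phi> (adj A (P v) \<otimes>\<^bsub>A\<^esub> P v) \<in> \<real>\<^sub>\<ge>\<^sub>0" using st P_closed[OF v] by (simp add: state_def)
    then show "\<phi> (P v) = of_real (\<psi> v)" "0 \<le> \<psi> v"
      using projD[OF P_proj[OF v]] by (auto simp: \<psi>_def nonneg_Reals_def)
  qed
  have "\<phi> unit = 1" by (rule state_unit[OF st unit_proj unit_neutral]) (use gen in auto)
  then have "(\<Sum>v\<in>verts G. \<phi> (P v)) = 1"
    unfolding unit_def using P_closed by (subst (asm) sum) auto
  then have "complex_of_real (\<Sum>v\<in>verts G. \<psi> v) = of_real 1" using \<psi> by simp
  then have total: "(\<Sum>v\<in>verts G. \<psi> v) = 1" by (simp only: of_real_eq_iff)
  have path: "\<phi> (path_elem A P S \<mu> \<otimes>\<^bsub>A\<^esub> adj A (path_elem A P S \<nu>)) =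
       (if \<mu> = \<nu> then complex_of_real (exp (- \<beta> * path_weight F (snd \<mu>)) * \<psi> (path_range G \<mu>)) else 0)"
    if mem: "\<mu> \<in> fpaths G" "\<nu> \<in> fpaths G" for \<mu> \<nu>
  proof -
    obtain u p w u' q w' where p: "\<mu> = (u, p)" "G.awalk u p w" and q: "\<nu> = (u', q)" "G.awalk u' q w'"
      using mem by (auto simp: fpaths_def)
    have w: "w \<in> verts G" "path_range G (u, p) = w" using p by (auto simp: path_range_def dest: G.awalk_last_in_verts)
    show ?thesis
    proof (cases "length p = length q")
      case len: True
      show ?thesis
      proof (cases "\<mu> = \<nu>")
        case True
        then have "\<nu> = (u, p)" using p by simp
        then show ?thesis
          unfolding p(1) using kms_swap[OF kms p(2) p(2)] spath_props[OF p(2)] w \<psi>(1)[OF w(1)] by simp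
      next
        case False
        have "adj A (spath u' q) \<otimes>\<^bsub>A\<^esub> spath u p = \<zero>\<^bsub>A\<^esub>"
          by (rule spath_orth[OF q(2) p(2)]) (use len False p q in auto)
        then show ?thesis
          using False kms_swap[OF kms p(2) q(2)] unfolding p(1) q(1) by (auto simp: zero)
      qed
    next
      case False
      then show ?thesis using gauge_invariant_zero[OF A st inv p(2) q(2)] p q by auto
    qed
  qed
  have harm: "(\<Sum>w\<in>verts G. wmat G F \<beta> v w * \<psi> w) = \<psi> v" if v: "v \<in> verts G" "\<not> sink G v" for v
  proof -
    have e: "\<phi> (S e \<otimes>\<^bsub>A\<^esub> adj A (S e)) = of_real (exp (- \<beta> * F e) * \<psi> (head G e))" if "e \<in> out_arcs G v" for e
    proof -
      have "G.awalk v [e] (head G e)" using that by (auto simp: G.awalk_Cons_iff G.awalk_Nil_iff)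
      then have "(v, [e]) \<in> fpaths G" by (auto simp: fpaths_def)
      from path[OF this this] show ?thesis by (simp add: path_weight_def path_range_def)
    qed
    have "of_real (\<psi> v) = \<phi> (\<Oplus>\<^bsub>A\<^esub>e\<in>out_arcs G v. S e \<otimes>\<^bsub>A\<^esub> adj A (S e))"
      using \<psi>(1)[OF v(1)] P_final[OF v] by simp
    also have "\<dots> = (\<Sum>e\<in>out_arcs G v. \<phi> (S e \<otimes>\<^bsub>A\<^esub> adj A (S e)))"
      using projD(1)[OF final_proj] by (intro sum) (auto simp: G.finite_out_arcs)
    also have "\<dots> = complex_of_real (\<Sum>e\<in>out_arcs G v. exp (- \<beta> * F e) * \<psi> (head G e))"
      using e by simp
    finally have "\<psi> v = (\<Sum>e\<in>out_arcs G v. exp (- \<beta> * F e) * \<psi> (head G e))"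
      by (simp only: of_real_eq_iff)
    also have "\<dots> = (\<Sum>e\<in>{e \<in> out_arcs G v. head G e \<in> verts G}. exp (- \<beta> * F e) * \<psi> (head G e))"
      by (intro sum.cong) auto
    finally show ?thesis by (simp add: wmat_sum[OF G])
  qed
  show thesis by (rule that[of \<psi>]) (use \<psi> total harm path in auto)
qed

section \<open>The spectral radius of a component\<close>

lemma exp_weighted_le:
  fixes t a b :: real
  assumes "0 \<le> t" "t \<le> 1"
  shows "exp ((1 - t) * a + t * b) \<le> (1 - t) * exp a + t * exp b"
proof -
  define m where "m = (1 - t) * a + t * b"
  have "exp m * (1 + (y - m)) \<le> exp y" for y
    using mult_left_mono[OF exp_ge_add_one_self[of "y - m"], of "exp m"] by (simp add: mult_exp_exp)
  then have "(1 - t) * (exp m * (1 + (a - m))) + t * (exp m * (1 + (b - m))) \<le> (1 - t) * exp a + t * exp b"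
    using assms by (intro add_mono mult_left_mono) auto
  moreover have "(1 - t) * (exp m * (1 + (a - m))) + t * (exp m * (1 + (b - m))) =
      exp m * (1 + ((1 - t) * a + t * b - m))"
    by (simp add: algebra_simps)
  ultimately show ?thesis by (simp add: m_def)
qed

text \<open>
  A convex function that is nonpositive at \<open>x\<close> and negative far to the right is negative on everything to
  the right of \<open>x\<close>.
\<close>

lemma convex_unique_zero:
  fixes L :: "real \<Rightarrow> real"
  assumes L: "convex_on UNIV L" "0 \<le> L 0" and B: "\<And>b. B \<le> b \<Longrightarrow> L b < 0"
  obtains z where "\<And>b. L b = 0 \<longleftrightarrow> b = z" "\<And>b. L b < 0 \<longleftrightarrow> z < b"
proof -
  have comb: "L y < 0" if "L x \<le> 0" "x < y" for x y
  proof -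
    \<comment> \<open>Any point to the right of \<open>y\<close> at which \<open>L\<close> is negative.\<close>
    define w where "w = max B (y + 1)"
    have w: "y < w" "L w < 0" using B[of w] by (auto simp: w_def)
    define t where "t = (y - x) / (w - x)"
    have t: "0 < t" "t < 1" using that w by (auto simp: t_def)
    have "t * (w - x) = y - x" using that w by (simp add: t_def)
    then have "(1 - t) *\<^sub>R x + t *\<^sub>R w = y" by (simp add: algebra_simps)
    then have "L y \<le> (1 - t) * L x + t * L w"
      using convex_onD[OF L(1), of t x w] t by simp
    also have "\<dots> < 0" using t that w
      by (intro add_nonpos_neg mult_nonneg_nonpos mult_pos_neg) auto
    finally show ?thesis .
  qed
  have "continuous_on {0..max B 0} L"
    using convex_on_continuous[OF open_UNIV L(1)] by (rule continuous_on_subset) auto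
  then obtain z where z: "L z = 0"
    using IVT2'[of L "max B 0" 0 0] B[of "max B 0"] L(2) by force
  have "L b < 0" if "z < b" for b using comb[of z b] z that by simp
  moreover have "0 < L b" if "b < z" for b using comb[of b z] z that by force
  ultimately show thesis
    using that[of z] z by (metis less_asym less_irrefl linorder_neqE_linordered_idom)
qed

context fin_digraph
begin

lemma wmat_nonneg: "0 \<le> wmat G F b v w"
  by (simp add: wmat_def sum_nonneg)

lemma wmat_pos_iff: "0 < wmat G F b v w \<longleftrightarrow> (\<exists>e\<in>arcs G. tail G e = v \<and> head G e = w)"
proof -
  have "finite (out_arcs G v \<inter> in_arcs G w)" by (simp add: finite_out_arcs)
  then have "0 < wmat G F b v w \<longleftrightarrow> out_arcs G v \<inter> in_arcs G w \<noteq> {}"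
    unfolding wmat_def by (metis exp_gt_zero less_irrefl sum.empty sum_pos)
  then show ?thesis by auto
qed

lemma wmat_uminus: "wmat G (\<lambda>e. - F e) (- b) = wmat G F b"
  by (simp add: wmat_def fun_eq_iff)

lemma component_subset_verts: "component G C \<Longrightarrow> C \<subseteq> verts G"
  by (auto simp: component_def quotient_def dest: reachable_in_verts)

lemma component_reachable: "component G C \<Longrightarrow> v \<in> C \<Longrightarrow> w \<in> C \<Longrightarrow> v \<rightarrow>\<^sup>* w"
  by (auto simp: component_def quotient_def intro: reachable_trans)

lemma component_closed: "component G C \<Longrightarrow> v \<in> C \<Longrightarrow> v \<rightarrow>\<^sup>* w \<Longrightarrow> w \<rightarrow>\<^sup>* v \<Longrightarrow> w \<in> C"
  by (auto simp: component_def quotient_def intro: reachable_trans)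

lemma component_disjoint: "component G C \<Longrightarrow> component G D \<Longrightarrow> v \<in> C \<Longrightarrow> v \<in> D \<Longrightarrow> C = D"
  using component_closed component_reachable by blast

lemma component_finite: "component G C \<Longrightarrow> finite C"
  using component_subset_verts finite_verts finite_subset by blast

lemma component_edge: "component G C \<Longrightarrow> \<exists>e\<in>arcs G. tail G e \<in> C \<and> head G e \<in> C"
  by (simp add: component_def)

lemma component_trancl:
  assumes C: "component G C" and "v \<in> C" "w \<in> C"
  shows "(v, w) \<in> {(a, b). a \<in> C \<and> b \<in> C \<and> (\<exists>e\<in>arcs G. tail G e = a \<and> head G e = b)}\<^sup>+"
proof -
  let ?R = "{(a, b). a \<in> C \<and> b \<in> C \<and> (\<exists>e\<in>arcs G. tail G e = a \<and> head G e = b)}"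
  have star: "(a, b) \<in> ?R\<^sup>*" if "a \<rightarrow>\<^sup>* b" "a \<in> C" "b \<in> C" for a b
    using that
  proof (induction rule: converse_reachable_induct)
    case (step x y)
    have "y \<in> C"
      using component_closed[OF C step.prems(1), of y] step.hyps component_reachable[OF C step.prems(2,1)]
      by (meson reachable_adjI reachable_trans)
    moreover have "\<exists>e\<in>arcs G. tail G e = x \<and> head G e = y"
      using step.hyps(1) by (auto simp: arcs_ends_def arc_to_ends_def)
    ultimately show ?case using step by (intro converse_rtrancl_into_rtrancl[of x y]) auto
  qed auto
  obtain e where e: "e \<in> arcs G" "tail G e \<in> C" "head G e \<in> C" using component_edge[OF C] by auto
  have "(v, tail G e) \<in> ?R\<^sup>*" "(head G e, w) \<in> ?R\<^sup>*" using star component_reachable[OF C] assms e by auto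
  moreover have "(tail G e, head G e) \<in> ?R" using e by auto
  ultimately show ?thesis by (meson rtrancl_into_trancl1 trancl_rtrancl_trancl)
qed

lemma component_irreducible: "component G C \<Longrightarrow> irreducible_on C (wmat G F b)"
  using component_trancl component_edge component_finite
  unfolding irreducible_on_def wmat_pos_iff by (auto simp: wmat_nonneg)

definition edges_in :: "'a set \<Rightarrow> 'b list \<Rightarrow> bool" where
  "edges_in C p \<longleftrightarrow> (\<forall>e\<in>set p. tail G e \<in> C \<and> head G e \<in> C)"

lemma edges_in_simps [simp]:
  "edges_in C []" "edges_in C (e # p) \<longleftrightarrow> tail G e \<in> C \<and> head G e \<in> C \<and> edges_in C p"
  "edges_in C (p @ q) \<longleftrightarrow> edges_in C p \<and> edges_in C q"
  by (auto simp: edges_in_def)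

lemma loops_in_iff: "p \<in> loops_in G C \<longleftrightarrow> p \<noteq> [] \<and> (\<exists>u. awalk u p u) \<and> edges_in C p"
  by (auto simp: loops_in_def edges_in_def)

lemma component_walk:
  assumes C: "component G C" and "v \<in> C" "w \<in> C"
  obtains p where "p \<noteq> []" "awalk v p w" "edges_in C p"
proof -
  have "\<exists>p. p \<noteq> [] \<and> awalk v p w \<and> edges_in C p"
    using component_trancl[OF assms]
  proof (induction rule: trancl_induct)
    case (base y)
    then obtain e where "e \<in> arcs G" "tail G e = v" "head G e = y" "v \<in> C" "y \<in> C" by auto
    then show ?case by (intro exI[of _ "[e]"]) (auto simp: awalk_Cons_iff awalk_Nil_iff)
  next
    case (step y z)
    then obtain e p where "e \<in> arcs G" "tail G e = y" "head G e = z" "y \<in> C" "z \<in> C"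
      "p \<noteq> []" "awalk v p y" "edges_in C p" by auto
    then show ?case
      by (intro exI[of _ "p @ [e]"]) (auto intro!: awalk_appendI[of v p y] simp: awalk_Cons_iff awalk_Nil_iff simp del: awalk_append_iff)
  qed
  with that show thesis by auto
qed

lemma component_loop:
  assumes C: "component G C"
  obtains p where "p \<in> loops_in G C"
proof -
  obtain e where e: "tail G e \<in> C" using component_edge[OF C] by auto
  obtain p where "p \<noteq> []" "awalk (tail G e) p (tail G e)" "edges_in C p"
    by (rule component_walk[OF C e e])
  then show thesis using that by (auto simp: loops_in_iff)
qed

text \<open>The function \<open>b \<mapsto> \<rho>(A(b)\<^sup>C)\<close>.\<close>

abbreviation spec :: "('b \<Rightarrow> real) \<Rightarrow> 'a set \<Rightarrow> real \<Rightarrow> real" where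
  "spec F C b \<equiv> spectral_radius (restr_mat C (wmat G F b))"

lemma mvec_wmat:
  assumes "finite X"
  shows "mvec X (wmat G F b) x v = (\<Sum>e\<in>{e \<in> out_arcs G v. head G e \<in> X}. exp (- b * F e) * x (head G e))"
  unfolding mvec_def using wmat_sum[OF fin_digraph_axioms assms] .

lemma finite_out_arcs_in: "finite {e \<in> out_arcs G v. head G e \<in> X}"
  using finite_out_arcs[of v] by simp

lemma path_weight_Cons: "path_weight F (e # p) = F e + path_weight F p"
  by (simp add: path_weight_def)

lemma edge_le_mvec:
  assumes "finite X" "\<And>v. v \<in> X \<Longrightarrow> 0 < x v" "e \<in> arcs G" "head G e \<in> X"
  shows "exp (- b * F e) * x (head G e) \<le> mvec X (wmat G F b) x (tail G e)"
  unfolding mvec_wmat[OF assms(1)]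
  by (rule member_le_sum) (use assms finite_out_arcs_in in \<open>auto intro: less_imp_le\<close>)

lemma walk_weight_le:
  assumes C: "finite C" and x: "\<And>v. v \<in> C \<Longrightarrow> 0 < x v" "\<And>v. v \<in> C \<Longrightarrow> mvec C (wmat G F b) x v \<le> l * x v"
    and l: "0 < l" and p: "awalk u p w" "edges_in C p" "u \<in> C"
  shows "exp (- b * path_weight F p) * x w \<le> l ^ length p * x u"
  using p
proof (induction p arbitrary: u)
  case Nil
  then show ?case by (simp add: awalk_Nil_iff path_weight_def)
next
  case (Cons e p)
  then have e: "e \<in> arcs G" "tail G e = u" "u \<in> C" "head G e \<in> C" "awalk (head G e) p w" "edges_in C p"
    by (auto simp: awalk_Cons_iff)
  have "exp (- b * path_weight F (e # p)) * x w = exp (- b * F e) * (exp (- b * path_weight F p) * x w)"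
    by (simp add: path_weight_Cons exp_add[symmetric] algebra_simps)
  also have "\<dots> \<le> exp (- b * F e) * (l ^ length p * x (head G e))"
    using Cons.IH[OF e(5,6,4)] by (intro mult_left_mono) auto
  also have "\<dots> = l ^ length p * (exp (- b * F e) * x (head G e))" by simp
  also have "\<dots> \<le> l ^ length p * (l * x u)"
    using edge_le_mvec[where x = x and b = b and F = F, OF C x(1) e(1,4)] x(2)[OF e(3)] e(2) l by (intro mult_left_mono) auto
  finally show ?case by (simp add: algebra_simps)
qed

lemma awalk_hd: "awalk u p w \<Longrightarrow> p \<noteq> [] \<Longrightarrow> u = tail G (hd p)"
  by (cases p) (auto simp: awalk_Cons_iff)

text \<open>
  Along each edge \<open>e\<close>, a Perron-Frobenius eigenvector \<open>x\<close> satisfies \<open>exp (-bF(e)) x\<^sub>r\<^sub>(\<^sub>e\<^sub>) \<le> \<rho> x\<^sub>s\<^sub>(\<^sub>e\<^sub>)\<close>. Multiplying these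
  inequalities along a loop cancels the entries of \<open>x\<close>.
\<close>

lemma loop_weight_le:
  assumes C: "component G C" and p: "p \<in> loops_in G C"
  shows "exp (- b * path_weight F p) \<le> spec F C b ^ length p"
proof -
  obtain x where x: "0 < spec F C b" "\<And>v. v \<in> C \<Longrightarrow> 0 < x v"
    "\<And>v. v \<in> C \<Longrightarrow> mvec C (wmat G F b) x v = spec F C b * x v"
    by (rule perron_frobenius[OF component_irreducible[OF C]]) blast
  obtain u where u: "awalk u p u" "p \<noteq> []" "edges_in C p" using p by (auto simp: loops_in_iff)
  have "u \<in> C" using awalk_hd[OF u(1,2)] u by (cases p) auto
  then have "exp (- b * path_weight F p) * x u \<le> spec F C b ^ length p * x u"
    using x u by (intro walk_weight_le[OF component_finite[OF C]]) auto
  then show ?thesis using x(2)[OF \<open>u \<in> C\<close>] by simp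
qed

lemma spec_pos: "component G C \<Longrightarrow> 0 < spec F C b"
  using perron_frobenius[OF component_irreducible] by blast

lemma spec_zero_ge_1:
  assumes C: "component G C"
  shows "1 \<le> spec F C 0"
proof (rule ccontr)
  assume lt: "\<not> ?thesis"
  obtain p where p: "p \<in> loops_in G C" using component_loop[OF C] .
  then have "p \<noteq> []" by (simp add: loops_in_iff)
  then have "spec F C 0 ^ length p < 1" using lt spec_pos[OF C, of F 0] power_strict_decreasing[of 0 "length p" "spec F C 0"] by simp
  with loop_weight_le[OF C p, of 0 F] show False by simp
qed

text \<open>
  The weighted geometric mean of the eigenvectors at \<open>a\<close> and \<open>b\<close> is subinvariant at the convex
  combination of \<open>a\<close> and \<open>b\<close>, for the weighted geometric mean of the two spectral radii. Edge by edge
  this is the inequality of the weighted arithmetic and geometric means.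
\<close>

lemma spec_log_convex:
  assumes C: "component G C"
  shows "convex_on UNIV (\<lambda>b. ln (spec F C b))"
proof (rule convex_onI)
  fix t a b :: real
  assume t: "0 < t" "t < 1"
  note irr = component_irreducible[OF C] and fin = component_finite[OF C]
  obtain x where x: "\<And>v. v \<in> C \<Longrightarrow> 0 < x v" "\<And>v. v \<in> C \<Longrightarrow> mvec C (wmat G F a) x v = spec F C a * x v"
    by (rule perron_frobenius[OF irr]) blast
  obtain y where y: "\<And>v. v \<in> C \<Longrightarrow> 0 < y v" "\<And>v. v \<in> C \<Longrightarrow> mvec C (wmat G F b) y v = spec F C b * y v"
    by (rule perron_frobenius[OF irr]) blast
  have la: "0 < spec F C a" and lb: "0 < spec F C b" using spec_pos[OF C] by auto
  define c where "c = (1 - t) * a + t * b"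
  define k where "k = exp ((1 - t) * ln (spec F C a) + t * ln (spec F C b))"
  define z where "z v = exp ((1 - t) * ln (x v) + t * ln (y v))" for v
  have "spec F C c \<le> k"
  proof (rule spectral_radius_le_subinvariant[OF irr])
    fix v assume v: "v \<in> C"
    let ?E = "{e \<in> out_arcs G v. head G e \<in> C}"
    have edge: "exp (- c * F e) * z (head G e) \<le> k * z v *
        ((1 - t) * (exp (- a * F e) * x (head G e) / (spec F C a * x v)) +
         t * (exp (- b * F e) * y (head G e) / (spec F C b * y v)))" if e: "e \<in> ?E" for e
    proof -
      define \<alpha> where "\<alpha> = - a * F e + ln (x (head G e)) - (ln (spec F C a) + ln (x v))"
      define \<gamma> where "\<gamma> = - b * F e + ln (y (head G e)) - (ln (spec F C b) + ln (y v))"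
      have h: "head G e \<in> C" using e by auto
      have \<alpha>: "exp \<alpha> = exp (- a * F e) * x (head G e) / (spec F C a * x v)"
        unfolding \<alpha>_def exp_diff exp_add using x(1)[OF v] x(1)[OF h] la by simp
      have \<gamma>: "exp \<gamma> = exp (- b * F e) * y (head G e) / (spec F C b * y v)"
        unfolding \<gamma>_def exp_diff exp_add using y(1)[OF v] y(1)[OF h] lb by simp
      have "exp (- c * F e) * z (head G e) = k * z v * exp ((1 - t) * \<alpha> + t * \<gamma>)"
        by (simp add: c_def z_def k_def \<alpha>_def \<gamma>_def exp_add[symmetric] algebra_simps)
      also have "\<dots> \<le> k * z v * ((1 - t) * exp \<alpha> + t * exp \<gamma>)"
        using exp_weighted_le[of t \<alpha> \<gamma>] t by (intro mult_left_mono) (auto simp: k_def z_def)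
      finally show ?thesis by (simp add: \<alpha> \<gamma>)
    qed
    have "mvec C (wmat G F c) z v = (\<Sum>e\<in>?E. exp (- c * F e) * z (head G e))"
      by (rule mvec_wmat[OF fin])
    also have "\<dots> \<le> (\<Sum>e\<in>?E. k * z v *
        ((1 - t) * (exp (- a * F e) * x (head G e) / (spec F C a * x v)) +
         t * (exp (- b * F e) * y (head G e) / (spec F C b * y v))))"
      by (rule sum_mono) (rule edge)
    also have "\<dots> = k * z v * ((1 - t) * (mvec C (wmat G F a) x v / (spec F C a * x v)) +
        t * (mvec C (wmat G F b) y v / (spec F C b * y v)))"
      unfolding mvec_wmat[OF fin]
      by (simp add: sum_distrib_left sum.distrib sum_divide_distrib distrib_left mult.assoc)
    also have "\<dots> = k * z v"
      using x(1)[OF v] y(1)[OF v] la lb by (simp add: x(2)[OF v] y(2)[OF v])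
    finally show "mvec C (wmat G F c) z v \<le> k * z v" .
  qed (auto simp: z_def k_def)
  moreover have "0 < k" by (simp add: k_def)
  ultimately have "ln (spec F C c) \<le> ln k"
    using ln_le_cancel_iff[of "spec F C c" k] spec_pos[OF C, of F c] by blast
  then show "ln (spec F C ((1 - t) *\<^sub>R a + t *\<^sub>R b)) \<le> (1 - t) * ln (spec F C a) + t * ln (spec F C b)"
    by (simp add: c_def k_def)
qed auto

lemma iterate_cycle:
  assumes C: "finite C" "v \<in> C" and g: "\<And>v. v \<in> C \<Longrightarrow> g v \<in> C"
  obtains u m where "u \<in> C" "0 < m" "m \<le> card C" "(g ^^ m) u = u"
proof -
  have it: "(g ^^ i) v \<in> C" for i by (induction i) (use C g in auto)
  have "\<not> inj_on (\<lambda>i. (g ^^ i) v) {..card C}"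
  proof
    assume "inj_on (\<lambda>i. (g ^^ i) v) {..card C}"
    then have "card {..card C} \<le> card C"
      using it C by (intro card_inj_on_le[of _ _ C]) auto
    then show False by simp
  qed
  then obtain i j where ij: "i < j" "j \<le> card C" "(g ^^ i) v = (g ^^ j) v"
    unfolding inj_on_def by (metis atMost_iff linorder_neqE_nat)
  have "(g ^^ (j - i)) ((g ^^ i) v) = (g ^^ j) v"
    using ij by (metis funpow_add comp_apply le_add_diff_inverse2 less_imp_le_nat)
  with ij it show thesis by (intro that[of "(g ^^ i) v" "j - i"]) auto
qed

text \<open>
  If \<open>\<rho> \<ge> 1\<close> at some \<open>b > 0\<close>, every \<open>v\<close> has an outgoing edge in \<open>C\<close> that contributes at least the fraction \<open>1/N\<close>
  to \<open>x\<^sub>v \<le> (A(b)\<^sup>C x)\<^sub>v\<close>, where \<open>N\<close> is the number of edges. Following these edges closes a loop \<open>p\<close> of length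
  at most \<open>|C|\<close>, for which \<open>1 \<le> N\<^sup>|\<^sup>C\<^sup>| exp (-bF(p))\<close>. As the finitely many such loops have weights bounded
  below by some \<open>w > 0\<close>, this bounds \<open>b\<close>.
\<close>

lemma pos_loops_spec_less_1:
  assumes C: "component G C" and pos: "pos_loops G F C"
  obtains B where "\<And>b. B \<le> b \<Longrightarrow> spec F C b < 1"
proof -
  note irr = component_irreducible[OF C] and fin = component_finite[OF C]
  define N where "N = real (card (arcs G))"
  define W where "W = path_weight F ` {p \<in> loops_in G C. length p \<le> card C}"
  define w where "w = Min (insert 1 W)"
  have "{p \<in> loops_in G C. length p \<le> card C} \<subseteq> {p. set p \<subseteq> arcs G \<and> length p \<le> card C}"
    by (auto simp: loops_in_iff awalk_def)
  then have "finite W" unfolding W_def using finite_lists_length_le[OF finite_arcs] finite_subset by blast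
  then have w: "0 < w" "\<And>p. p \<in> loops_in G C \<Longrightarrow> length p \<le> card C \<Longrightarrow> w \<le> path_weight F p"
    using pos by (auto simp: w_def W_def pos_loops_def)
  obtain e0 where "e0 \<in> arcs G" using component_edge[OF C] by auto
  then have "card (arcs G) \<noteq> 0" using finite_arcs by auto
  then have N: "1 \<le> N" unfolding N_def by linarith
  have "spec F C b < 1" if b: "card C * ln N / w + 1 \<le> b" for b
  proof (rule ccontr)
    assume ge: "\<not> spec F C b < 1"
    have "0 \<le> card C * ln N / w" using N w(1) by (intro divide_nonneg_pos mult_nonneg_nonneg) auto
    then have b0: "0 < b" using b by linarith
    obtain x where x: "\<And>v. v \<in> C \<Longrightarrow> 0 < x v" "\<And>v. v \<in> C \<Longrightarrow> mvec C (wmat G F b) x v = spec F C b * x v"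
      by (rule perron_frobenius[OF irr]) blast
    have "\<exists>e. e \<in> out_arcs G v \<and> head G e \<in> C \<and> x v \<le> N * (exp (- b * F e) * x (head G e))" if v: "v \<in> C" for v
    proof (rule ccontr)
      assume none: "\<not> ?thesis"
      let ?E = "{e \<in> out_arcs G v. head G e \<in> C}"
      have lt: "exp (- b * F e) * x (head G e) < x v / N" if "e \<in> ?E" for e
        using none that N by (auto simp: field_simps not_le)
      have "1 * x v \<le> spec F C b * x v" using ge x(1)[OF v] by (intro mult_right_mono) auto
      then have xv: "x v \<le> (\<Sum>e\<in>?E. exp (- b * F e) * x (head G e))"
        using x(2)[OF v] mvec_wmat[OF fin, of F b x v] by simp
      have ne: "?E \<noteq> {}"
      proof
        assume "?E = {}"
        then have "(\<Sum>e\<in>?E. exp (- b * F e) * x (head G e)) = 0" by (simp only: sum.empty)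
        with xv x(1)[OF v] show False by simp
      qed
      have "(\<Sum>e\<in>?E. exp (- b * F e) * x (head G e)) < (\<Sum>e\<in>?E. x v / N)"
        using lt ne by (intro sum_strict_mono finite_out_arcs_in) auto
      also have "\<dots> = card ?E * (x v / N)" by simp
      also have "\<dots> \<le> N * (x v / N)"
        using x(1)[OF v] N finite_arcs unfolding N_def
        by (intro mult_right_mono) (auto intro!: card_mono)
      also have "\<dots> = x v" using N by simp
      finally show False using xv by simp
    qed
    then obtain f where f: "\<And>v. v \<in> C \<Longrightarrow> f v \<in> arcs G \<and> tail G (f v) = v \<and> head G (f v) \<in> C \<and>
        x v \<le> N * (exp (- b * F (f v)) * x (head G (f v)))" by (metis in_out_arcs_conv)
    define g where "g v = head G (f v)" for v
    have g: "g v \<in> C" if "v \<in> C" for v using f that by (simp add: g_def)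
    have walk: "\<exists>p. length p = m \<and> awalk u p ((g ^^ m) u) \<and> edges_in C p \<and>
        x u \<le> N ^ m * (exp (- b * path_weight F p) * x ((g ^^ m) u))" if "u \<in> C" for u m
      using that
    proof (induction m arbitrary: u)
      case 0
      then show ?case
        using component_subset_verts[OF C] by (intro exI[of _ "[]"]) (auto simp: awalk_Nil_iff path_weight_def)
    next
      case (Suc m)
      obtain p where p: "length p = m" "awalk (g u) p ((g ^^ m) (g u))" "edges_in C p"
        "x (g u) \<le> N ^ m * (exp (- b * path_weight F p) * x ((g ^^ m) (g u)))"
        using Suc.IH[OF g[OF Suc.prems]] by auto
      note fu = f[OF Suc.prems]
      have "x u \<le> N * (exp (- b * F (f u)) * x (g u))" using fu by (simp add: g_def)
      also have "\<dots> \<le> N * (exp (- b * F (f u)) * (N ^ m * (exp (- b * path_weight F p) * x ((g ^^ m) (g u)))))"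
        using p(4) N by (intro mult_left_mono) auto
      also have "\<dots> = N ^ Suc m * (exp (- b * path_weight F (f u # p)) * x ((g ^^ Suc m) u))"
        by (simp add: path_weight_Cons exp_add[symmetric] funpow_swap1 algebra_simps)
      finally show ?case
        using p fu Suc.prems by (intro exI[of _ "f u # p"]) (auto simp: awalk_Cons_iff g_def[symmetric] funpow_swap1)
    qed
    obtain v0 where "v0 \<in> C" using component_edge[OF C] by auto
    then obtain u m where um: "u \<in> C" "0 < m" "m \<le> card C" "(g ^^ m) u = u"
      using iterate_cycle[of C v0 g] fin g by blast
    obtain p where p: "length p = m" "awalk u p u" "edges_in C p"
      "x u \<le> N ^ m * (exp (- b * path_weight F p) * x u)" using walk[OF um(1), of m] um(4) by auto
    have "p \<in> loops_in G C" using p um by (auto simp: loops_in_iff)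
    then have wp: "w \<le> path_weight F p" using w(2) p um by auto
    have "1 \<le> N ^ m * exp (- b * path_weight F p)"
      using p(4) x(1)[OF um(1)] by (simp add: mult.assoc[symmetric])
    then have "exp (b * path_weight F p) \<le> N ^ m" by (simp add: exp_minus field_simps)
    then have "ln (exp (b * path_weight F p)) \<le> ln (N ^ m)" using N by (subst ln_le_cancel_iff) auto
    then have "b * path_weight F p \<le> m * ln N" using N by (simp add: ln_realpow)
    also have "\<dots> \<le> card C * ln N" using um N by (intro mult_right_mono) auto
    finally have "b * w \<le> card C * ln N" using wp b0 by (smt (verit) mult_left_mono)
    moreover have "card C * ln N < b * w" using b w(1) by (simp add: field_simps)
    ultimately show False by simp
  qed
  then show thesis by (rule that)
qed

lemma comp_beta_pos:
  assumes C: "component G C" and pos: "pos_loops G F C"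
  shows "spec F C b = 1 \<longleftrightarrow> b = comp_beta G F C" "spec F C b < 1 \<longleftrightarrow> comp_beta G F C < b"
proof -
  obtain B where B: "\<And>b. B \<le> b \<Longrightarrow> spec F C b < 1" using pos_loops_spec_less_1[OF C pos] by blast
  note p = spec_pos[OF C, of F]
  obtain z where z: "\<And>b. ln (spec F C b) = 0 \<longleftrightarrow> b = z" "\<And>b. ln (spec F C b) < 0 \<longleftrightarrow> z < b"
    by (rule convex_unique_zero[OF spec_log_convex[OF C, of F], of B])
      (use spec_zero_ge_1[OF C, of F] B p in \<open>auto simp: ln_less_zero_iff\<close>)
  have z': "spec F C b = 1 \<longleftrightarrow> b = z" "spec F C b < 1 \<longleftrightarrow> z < b" for b
    using z[of b] p[of b] by auto
  then have "comp_beta G F C = z" unfolding comp_beta_def by auto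
  with z' show "spec F C b = 1 \<longleftrightarrow> b = comp_beta G F C" "spec F C b < 1 \<longleftrightarrow> comp_beta G F C < b" by auto
qed

lemma path_weight_uminus: "path_weight (\<lambda>e. - F e) p = - path_weight F p"
  by (induction p) (auto simp: path_weight_def)

text \<open>
  Replacing \<open>F\<close> and \<open>b\<close> by their negatives does not change \<open>A(b)\<close>.
\<close>

lemma comp_beta_neg:
  assumes C: "component G C" and neg: "neg_loops G F C"
  shows "spec F C b = 1 \<longleftrightarrow> b = comp_beta G F C" "spec F C b < 1 \<longleftrightarrow> b < comp_beta G F C"
proof -
  have pos: "pos_loops G (\<lambda>e. - F e) C" using neg by (simp add: pos_loops_def neg_loops_def path_weight_uminus)
  let ?z = "comp_beta G (\<lambda>e. - F e) C"
  have z': "spec F C b = 1 \<longleftrightarrow> b = - ?z" "spec F C b < 1 \<longleftrightarrow> b < - ?z" for b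
    using comp_beta_pos[OF C pos, of "- b"] unfolding wmat_uminus by auto
  then have "comp_beta G F C = - ?z" unfolding comp_beta_def[of G F C] by auto
  with z' show "spec F C b = 1 \<longleftrightarrow> b = comp_beta G F C" "spec F C b < 1 \<longleftrightarrow> b < comp_beta G F C" by auto
qed

lemma spec_less_1_loop:
  assumes C: "component G C" and "spec F C b < 1" and p: "p \<in> loops_in G C"
  shows "0 < b * path_weight F p"
proof -
  have "p \<noteq> []" using p by (simp add: loops_in_iff)
  then have "spec F C b ^ length p < 1"
    using assms(2) spec_pos[OF C, of F b] power_strict_decreasing[of 0 "length p" "spec F C b"] by simp
  then have "exp (- b * path_weight F p) < 1" using loop_weight_le[OF C p, of b F] by linarith
  then show ?thesis by simp
qed

section \<open>Circular components\<close>

text \<open>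
  This is the edge by edge form of circularity (\<open>deterministic_circular\<close>, \<open>circular_deterministic\<close>).
\<close>

definition deterministic_on :: "'a set \<Rightarrow> bool" where
  "deterministic_on C \<longleftrightarrow> (\<forall>e\<in>arcs G. \<forall>f\<in>arcs G. tail G e = tail G f \<longrightarrow> tail G e \<in> C \<longrightarrow> head G e \<in> C \<longrightarrow> head G f \<in> C \<longrightarrow> e = f)"

lemma deterministic_onD:
  assumes "deterministic_on C" "e \<in> arcs G" "f \<in> arcs G" "tail G e = tail G f" "tail G e \<in> C" "head G e \<in> C" "head G f \<in> C"
  shows "e = f"
  using assms by (auto simp: deterministic_on_def)

lemma closed_walk_heads:
  assumes "awalk u p w" "e \<in> set p"
  shows "head G e = w \<or> head G e \<in> tail G ` set p"
  using assms
proof (induction p arbitrary: u)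
  case (Cons f p)
  show ?case
  proof (cases "e = f")
    case True
    with Cons.prems show ?thesis by (cases p) (auto simp: awalk_Cons_iff awalk_Nil_iff)
  next
    case False
    with Cons show ?thesis by (auto simp: awalk_Cons_iff)
  qed
qed simp

lemma critical_walk_edges:
  assumes C: "finite C" and x: "\<And>v. v \<in> C \<Longrightarrow> 0 < x v" "\<And>v. v \<in> C \<Longrightarrow> mvec C (wmat G F b) x v = x v"
    and p: "awalk u p w" "edges_in C p" "u \<in> C" "x u \<le> exp (- b * path_weight F p) * x w" and e: "e \<in> set p"
  shows "x (tail G e) \<le> exp (- b * F e) * x (head G e)"
  using p e
proof (induction p arbitrary: u)
  case (Cons f p)
  then have f: "f \<in> arcs G" "tail G f = u" "u \<in> C" "head G f \<in> C" "awalk (head G f) p w" "edges_in C p"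
    by (auto simp: awalk_Cons_iff)
  define y where "y = exp (- b * path_weight F p) * x w"
  have tot: "x u \<le> exp (- b * F f) * y"
    using Cons.prems(4) by (simp add: y_def path_weight_Cons exp_add[symmetric] algebra_simps)
  have le1: "exp (- b * F f) * x (head G f) \<le> x u"
    using edge_le_mvec[where x = x and b = b and F = F, OF C x(1) f(1,4)] x(2)[OF f(3)] f(2) by simp
  have le2: "y \<le> x (head G f)"
  proof -
    have "mvec C (wmat G F b) x v \<le> 1 * x v" if "v \<in> C" for v using x(2)[OF that] by simp
    from walk_weight_le[where x = x and l = 1 and b = b and F = F, OF C x(1) this _ f(5,6,4)]
    show ?thesis by (simp add: y_def)
  qed
  have "exp (- b * F f) * x (head G f) \<le> exp (- b * F f) * y" using le1 tot by linarith
  then have "x (head G f) \<le> y" by simp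
  moreover have "x u \<le> exp (- b * F f) * x (head G f)"
    using tot mult_left_mono[OF le2 exp_ge_zero, of "- b * F f"] by linarith
  ultimately show ?case
    using Cons.IH[OF f(5,6,4)] Cons.prems(5) f(2) by (auto simp: y_def)
qed simp

text \<open>
  If \<open>\<rho> = 1\<close> and \<open>exp (-bF(p)) \<ge> 1\<close>, all the inequalities behind \<open>loop_weight_le\<close> are equalities. Then an
  edge of \<open>p\<close> contributes everything to \<open>x\<^sub>v = (A(b)\<^sup>C x)\<^sub>v\<close> at its source \<open>v\<close>, so no other edge in \<open>C\<close> starts
  at \<open>v\<close>. Hence the vertices of \<open>p\<close> are closed under edges in \<open>C\<close>, and \<open>p\<close> visits all of \<open>C\<close>.
\<close>

lemma critical_loop_deterministic:
  assumes C: "component G C" and 1: "spec F C b = 1" and p: "p \<in> loops_in G C" "b * path_weight F p \<le> 0"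
  shows "deterministic_on C"
proof -
  note irr = component_irreducible[OF C] and fin = component_finite[OF C]
  obtain x where x: "\<And>v. v \<in> C \<Longrightarrow> 0 < x v" "\<And>v. v \<in> C \<Longrightarrow> mvec C (wmat G F b) x v = spec F C b * x v"
    by (rule perron_frobenius[OF irr]) blast
  have x2: "mvec C (wmat G F b) x v = x v" if "v \<in> C" for v using x(2)[OF that] 1 by simp
  obtain u where u: "awalk u p u" "p \<noteq> []" "edges_in C p" using p by (auto simp: loops_in_iff)
  have uC: "u \<in> C" "u \<in> tail G ` set p" using awalk_hd[OF u(1,2)] u by (cases p; auto)+
  have "1 \<le> exp (- b * path_weight F p)" using p(2) by simp
  then have "x u \<le> exp (- b * path_weight F p) * x u" using mult_right_mono[of 1 _ "x u"] x(1)[OF uC(1)] by simp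
  then have tight: "x (tail G e) \<le> exp (- b * F e) * x (head G e)" if "e \<in> set p" for e
    using critical_walk_edges[where x = x, OF fin x(1) x2 u(1,3) uC(1) _ that] by blast
  have only: "f = e" if e: "e \<in> set p" and f: "f \<in> arcs G" "tail G f = tail G e" "head G f \<in> C" for e f
  proof (rule ccontr)
    assume "f \<noteq> e"
    have eC: "e \<in> arcs G" "tail G e \<in> C" "head G e \<in> C" using e u by (auto simp: awalk_def edges_in_def)
    let ?E = "{e' \<in> out_arcs G (tail G e). head G e' \<in> C}"
    have "(\<Sum>e'\<in>{e, f}. exp (- b * F e') * x (head G e')) \<le> (\<Sum>e'\<in>?E. exp (- b * F e') * x (head G e'))"
      using e f eC x(1) by (intro sum_mono2 finite_out_arcs_in) (auto intro: less_imp_le)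
    also have "\<dots> = x (tail G e)" using x2[OF eC(2)] mvec_wmat[OF fin, of F b x "tail G e"] by simp
    finally have "exp (- b * F e) * x (head G e) + exp (- b * F f) * x (head G f) \<le> x (tail G e)"
      using \<open>f \<noteq> e\<close> by simp
    moreover have "0 < exp (- b * F f) * x (head G f)" using x(1)[OF f(3)] by simp
    ultimately show False using tight[OF e] by linarith
  qed
  have "C \<subseteq> tail G ` set p"
  proof (rule irreducible_on_forward_closed[OF irr uC(2,1)])
    fix v w assume vw: "v \<in> C" "w \<in> C" "0 < wmat G F b v w" "v \<in> tail G ` set p"
    then obtain e f where e: "e \<in> set p" "tail G e = v" and f: "f \<in> arcs G" "tail G f = v" "head G f = w"
      by (auto simp: wmat_pos_iff)
    then have "f = e" using only[of e f] vw by simp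
    then show "w \<in> tail G ` set p" using closed_walk_heads[OF u(1) e(1)] f uC by auto
  qed
  then show ?thesis
    unfolding deterministic_on_def
  proof (intro ballI impI)
    fix e f assume ef: "e \<in> arcs G" "f \<in> arcs G" "tail G e = tail G f" "tail G e \<in> C" "head G e \<in> C" "head G f \<in> C"
    then obtain g where "g \<in> set p" "tail G e = tail G g" using \<open>C \<subseteq> tail G ` set p\<close> by blast
    then show "e = f" using only[of g e] only[of g f] ef by simp
  qed
qed

lemma deterministic_walk_prefix:
  assumes "deterministic_on C" "awalk u p w" "awalk u q w'" "edges_in C p" "edges_in C q" "length p \<le> length q"
  shows "p = take (length p) q"
  using assms(2-)
proof (induction p arbitrary: u q)
  case (Cons e p)
  then obtain f q' where q: "q = f # q'" by (cases q) auto
  with Cons.prems have "e \<in> arcs G" "f \<in> arcs G" "tail G e = tail G f" "tail G e \<in> C" "head G e \<in> C" "head G f \<in> C"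
    by (auto simp: awalk_Cons_iff)
  then have "e = f" using deterministic_onD[OF assms(1)] by blast
  with Cons q show ?case by (auto simp: awalk_Cons_iff)
qed simp

lemma deterministic_walk_unique:
  assumes "deterministic_on C" "awalk u p w" "awalk u q w'" "edges_in C p" "edges_in C q" "length p = length q"
  shows "p = q"
  using deterministic_walk_prefix[OF assms(1-5)] assms(6) by simp

lemma awalk_power:
  assumes "awalk u p u"
  shows "awalk u (concat (replicate n p)) u"
  using assms by (induction n) (auto intro!: awalk_appendI simp: awalk_Nil_iff awalk_hd_in_verts simp del: awalk_append_iff)

lemma length_concat_replicate: "length (concat (replicate n p)) = n * length p"
  by (induction n) auto

lemma edges_in_power: "edges_in C p \<Longrightarrow> edges_in C (concat (replicate n p))"
  by (induction n) auto

text \<open>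
  Let \<open>\<nu>\<close> be a shortest loop, with base point \<open>u\<close>. As walks are determined by their start and their
  length, every closed walk at \<open>u\<close> is a power of \<open>\<nu>\<close>. If \<open>q\<close> is a loop at \<open>v\<close> and \<open>r\<close> a shortest walk from \<open>u\<close>
  to \<open>v\<close>, then \<open>r q = \<nu>\<^sup>n r\<close> for some \<open>n\<close>, and \<open>q\<close> is the rotation of \<open>\<nu>\<^sup>n\<close> by the length of \<open>r\<close>.
\<close>

lemma deterministic_circular:
  assumes C: "component G C" and det: "deterministic_on C"
  shows "circular G C"
proof -
  obtain \<nu> where \<nu>: "\<nu> \<in> loops_in G C" and min: "\<And>p. p \<in> loops_in G C \<Longrightarrow> length \<nu> \<le> length p"
  proof -
    obtain p where "p \<in> loops_in G C" using component_loop[OF C] .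
    then show thesis using ex_has_least_nat[of "\<lambda>p. p \<in> loops_in G C" p length] that by blast
  qed
  obtain u where u: "awalk u \<nu> u" "\<nu> \<noteq> []" "edges_in C \<nu>" using \<nu> by (auto simp: loops_in_iff)
  have uC: "u \<in> C" using awalk_hd[OF u(1,2)] u by (cases \<nu>) auto
  have closed: "\<exists>n. a = concat (replicate n \<nu>)" if "awalk u a u" "edges_in C a" for a
    using that
  proof (induction "length a" arbitrary: a rule: less_induct)
    case less
    show ?case
    proof (cases "a = []")
      case True
      then show ?thesis by (intro exI[of _ 0]) simp
    next
      case False
      with less.prems have "a \<in> loops_in G C" by (auto simp: loops_in_iff)
      then have "\<nu> = take (length \<nu>) a"
        using deterministic_walk_prefix[OF det u(1) less.prems(1) u(3) less.prems(2)] min by simp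
      then obtain s where s: "a = \<nu> @ s" by (metis append_take_drop_id)
      have "awlast u \<nu> = u" using u(1) by auto
      then have "awalk u s u" "edges_in C s" using less.prems s by auto
      moreover have "length s < length a" using s u(2) by simp
      ultimately obtain n where "s = concat (replicate n \<nu>)" using less.hyps by blast
      with s show ?thesis by (intro exI[of _ "Suc n"]) simp
    qed
  qed
  have "\<exists>k n. q = rotate k (concat (replicate n \<nu>))" if q: "q \<in> loops_in G C" for q
  proof -
    obtain v where v: "awalk v q v" "q \<noteq> []" "edges_in C q" using q by (auto simp: loops_in_iff)
    have vC: "v \<in> C" using awalk_hd[OF v(1,2)] v by (cases q) auto
    obtain r0 where r0: "awalk u r0 v" "edges_in C r0" using component_walk[OF C uC vC] by blast
    then have "\<exists>r. (awalk u r v \<and> edges_in C r) \<and> (\<forall>p. awalk u p v \<and> edges_in C p \<longrightarrow> length r \<le> length p)"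
      by (intro ex_has_least_nat[of "\<lambda>r. awalk u r v \<and> edges_in C r" r0]) simp
    then obtain r where r: "awalk u r v" "edges_in C r"
      and r_min: "\<And>p. awalk u p v \<Longrightarrow> edges_in C p \<Longrightarrow> length r \<le> length p"
      by auto
    obtain r' where r': "awalk v r' u" "edges_in C r'" using component_walk[OF C vC uC] by blast
    \<comment> \<open>Otherwise \<open>r\<close> starts with \<open>\<nu>\<close>, which can be dropped.\<close>
    have "length r < length \<nu>"
    proof (rule ccontr)
      assume "\<not> length r < length \<nu>"
      then have "\<nu> = take (length \<nu>) r" using deterministic_walk_prefix[OF det u(1) r(1) u(3) r(2)] by simp
      then obtain s where s: "r = \<nu> @ s" by (metis append_take_drop_id)
      have "awlast u \<nu> = u" using u(1) by auto
      then have "awalk u s v" "edges_in C s" using r s by auto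
      then have "length r \<le> length s" by (rule r_min)
      with s u(2) show False by simp
    qed
    have "edges_in C (r @ r')" "edges_in C (r @ q @ r')" using r r' v by simp_all
    note cl = closed[OF awalk_appendI[OF r(1) r'(1)] this(1)]
      closed[OF awalk_appendI[OF r(1) awalk_appendI[OF v(1) r'(1)]] this(2)]
    obtain N where "r @ r' = concat (replicate N \<nu>)" using cl(1) by blast
    then have "length (r @ r') = N * length \<nu>" by (simp only: length_concat_replicate)
    then have N: "length r + length r' = N * length \<nu>" by simp
    obtain M where "r @ q @ r' = concat (replicate M \<nu>)" using cl(2) by blast
    then have "length (r @ q @ r') = M * length \<nu>" by (simp only: length_concat_replicate)
    then have M: "length r + (length q + length r') = M * length \<nu>" by simp
    define n where "n = M - N"
    have n: "length q = n * length \<nu>" using N M by (simp add: n_def diff_mult_distrib)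
    define a where "a = concat (replicate n \<nu>)"
    have a: "awalk u a u" "edges_in C a" "length a = length q"
      using awalk_power[OF u(1)] edges_in_power[OF u(3)] n by (auto simp: a_def length_concat_replicate)
    have rq: "r @ q = a @ r"
      by (rule deterministic_walk_unique[OF det awalk_appendI[OF r(1) v(1)] awalk_appendI[OF a(1) r(1)]])
        (use r v a in auto)
    have "length r \<le> length a" using \<open>length r < length \<nu>\<close> min[OF q] a(3) by simp
    then have "take (length r) a = take (length r) (a @ r)" by simp
    also have "\<dots> = take (length r) (r @ q)" by (simp only: rq)
    also have "\<dots> = r" by simp
    finally obtain s where s: "a = r @ s" by (metis append_take_drop_id)
    then have "q = s @ r" using rq by simp
    with s have "q = rotate (length r) a" by (simp add: rotate_append)
    then show ?thesis unfolding a_def by blast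
  qed
  then show ?thesis using \<nu> by (auto simp: circular_def circular_with_def)
qed

text \<open>
  Each loop in \<open>C\<close> has the same edges as \<open>\<nu>\<close> and is at least as long. So every edge in \<open>C\<close> occurs in \<open>\<nu>\<close>, and
  two different edges with the same source would cut a shorter loop out of \<open>\<nu>\<close>.
\<close>

lemma circular_deterministic:
  assumes C: "component G C" and \<nu>: "circular_with G C \<nu>"
  shows "deterministic_on C"
proof -
  have loop: "set p = set \<nu>" "length \<nu> \<le> length p" if p: "p \<in> loops_in G C" for p
  proof -
    obtain k n where kn: "p = rotate k (concat (replicate n \<nu>))" using p \<nu> by (auto simp: circular_with_def)
    have "n \<noteq> 0" using p kn by (auto simp: loops_in_iff)
    then obtain m where "n = Suc m" by (cases n) auto
    then show "set p = set \<nu>" "length \<nu> \<le> length p" using kn by (auto simp: length_concat_replicate)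
  qed
  have edge: "e \<in> set \<nu>" if e: "e \<in> arcs G" "tail G e \<in> C" "head G e \<in> C" for e
  proof -
    obtain p where p: "awalk (head G e) p (tail G e)" "edges_in C p" by (rule component_walk[OF C e(3,2)])
    have "e # p \<in> loops_in G C" using p e by (auto simp: loops_in_iff awalk_Cons_iff)
    from loop(1)[OF this] show ?thesis by auto
  qed
  obtain u where u: "awalk u \<nu> u" "edges_in C \<nu>" using \<nu> by (auto simp: circular_with_def loops_in_iff)
  \<comment> \<open>The part of \<open>\<nu>\<close> between two edges with the same source is a shorter loop.\<close>
  have no_split: False if "\<nu> = xs @ e # ys @ f # zs" "tail G e = tail G f" for xs e ys f zs
  proof -
    have "awalk (tail G e) (e # ys) (tail G f)"
      using u(1) unfolding that(1) by (auto simp: awalk_Cons_iff)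
    then have "e # ys \<in> loops_in G C" using u(2) that by (auto simp: loops_in_iff simp del: awalk_append_iff)
    from loop(2)[OF this] that(1) show False by simp
  qed
  show ?thesis
    unfolding deterministic_on_def
  proof (intro ballI impI)
    fix e f assume ef: "e \<in> arcs G" "f \<in> arcs G" "tail G e = tail G f" "tail G e \<in> C" "head G e \<in> C" "head G f \<in> C"
    then have "e \<in> set \<nu>" "f \<in> set \<nu>" using edge by auto
    then obtain xs ys where xy: "\<nu> = xs @ e # ys" "f \<in> set xs \<union> {e} \<union> set ys" by (auto dest: split_list)
    show "e = f"
    proof (rule ccontr)
      assume "e \<noteq> f"
      then consider "f \<in> set xs" | "f \<in> set ys" using xy by auto
      then show False
      proof cases
        case 1
        then obtain as bs where "xs = as @ f # bs" by (auto dest: split_list)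
        then show False using no_split[of as f bs e ys] xy ef by simp
      next
        case 2
        then obtain as bs where "ys = as @ f # bs" by (auto dest: split_list)
        then show False using no_split[of xs e as f bs] xy ef by simp
      qed
    qed
  qed
qed

text \<open>
  With a single term in each row, the inequality of \<open>walk_weight_le\<close> is an equality.
\<close>

lemma deterministic_walk_weight:
  assumes C: "component G C" and det: "deterministic_on C"
    and x: "\<And>v. v \<in> C \<Longrightarrow> mvec C (wmat G F b) x v = l * x v"
    and p: "awalk u p w" "edges_in C p" "u \<in> C"
  shows "exp (- b * path_weight F p) * x w = l ^ length p * x u"
  using p
proof (induction p arbitrary: u)
  case Nil
  then show ?case by (simp add: awalk_Nil_iff path_weight_def)
next
  case (Cons e p)
  then have e: "e \<in> arcs G" "tail G e = u" "u \<in> C" "head G e \<in> C" "awalk (head G e) p w" "edges_in C p"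
    by (auto simp: awalk_Cons_iff)
  have only: "{f \<in> out_arcs G u. head G f \<in> C} = {e}"
  proof
    show "{f \<in> out_arcs G u. head G f \<in> C} \<subseteq> {e}"
    proof
      fix f assume "f \<in> {f \<in> out_arcs G u. head G f \<in> C}"
      then have "f = e" using e by (intro deterministic_onD[OF det]) auto
      then show "f \<in> {e}" by simp
    qed
  qed (use e in auto)
  have "mvec C (wmat G F b) x u = exp (- b * F e) * x (head G e)"
    unfolding mvec_wmat[OF component_finite[OF C]] only by simp
  then have xu: "exp (- b * F e) * x (head G e) = l * x u" using x[OF e(3)] by simp
  have "exp (- b * path_weight F (e # p)) * x w = exp (- b * F e) * (exp (- b * path_weight F p) * x w)"
    by (simp add: path_weight_Cons exp_add[symmetric] algebra_simps)
  also have "\<dots> = l ^ length p * (exp (- b * F e) * x (head G e))"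
    using Cons.IH[OF e(5,6,4)] by simp
  finally show ?case using xu by simp
qed

lemma circular_spec:
  assumes C: "component G C" and \<nu>: "circular_with G C \<nu>"
  shows "spec F C b = 1 \<longleftrightarrow> b * path_weight F \<nu> = 0"
proof -
  obtain x where x: "\<And>v. v \<in> C \<Longrightarrow> 0 < x v" "\<And>v. v \<in> C \<Longrightarrow> mvec C (wmat G F b) x v = spec F C b * x v"
    by (rule perron_frobenius[OF component_irreducible[OF C]]) blast
  obtain u where u: "awalk u \<nu> u" "\<nu> \<noteq> []" "edges_in C \<nu>" using \<nu> by (auto simp: circular_with_def loops_in_iff)
  have uC: "u \<in> C" using awalk_hd[OF u(1,2)] u by (cases \<nu>) auto
  have "exp (- b * path_weight F \<nu>) * x u = spec F C b ^ length \<nu> * x u"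
    using deterministic_walk_weight[where x = x, OF C circular_deterministic[OF C \<nu>] x(2) u(1,3) uC] by simp
  then have "exp (- b * path_weight F \<nu>) = spec F C b ^ length \<nu>" using x(1)[OF uC] by simp
  moreover have "spec F C b ^ length \<nu> = 1 \<longleftrightarrow> spec F C b = 1"
  proof
    assume "spec F C b ^ length \<nu> = 1"
    then have "spec F C b ^ length \<nu> = 1 ^ length \<nu>" by simp
    then show "spec F C b = 1"
      by (rule power_eq_imp_eq_base) (use spec_pos[OF C, of F b] u(2) in auto)
  qed simp
  moreover have "exp (- b * path_weight F \<nu>) = 1 \<longleftrightarrow> b * path_weight F \<nu> = 0" by simp
  ultimately show ?thesis by argo
qed

lemma critical_noncircular_loop:
  assumes C: "component G C" "\<not> circular G C" and "spec F C b = 1" and p: "p \<in> loops_in G C"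
  shows "0 < b * path_weight F p"
proof (rule ccontr)
  assume "\<not> 0 < b * path_weight F p"
  then have "b * path_weight F p \<le> 0" by simp
  from critical_loop_deterministic[OF C(1) assms(3) p this] deterministic_circular[OF C(1)] C(2)
  show False by blast
qed

section \<open>Backward closed sets and the index sets\<close>

definition backward_closed :: "'a set \<Rightarrow> bool" where
  "backward_closed X \<longleftrightarrow> X \<subseteq> verts G \<and> (\<forall>e\<in>arcs G. head G e \<in> X \<longrightarrow> tail G e \<in> X)"

lemma backward_closed_reachable:
  assumes "backward_closed X" "v \<rightarrow>\<^sup>* w" "w \<in> X"
  shows "v \<in> X"
  using assms(2,3)
proof (induction rule: converse_reachable_induct)
  case (step x y)
  then obtain e where "e \<in> arcs G" "tail G e = x" "head G e = y" by (auto simp: arcs_ends_def arc_to_ends_def)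
  with step assms(1) show ?case by (auto simp: backward_closed_def)
qed

lemma arc_reachable: "e \<in> arcs G \<Longrightarrow> tail G e \<rightarrow>\<^sup>* head G e"
  by (intro reachable_adjI in_arcs_imp_in_arcs_ends)

lemma backward_closed_up_closure: "backward_closed (up_closure G Y)"
  using arc_reachable by (auto simp: backward_closed_def up_closure_def intro: reachable_trans)

lemma subset_up_closure: "Y \<subseteq> verts G \<Longrightarrow> Y \<subseteq> up_closure G Y"
  by (auto simp: up_closure_def)

lemma backward_closed_up_closure_minus:
  assumes C: "component G C"
  shows "backward_closed (up_closure G C - C)"
proof -
  have "tail G e \<notin> C" if e: "e \<in> arcs G" "head G e \<in> up_closure G C" "head G e \<notin> C" for e
  proof
    assume t: "tail G e \<in> C"
    obtain w where w: "w \<in> C" "head G e \<rightarrow>\<^sup>* w" using e(2) by (auto simp: up_closure_def)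
    then have "head G e \<rightarrow>\<^sup>* tail G e" using component_reachable[OF C w(1) t] reachable_trans by blast
    then show False using component_closed[OF C t arc_reachable[OF e(1)]] e(3) by blast
  qed
  then show ?thesis using backward_closed_up_closure[of C] by (auto simp: backward_closed_def)
qed

lemma loops_in_mono: "X \<subseteq> Y \<Longrightarrow> loops_in G X \<subseteq> loops_in G Y"
  by (auto simp: loops_in_def)

lemma edge_class_component:
  assumes "e \<in> arcs G" "head G e \<rightarrow>\<^sup>* tail G e"
  shows "component G {w. tail G e \<rightarrow>\<^sup>* w \<and> w \<rightarrow>\<^sup>* tail G e}"
proof -
  let ?C = "{w. tail G e \<rightarrow>\<^sup>* w \<and> w \<rightarrow>\<^sup>* tail G e}"
  have eq: "?C = {(v, w). v \<rightarrow>\<^sup>* w \<and> w \<rightarrow>\<^sup>* v} `` {tail G e}" by auto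
  have "?C \<in> verts G // {(v, w). v \<rightarrow>\<^sup>* w \<and> w \<rightarrow>\<^sup>* v}"
    unfolding eq by (rule quotientI) (use assms(1) in auto)
  moreover have "tail G e \<in> ?C" "head G e \<in> ?C" using assms arc_reachable[OF assms(1)] by auto
  ultimately show ?thesis using assms(1) unfolding component_def by blast
qed

text \<open>The vertices of a loop reach each other.\<close>

lemma loop_in_component:
  assumes X: "backward_closed X" and p: "p \<in> loops_in G X"
  obtains C where "C \<in> components_in G X" "p \<in> loops_in G C"
proof -
  obtain u where u: "awalk u p u" "p \<noteq> []" "edges_in X p" using p by (auto simp: loops_in_iff)
  obtain e q where eq: "p = e # q" using u(2) by (cases p) auto
  have e: "e \<in> arcs G" "tail G e = u" "awalk (head G e) q u" using u(1) eq by (auto simp: awalk_Cons_iff)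
  let ?C = "{w. tail G e \<rightarrow>\<^sup>* w \<and> w \<rightarrow>\<^sup>* tail G e}"
  have C: "component G ?C" by (rule edge_class_component) (use e in \<open>auto intro: reachable_awalkI\<close>)
  have "tail G e \<in> X" using u(3) eq by simp
  then have sub: "?C \<subseteq> X" using backward_closed_reachable[OF X] by auto
  have "u \<rightarrow>\<^sup>* tail G f \<and> tail G f \<rightarrow>\<^sup>* u \<and> u \<rightarrow>\<^sup>* head G f \<and> head G f \<rightarrow>\<^sup>* u" if f: "f \<in> set p" for f
  proof -
    obtain xs ys where xy: "p = xs @ f # ys" using f by (auto dest: split_list)
    have "awalk u xs (tail G f)" "awalk (tail G f) (f # ys) u" "f \<in> arcs G" "awalk (head G f) ys u"
      using u(1) unfolding xy by (auto simp: awalk_Cons_iff)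
    then show ?thesis using arc_reachable[of f] by (meson reachable_awalkI reachable_trans)
  qed
  then have "edges_in ?C p" using e(2) by (auto simp: edges_in_def)
  then have "p \<in> loops_in G ?C" using u by (auto simp: loops_in_iff)
  with C sub that show thesis by (auto simp: components_in_def)
qed

lemma loops_in_eq_Union:
  assumes X: "backward_closed X"
  shows "loops_in G X = (\<Union>C\<in>components_in G X. loops_in G C)"
proof (intro equalityI subsetI)
  fix p assume "p \<in> loops_in G X"
  then obtain C where "C \<in> components_in G X" "p \<in> loops_in G C" by (rule loop_in_component[OF X])
  then show "p \<in> (\<Union>C\<in>components_in G X. loops_in G C)" by (rule UN_I)
next
  fix p assume "p \<in> (\<Union>C\<in>components_in G X. loops_in G C)"
  then obtain C where "C \<subseteq> X" "p \<in> loops_in G C" by (auto simp: components_in_def)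
  then show "p \<in> loops_in G X" using loops_in_mono[of C X] by blast
qed

lemma pos_loops_iff:
  assumes "backward_closed X"
  shows "pos_loops G F X \<longleftrightarrow> (\<forall>C\<in>components_in G X. pos_loops G F C)"
    and "neg_loops G F X \<longleftrightarrow> (\<forall>C\<in>components_in G X. neg_loops G F C)"
  unfolding pos_loops_def neg_loops_def loops_in_eq_Union[OF assms] by simp_all

lemma loops_in_empty_iff:
  assumes "backward_closed X"
  shows "loops_in G X = {} \<longleftrightarrow> components_in G X = {}"
proof -
  have "loops_in G C \<noteq> {}" if "C \<in> components_in G X" for C
  proof -
    have "component G C" using that by (simp add: components_in_def)
    then obtain p where "p \<in> loops_in G C" by (rule component_loop)
    then show ?thesis by auto
  qed
  then show ?thesis unfolding loops_in_eq_Union[OF assms] by auto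
qed

lemma finite_components_in: "X \<subseteq> verts G \<Longrightarrow> finite (components_in G X)"
  by (rule finite_subset[of _ "Pow (verts G)"]) (auto simp: components_in_def)

definition subcritical :: "('b \<Rightarrow> real) \<Rightarrow> real \<Rightarrow> 'a set \<Rightarrow> bool" where
  "subcritical F b X \<longleftrightarrow> (\<forall>C\<in>components_in G X. spec F C b < 1)"

lemma subcritical_pos:
  assumes "backward_closed X" "pos_loops G F X"
  shows "subcritical F b X \<longleftrightarrow> (\<forall>C\<in>components_in G X. comp_beta G F C < b)"
proof -
  have "spec F C b < 1 \<longleftrightarrow> comp_beta G F C < b" if "C \<in> components_in G X" for C
    by (rule comp_beta_pos(2)) (use that assms(2)[unfolded pos_loops_iff(1)[OF assms(1)]] in \<open>auto simp: components_in_def\<close>)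
  then show ?thesis unfolding subcritical_def by simp
qed

lemma subcritical_neg:
  assumes "backward_closed X" "neg_loops G F X"
  shows "subcritical F b X \<longleftrightarrow> (\<forall>C\<in>components_in G X. b < comp_beta G F C)"
proof -
  have "spec F C b < 1 \<longleftrightarrow> b < comp_beta G F C" if "C \<in> components_in G X" for C
    by (rule comp_beta_neg(2)) (use that assms(2)[unfolded pos_loops_iff(2)[OF assms(1)]] in \<open>auto simp: components_in_def\<close>)
  then show ?thesis unfolding subcritical_def by simp
qed

text \<open>
  For a loop \<open>p\<close> in a component, \<open>exp (-bF(p))\<close> is at most a power of the spectral radius, hence below \<open>1\<close>.
\<close>

lemma subcritical_loops:
  assumes X: "backward_closed X" and sub: "subcritical F b X" and b: "b \<noteq> 0"
  shows "if 0 < b then pos_loops G F X else neg_loops G F X"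
proof -
  have "0 < b * path_weight F p" if p: "p \<in> loops_in G X" for p
  proof -
    obtain C where C: "C \<in> components_in G X" "p \<in> loops_in G C" by (rule loop_in_component[OF X p])
    have "component G C" "spec F C b < 1" using C(1) sub by (auto simp: components_in_def subcritical_def)
    then show ?thesis using C(2) by (rule spec_less_1_loop)
  qed
  then show ?thesis using b by (auto simp: pos_loops_def neg_loops_def zero_less_mult_iff)
qed

lemma components_in_up_closure:
  assumes C: "component G C"
  shows "components_in G (up_closure G C) = insert C (components_in G (up_closure G C - C))"
proof -
  have "C \<subseteq> up_closure G C" by (rule subset_up_closure[OF component_subset_verts[OF C]])
  moreover have "D \<inter> C = {}" if "component G D" "D \<noteq> C" for D
    using component_disjoint[OF C that(1)] that(2) by blast
  ultimately show ?thesis using C by (auto simp: components_in_def)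
qed

text \<open>
  Both types at once: the weights of loops have the sign of \<open>b\<close>, by \<open>critical_noncircular_loop\<close> and
  \<open>subcritical_loops\<close>, so that \<open>comp_beta_pos\<close> or \<open>comp_beta_neg\<close> translates between critical parameters and
  spectral radii.
\<close>

theorem C_set_iff:
  assumes b: "b \<noteq> 0"
  shows "C \<in> C_set G F b \<longleftrightarrow> component G C \<and> \<not> circular G C \<and> spec F C b = 1 \<and> subcritical F b (up_closure G C - C)"
    (is "?L \<longleftrightarrow> ?R")
proof
  assume ?L
  then consider (pos) "kms_noncircular_pos G F C" "comp_beta G F C = b" | (neg) "kms_noncircular_neg G F C" "comp_beta G F C = b"
    by (auto simp: C_set_def)
  then show ?R
  proof cases
    case pos
    then have C: "component G C" "\<not> circular G C" "pos_loops G F (up_closure G C)"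
      "\<And>D. D \<in> components_in G (up_closure G C - C) \<Longrightarrow> comp_beta G F D < b"
      by (auto simp: kms_noncircular_pos_def)
    have "pos_loops G F C"
      using C(3) pos_loops_iff(1)[OF backward_closed_up_closure] components_in_up_closure[OF C(1)] by blast
    then have "spec F C b = 1" using comp_beta_pos(1)[OF C(1), of F b] pos(2) by simp
    moreover have "pos_loops G F (up_closure G C - C)"
      using C(3) loops_in_mono[of "up_closure G C - C" "up_closure G C"] by (auto simp: pos_loops_def)
    then have "subcritical F b (up_closure G C - C)"
      using C(4) subcritical_pos[OF backward_closed_up_closure_minus[OF C(1)]] by blast
    ultimately show ?R using C(1,2) by simp
  next
    case neg
    then have C: "component G C" "\<not> circular G C" "neg_loops G F (up_closure G C)"
      "\<And>D. D \<in> components_in G (up_closure G C - C) \<Longrightarrow> b < comp_beta G F D"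
      by (auto simp: kms_noncircular_neg_def)
    have "neg_loops G F C"
      using C(3) pos_loops_iff(2)[OF backward_closed_up_closure] components_in_up_closure[OF C(1)] by blast
    then have "spec F C b = 1" using comp_beta_neg(1)[OF C(1), of F b] neg(2) by simp
    moreover have "neg_loops G F (up_closure G C - C)"
      using C(3) loops_in_mono[of "up_closure G C - C" "up_closure G C"] by (auto simp: neg_loops_def)
    then have "subcritical F b (up_closure G C - C)"
      using C(4) subcritical_neg[OF backward_closed_up_closure_minus[OF C(1)]] by blast
    ultimately show ?R using C(1,2) by simp
  qed
next
  assume R: ?R
  then have C: "component G C" "\<not> circular G C" "spec F C b = 1" and sub: "subcritical F b (up_closure G C - C)" by auto
  note bc = backward_closed_up_closure_minus[OF C(1)]
  have loops: "0 < b * path_weight F p" if "p \<in> loops_in G C" for p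
    by (rule critical_noncircular_loop[OF C that])
  note rest = subcritical_loops[OF bc sub b]
  show ?L
  proof (cases "0 < b")
    case True
    then have pos: "pos_loops G F C" "pos_loops G F (up_closure G C - C)"
      using loops rest by (auto simp: pos_loops_def zero_less_mult_iff)
    then have all: "pos_loops G F (up_closure G C)"
      unfolding pos_loops_iff(1)[OF backward_closed_up_closure] components_in_up_closure[OF C(1)]
      using pos_loops_iff(1)[OF bc, of F] by simp
    have beta: "comp_beta G F C = b" using comp_beta_pos(1)[OF C(1) pos(1), of b] C(3) by simp
    have "kms_noncircular_pos G F C"
      unfolding kms_noncircular_pos_def beta
      using C(1,2) all sub[unfolded subcritical_pos[OF bc pos(2)]] by (intro conjI)
    then show ?L unfolding C_set_def using beta by simp
  next
    case False
    then have neg: "neg_loops G F C" "neg_loops G F (up_closure G C - C)"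
      using loops rest by (auto simp: neg_loops_def zero_less_mult_iff)
    then have all: "neg_loops G F (up_closure G C)"
      unfolding pos_loops_iff(2)[OF backward_closed_up_closure] components_in_up_closure[OF C(1)]
      using pos_loops_iff(2)[OF bc, of F] by simp
    have beta: "comp_beta G F C = b" using comp_beta_neg(1)[OF C(1) neg(1), of b] C(3) by simp
    have "kms_noncircular_neg G F C"
      unfolding kms_noncircular_neg_def beta
      using C(1,2) all sub[unfolded subcritical_neg[OF bc neg(2)]] by (intro conjI)
    then show ?L unfolding C_set_def using beta by simp
  qed
qed

text \<open>
  The conditions on circular components and on sinks differ only in the set \<open>X\<close>.
\<close>

lemma interval_iff_subcritical:
  assumes X: "backward_closed X" and b: "b \<noteq> 0"
  shows "(pos_loops G F X \<or> neg_loops G F X) \<and>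
      b \<in> (if components_in G X = {} then UNIV
           else if pos_loops G F X then {Max (comp_beta G F ` components_in G X)<..}
           else {..<Min (comp_beta G F ` components_in G X)})
    \<longleftrightarrow> subcritical F b X"
proof (cases "components_in G X = {}")
  case True
  then show ?thesis using pos_loops_iff(1)[OF X, of F] by (simp add: subcritical_def)
next
  case False
  have fin: "finite (components_in G X)" using X by (intro finite_components_in) (simp add: backward_closed_def)
  have "loops_in G X \<noteq> {}" using loops_in_empty_iff[OF X] False by simp
  then have both: "\<not> (pos_loops G F X \<and> neg_loops G F X)"
    by (force simp: pos_loops_def neg_loops_def)
  have "subcritical F b X \<Longrightarrow> pos_loops G F X \<or> neg_loops G F X"
    using subcritical_loops[OF X _ b, of F] by (auto split: if_splits)
  then show ?thesis
    using False fin both subcritical_pos[OF X, of F b] subcritical_neg[OF X, of F b] by auto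
qed

theorem Z_set_iff:
  assumes b: "b \<noteq> 0"
  shows "C \<in> Z_set G F b \<longleftrightarrow> component G C \<and> circular G C \<and> spec F C b = 1 \<and> subcritical F b (up_closure G C - C)"
proof (cases "component G C")
  case True
  have "(\<exists>\<nu>. circular_with G C \<nu> \<and> path_weight F \<nu> = 0) \<longleftrightarrow> circular G C \<and> spec F C b = 1"
    using circular_spec[OF True, of _ F b] b by (auto simp: circular_def)
  then show ?thesis
    using interval_iff_subcritical[OF backward_closed_up_closure_minus[OF True] b, of F] True
    by (auto simp: Z_set_def kms_circular_def circ_interval_def Let_def)
next
  case False
  then show ?thesis by (simp add: Z_set_def kms_circular_def)
qed

theorem S_set_iff:
  assumes b: "b \<noteq> 0"
  shows "s \<in> S_set G F b \<longleftrightarrow> sink G s \<and> subcritical F b (up_closure G {s})"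
  using interval_iff_subcritical[OF backward_closed_up_closure b, of F "{s}"]
    loops_in_empty_iff[OF backward_closed_up_closure, of "{s}"]
  by (auto simp: S_set_def kms_sink_def sink_interval_def Let_def)

section \<open>Subcritical sets\<close>

lemma backward_closed_finite: "backward_closed X \<Longrightarrow> finite X"
  unfolding backward_closed_def by (rule finite_subset[OF conjunct1 finite_verts])

lemma wmat_into_backward_closed:
  assumes "backward_closed X" "w \<in> X" "v \<notin> X"
  shows "wmat G F b v w = 0"
proof (rule ccontr)
  assume "wmat G F b v w \<noteq> 0"
  then have "0 < wmat G F b v w" using wmat_nonneg[of F b v w] by linarith
  with assms show False by (auto simp: wmat_pos_iff backward_closed_def)
qed

text \<open>
  The \<open>\<sim>\<close>-class of \<open>v\<close>, which is a component only if it contains an edge.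
\<close>

definition scc :: "'a \<Rightarrow> 'a set" where
  "scc v = {w. v \<rightarrow>\<^sup>* w \<and> w \<rightarrow>\<^sup>* v}"

lemma scc_eq: "w \<in> scc v \<Longrightarrow> scc w = scc v"
  unfolding scc_def by (blast intro: reachable_trans)

lemma scc_self: "v \<in> verts G \<Longrightarrow> v \<in> scc v"
  by (simp add: scc_def)

lemma scc_subset: "backward_closed X \<Longrightarrow> v \<in> X \<Longrightarrow> scc v \<subseteq> X"
  using backward_closed_reachable by (auto simp: scc_def)

lemma scc_component:
  assumes "v \<in> verts G" "e \<in> arcs G" "tail G e \<in> scc v" "head G e \<in> scc v"
  shows "component G (scc v)"
proof -
  have eq: "scc v = {(v, w). v \<rightarrow>\<^sup>* w \<and> w \<rightarrow>\<^sup>* v} `` {v}" by (auto simp: scc_def)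
  have "scc v \<in> verts G // {(v, w). v \<rightarrow>\<^sup>* w \<and> w \<rightarrow>\<^sup>* v}"
    unfolding eq by (rule quotientI) (rule assms(1))
  then show ?thesis using assms unfolding component_def by blast
qed

text \<open>
  It is constant on strong components and increases strictly along the edges between them.
\<close>

definition depth :: "'a \<Rightarrow> nat" where "depth v = card {u \<in> verts G. u \<rightarrow>\<^sup>* v}"

lemma depth_scc: "w \<in> scc v \<Longrightarrow> depth w = depth v"
  unfolding scc_def depth_def by (rule arg_cong[of _ _ card]) (auto intro: reachable_trans)

lemma depth_less:
  assumes "0 < wmat G F b v w" "w \<notin> scc v"
  shows "depth v < depth w"
  unfolding depth_def
proof (rule psubset_card_mono)
  obtain e where e: "e \<in> arcs G" "tail G e = v" "head G e = w" using assms(1) by (auto simp: wmat_pos_iff)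
  then have vw: "v \<rightarrow>\<^sup>* w" "w \<in> verts G" using arc_reachable by auto
  then have "\<not> w \<rightarrow>\<^sup>* v" using assms(2) by (simp add: scc_def)
  then show "{u \<in> verts G. u \<rightarrow>\<^sup>* v} \<subset> {u \<in> verts G. u \<rightarrow>\<^sup>* w}"
    using vw by (auto intro: reachable_trans)
qed simp

lemma class_subsolution:
  assumes X: "backward_closed X" and sub: "subcritical F b X" and v: "v \<in> X"
  shows "\<exists>x. \<forall>w\<in>scc v. 0 < x w \<and> mvec (scc v) (wmat G F b) x w < x w"
proof (cases "\<exists>e\<in>arcs G. tail G e \<in> scc v \<and> head G e \<in> scc v")
  case True
  have "v \<in> verts G" using X v by (auto simp: backward_closed_def)
  with True have C: "component G (scc v)" using scc_component by blast
  then have "scc v \<in> components_in G X" using scc_subset[OF X v] by (simp add: components_in_def)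
  then have lt: "spec F (scc v) b < 1" using sub by (simp add: subcritical_def)
  obtain x where x: "\<And>w. w \<in> scc v \<Longrightarrow> 0 < x w"
    "\<And>w. w \<in> scc v \<Longrightarrow> mvec (scc v) (wmat G F b) x w = spec F (scc v) b * x w"
    by (rule perron_frobenius[OF component_irreducible[OF C]]) blast
  have "mvec (scc v) (wmat G F b) x w < x w" if "w \<in> scc v" for w
    using mult_strict_right_mono[OF lt x(1)[OF that]] x(2)[OF that] by simp
  with x(1) show ?thesis by blast
next
  case False
  have "wmat G F b u w = 0" if "u \<in> scc v" "w \<in> scc v" for u w
    using False that wmat_pos_iff[of F b u w] wmat_nonneg[of F b u w] by force
  then have "mvec (scc v) (wmat G F b) (\<lambda>_. 1) w < 1" if "w \<in> scc v" for w
    using that by (simp add: mvec_def)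
  then show ?thesis by (intro exI[of _ "\<lambda>_. 1"]) simp
qed

text \<open>
  Each \<open>\<sim>\<close>-class in \<open>X\<close> carries a positive vector that \<open>A(b)\<close> strictly decreases when restricted to the class:
  a Perron-Frobenius eigenvector, or a constant if the class has no edge. Weighting these vectors by
  powers \<open>\<epsilon>\<^sup>d\<close> of their depth \<open>d\<close> makes the contributions of deeper classes negligible for small \<open>\<epsilon>\<close>.
\<close>

lemma subcritical_subsolution:
  assumes X: "backward_closed X" and sub: "subcritical F b X"
  obtains y \<theta> where "\<And>v. v \<in> X \<Longrightarrow> 0 < y v" "0 \<le> \<theta>" "\<theta> < 1"
    "\<And>v. v \<in> X \<Longrightarrow> mvec X (wmat G F b) y v \<le> \<theta> * y v"
proof -
  let ?W = "wmat G F b"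
  have fin: "finite X" using X by (rule backward_closed_finite)
  have "\<exists>x. \<forall>v\<in>X. \<forall>w\<in>scc v. 0 < x (scc v) w \<and> mvec (scc v) ?W (x (scc v)) w < x (scc v) w"
  proof -
    let ?P = "\<lambda>C x. \<forall>w\<in>C. 0 < x w \<and> mvec C ?W x w < x w"
    have "?P (scc v) (SOME x. ?P (scc v) x)" if "v \<in> X" for v
      by (rule someI_ex[of "?P (scc v)"]) (rule class_subsolution[OF X sub that])
    then show ?thesis by (intro exI[of _ "\<lambda>C. SOME x. ?P C x"]) blast
  qed
  then obtain xx where xx: "\<And>v w. v \<in> X \<Longrightarrow> w \<in> scc v \<Longrightarrow>
      0 < xx (scc v) w \<and> mvec (scc v) ?W (xx (scc v)) w < xx (scc v) w"
    by blast
  define x where "x v = xx (scc v) v" for v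
  have self: "v \<in> scc v" if "v \<in> X" for v using that X scc_self by (auto simp: backward_closed_def)
  have x: "0 < x v" "mvec (scc v) ?W x v < x v" if v: "v \<in> X" for v
  proof -
    show "0 < x v" using xx[OF v self[OF v]] by (simp add: x_def)
    have "mvec (scc v) ?W x v = mvec (scc v) ?W (xx (scc v)) v"
      by (rule mvec_cong) (simp add: x_def scc_eq)
    then show "mvec (scc v) ?W x v < x v" using xx[OF v self[OF v]] by (simp add: x_def)
  qed
  define d where "d v = x v - mvec (scc v) ?W x v" for v
  define K where "K v = mvec X ?W x v" for v
  \<comment> \<open>The gap \<open>d\<close> inside the class must absorb \<open>\<epsilon>\<close> times everything that \<open>v\<close> receives from \<open>X\<close>.\<close>
  have "\<forall>\<^sub>F \<epsilon> in at_right 0. \<forall>v\<in>X. \<epsilon> * K v < d v"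
    unfolding eventually_ball_finite_distrib[OF fin]
  proof
    fix v assume "v \<in> X"
    then have "0 * K v < d v" using x by (simp add: d_def)
    moreover have "((\<lambda>\<epsilon>. \<epsilon> * K v) \<longlongrightarrow> 0 * K v) (at_right 0)" by (intro tendsto_intros)
    ultimately show "\<forall>\<^sub>F \<epsilon> in at_right 0. \<epsilon> * K v < d v" by (rule order_tendstoD(2)[rotated])
  qed
  moreover have "\<forall>\<^sub>F \<epsilon> :: real in at_right 0. 0 < \<epsilon> \<and> \<epsilon> < 1"
    by (auto simp: eventually_at_right[of 0 1] intro!: exI[of _ 1])
  ultimately have "\<forall>\<^sub>F \<epsilon> in at_right 0. (\<forall>v\<in>X. \<epsilon> * K v < d v) \<and> 0 < \<epsilon> \<and> \<epsilon> < 1"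
    by (rule eventually_conj)
  then obtain \<epsilon> where \<epsilon>: "\<And>v. v \<in> X \<Longrightarrow> \<epsilon> * K v < d v" "0 < \<epsilon>" "\<epsilon> < 1"
    using eventually_happens[of _ "at_right (0::real)"] trivial_limit_at_right_real by blast
  define y where "y v = \<epsilon> ^ depth v * x v" for v
  have y: "0 < y v" if "v \<in> X" for v using x(1)[OF that] \<epsilon> by (simp add: y_def)
  have strict: "mvec X ?W y v < 1 * y v" if v: "v \<in> X" for v
  proof -
    let ?c = "scc v"
    have cX: "?c \<subseteq> X" by (rule scc_subset[OF X v])
    have "mvec ?c ?W y v = (\<Sum>w\<in>?c. \<epsilon> ^ depth v * (?W v w * x w))"
      unfolding mvec_def by (rule sum.cong) (auto simp: y_def depth_scc)
    then have 1: "mvec ?c ?W y v = \<epsilon> ^ depth v * mvec ?c ?W x v"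
      by (simp add: mvec_def sum_distrib_left)
    have "mvec (X - ?c) ?W y v \<le> (\<Sum>w\<in>X - ?c. \<epsilon> ^ depth v * \<epsilon> * (?W v w * x w))"
      unfolding mvec_def
    proof (rule sum_mono)
      fix w assume w: "w \<in> X - ?c"
      show "?W v w * y w \<le> \<epsilon> ^ depth v * \<epsilon> * (?W v w * x w)"
      proof (cases "?W v w = 0")
        case False
        then have "0 < ?W v w" using wmat_nonneg[of F b v w] by linarith
        then have "depth v < depth w" using w by (intro depth_less) auto
        then have "\<epsilon> ^ depth w \<le> \<epsilon> ^ Suc (depth v)" using \<epsilon> by (intro power_decreasing) auto
        then have "\<epsilon> ^ depth w * (?W v w * x w) \<le> \<epsilon> ^ Suc (depth v) * (?W v w * x w)"
          using x(1)[of w] w wmat_nonneg[of F b v w] by (intro mult_right_mono) auto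
        then show ?thesis by (simp add: y_def algebra_simps)
      qed simp
    qed
    also have "\<dots> = \<epsilon> ^ depth v * \<epsilon> * mvec (X - ?c) ?W x v" by (simp add: mvec_def sum_distrib_left)
    also have "\<dots> \<le> \<epsilon> ^ depth v * \<epsilon> * K v"
      unfolding K_def mvec_def using \<epsilon> x(1) fin
      by (intro mult_left_mono sum_mono2) (auto intro!: mult_nonneg_nonneg wmat_nonneg simp: less_imp_le)
    also have "\<dots> < \<epsilon> ^ depth v * d v" using \<epsilon>(1)[OF v] \<epsilon>(2) by (simp add: mult.assoc)
    finally have 2: "mvec (X - ?c) ?W y v < \<epsilon> ^ depth v * d v" .
    have "mvec X ?W y v = mvec ?c ?W y v + mvec (X - ?c) ?W y v"
      unfolding mvec_def using sum.subset_diff[OF cX fin] by (simp add: add.commute)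
    also have "\<dots> < \<epsilon> ^ depth v * (mvec ?c ?W x v + d v)" using 1 2 by (simp add: distrib_left)
    finally show ?thesis by (simp add: y_def d_def)
  qed
  show thesis
  proof (cases "X = {}")
    case True
    then show thesis using that[of y 0] by simp
  next
    case False
    obtain k where k: "k < 1" "\<And>v. v \<in> X \<Longrightarrow> mvec X ?W y v \<le> k * y v"
      by (rule strictly_subinvariant_improve[OF fin False y strict]) auto
    have "mvec X ?W y v \<le> max k 0 * y v" if "v \<in> X" for v
      using k(2)[OF that] mult_right_mono[of k "max k 0" "y v"] y[OF that] by linarith
    then show thesis using that[of y "max k 0"] k(1) y by simp
  qed
qed

text \<open>
  Where \<open>|z|\<close> is maximal relative to the subsolution \<open>y\<close>, say \<open>|z| = cy\<close>, one gets \<open>cy \<le> c\<theta>y\<close> with \<open>\<theta> < 1\<close>.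
\<close>

lemma subcritical_harmonic_zero:
  assumes X: "backward_closed X" and sub: "subcritical F b X"
    and z: "\<And>v. v \<in> X \<Longrightarrow> mvec X (wmat G F b) z v = z v" and v: "v \<in> X"
  shows "z v = 0"
proof -
  let ?W = "wmat G F b"
  have fin: "finite X" using X by (rule backward_closed_finite)
  obtain y \<theta> where y: "\<And>v. v \<in> X \<Longrightarrow> 0 < y v" "0 \<le> \<theta>" "\<theta> < 1" "\<And>v. v \<in> X \<Longrightarrow> mvec X ?W y v \<le> \<theta> * y v"
    by (rule subcritical_subsolution[OF X sub]) blast
  define c where "c = Max ((\<lambda>v. \<bar>z v\<bar> / y v) ` X)"
  have "c \<in> (\<lambda>v. \<bar>z v\<bar> / y v) ` X" unfolding c_def using fin v by (intro Max_in) auto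
  then obtain i where i: "i \<in> X" "c = \<bar>z i\<bar> / y i" by auto
  then have zi: "\<bar>z i\<bar> = c * y i" "0 \<le> c" using y(1)[OF i(1)] by (auto intro!: divide_nonneg_pos)
  have le: "\<bar>z w\<bar> \<le> c * y w" if "w \<in> X" for w
  proof -
    have "\<bar>z w\<bar> / y w \<le> c" unfolding c_def using fin that by (intro Max_ge) auto
    then show ?thesis using y(1)[OF that] by (simp add: pos_divide_le_eq)
  qed
  have "c * y i = \<bar>mvec X ?W z i\<bar>" using zi z[OF i(1)] by simp
  also have "\<dots> \<le> (\<Sum>w\<in>X. \<bar>?W i w * z w\<bar>)" unfolding mvec_def by (rule sum_abs)
  also have "\<dots> \<le> (\<Sum>w\<in>X. ?W i w * (c * y w))"
    using le wmat_nonneg[of F b] by (intro sum_mono) (auto simp: abs_mult intro!: mult_left_mono)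
  also have "\<dots> = c * mvec X ?W y i" by (simp add: mvec_def sum_distrib_left mult.left_commute)
  also have "\<dots> \<le> c * (\<theta> * y i)" using y(4)[OF i(1)] zi(2) by (rule mult_left_mono)
  finally have "c * y i * (1 - \<theta>) \<le> 0" by (simp add: algebra_simps)
  then have "c * y i \<le> 0" using y(3) by (simp add: mult_le_0_iff)
  then have "c \<le> 0" using y(1)[OF i(1)] by (simp add: mult_le_0_iff)
  then show ?thesis using le[OF v] y(1)[OF v] by (smt (verit) mult_nonpos_nonneg)
qed

lemma wmat_pow_nonneg: "0 \<le> wmat_pow G F b n v w"
  by (induction n arbitrary: v) (auto intro!: sum_nonneg mult_nonneg_nonneg wmat_nonneg)

lemma wmat_pow_into_backward_closed:
  assumes "backward_closed X" "w \<in> X" "v \<notin> X"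
  shows "wmat_pow G F b n v w = 0"
  using assms(3)
proof (induction n arbitrary: v)
  case (Suc n)
  have "wmat G F b v u * wmat_pow G F b n u w = 0" for u
    using Suc wmat_into_backward_closed[OF assms(1), of u v F b] by (cases "u \<in> X") auto
  then show ?case by simp
qed (use assms in auto)

definition green :: "('b \<Rightarrow> real) \<Rightarrow> real \<Rightarrow> 'a \<Rightarrow> 'a \<Rightarrow> real" where
  "green F b v w = (\<Sum>n. wmat_pow G F b n v w)"

context
  fixes F :: "'b \<Rightarrow> real" and b :: real and X :: "'a set"
  assumes X: "backward_closed X" and sub: "subcritical F b X"
begin

lemma summable_wmat_pow:
  assumes w: "w \<in> X"
  shows "summable (\<lambda>n. wmat_pow G F b n v w)"
proof (cases "v \<in> X")
  case False
  then show ?thesis by (simp add: wmat_pow_into_backward_closed[OF X w])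
next
  case True
  obtain y \<theta> where y: "\<And>v. v \<in> X \<Longrightarrow> 0 < y v" "0 \<le> \<theta>" "\<theta> < 1" "\<And>v. v \<in> X \<Longrightarrow> mvec X (wmat G F b) y v \<le> \<theta> * y v"
    by (rule subcritical_subsolution[OF X sub]) blast
  have le: "wmat_pow G F b n v w \<le> \<theta> ^ n * (y v / y w)" if "v \<in> X" for n v
    using that
  proof (induction n arbitrary: v)
    case 0
    then show ?case using y(1)[OF 0] y(1)[OF w] by simp
  next
    case (Suc n)
    have "wmat_pow G F b (Suc n) v w = (\<Sum>u\<in>X. wmat G F b v u * wmat_pow G F b n u w)"
      using X by (auto simp: backward_closed_def wmat_pow_into_backward_closed[OF X w] intro!: sum.mono_neutral_right)
    also have "\<dots> \<le> (\<Sum>u\<in>X. wmat G F b v u * (\<theta> ^ n * (y u / y w)))"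
      using Suc.IH by (intro sum_mono mult_left_mono wmat_nonneg) auto
    also have "\<dots> = \<theta> ^ n / y w * mvec X (wmat G F b) y v"
      by (simp add: mvec_def sum_distrib_left field_simps)
    also have "\<dots> \<le> \<theta> ^ n / y w * (\<theta> * y v)"
      using y(4)[OF Suc.prems] y(1)[OF w] y(2) by (intro mult_left_mono) auto
    finally show ?case by (simp add: algebra_simps)
  qed
  show ?thesis
  proof (rule summable_comparison_test)
    show "\<exists>N. \<forall>n\<ge>N. norm (wmat_pow G F b n v w) \<le> \<theta> ^ n * (y v / y w)"
      using le[OF True] by (auto simp: wmat_pow_nonneg)
    show "summable (\<lambda>n. \<theta> ^ n * (y v / y w))"
      using y(2,3) by (intro summable_mult2 summable_geometric) auto
  qed
qed

lemma green_nonneg: "w \<in> X \<Longrightarrow> 0 \<le> green F b v w"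
  unfolding green_def by (rule suminf_nonneg[OF summable_wmat_pow]) (auto simp: wmat_pow_nonneg)

lemma green_outside: "w \<in> X \<Longrightarrow> v \<notin> X \<Longrightarrow> green F b v w = 0"
  by (simp add: green_def wmat_pow_into_backward_closed[OF X])

lemma green_eq:
  assumes w: "w \<in> X"
  shows "green F b v w = (if v = w then 1 else 0) + mvec (verts G) (wmat G F b) (\<lambda>u. green F b u w) v"
proof -
  have "(\<Sum>n. wmat_pow G F b (Suc n) v w) = green F b v w - wmat_pow G F b 0 v w"
    unfolding green_def by (rule suminf_split_head[OF summable_wmat_pow[OF w]])
  moreover have "(\<Sum>n. wmat_pow G F b (Suc n) v w) = mvec (verts G) (wmat G F b) (\<lambda>u. green F b u w) v"
    using summable_wmat_pow[OF w] unfolding wmat_pow.simps mvec_def green_def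
    by (subst suminf_sum) (auto intro!: summable_mult simp: suminf_mult)
  ultimately show ?thesis by simp
qed

lemma green_self_ge_1:
  assumes w: "w \<in> X"
  shows "1 \<le> green F b w w"
proof -
  have "0 \<le> mvec (verts G) (wmat G F b) (\<lambda>u. green F b u w) w"
    unfolding mvec_def by (intro sum_nonneg mult_nonneg_nonneg wmat_nonneg green_nonneg w)
  then show ?thesis using green_eq[OF w, of w] by simp
qed

end

lemma mvec_verts_eq:
  assumes "backward_closed X" "\<And>v. v \<in> verts G \<Longrightarrow> v \<notin> X \<Longrightarrow> z v = 0"
  shows "mvec (verts G) (wmat G F b) z v = mvec X (wmat G F b) z v"
  unfolding mvec_def using assms by (intro sum.mono_neutral_right) (auto simp: backward_closed_def)

lemma superharmonic_pos:
  assumes z: "\<And>v. v \<in> verts G \<Longrightarrow> 0 \<le> z v" "\<And>v. v \<in> verts G \<Longrightarrow> mvec (verts G) (wmat G F b) z v \<le> z v"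
    and vw: "v \<rightarrow>\<^sup>* w" "0 < z w"
  shows "0 < z v"
  using vw
proof (induction rule: converse_reachable_induct)
  case (step x y)
  then obtain e where e: "e \<in> arcs G" "tail G e = x" "head G e = y" by (auto simp: arcs_ends_def arc_to_ends_def)
  then have xy: "x \<in> verts G" "y \<in> verts G" "0 < wmat G F b x y" by (auto simp: wmat_pos_iff)
  have "0 < wmat G F b x y * z y" using xy(3) step.IH[OF step.prems] by simp
  also have "\<dots> \<le> mvec (verts G) (wmat G F b) z x"
    unfolding mvec_def using xy z by (intro member_le_sum) (auto intro!: mult_nonneg_nonneg wmat_nonneg)
  also have "\<dots> \<le> z x" using z xy by simp
  finally show ?case .
qed

text \<open>
  By \<open>C_set_iff\<close> and \<open>Z_set_iff\<close> these are the elements of \<open>\<C>(b) \<union> \<Z>(b)\<close>, for \<open>b \<noteq> 0\<close>.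
\<close>

definition critical :: "('b \<Rightarrow> real) \<Rightarrow> real \<Rightarrow> 'a set \<Rightarrow> bool" where
  "critical F b C \<longleftrightarrow> component G C \<and> spec F C b = 1 \<and> subcritical F b (up_closure G C - C)"

definition is_comp_vec :: "('b \<Rightarrow> real) \<Rightarrow> real \<Rightarrow> 'a set \<Rightarrow> ('a \<Rightarrow> real) \<Rightarrow> bool" where
  "is_comp_vec F b C x \<longleftrightarrow> (\<forall>v. 0 \<le> x v) \<and> (\<Sum>v\<in>verts G. x v) = 1 \<and>
     (\<forall>v\<in>verts G. mvec (verts G) (wmat G F b) x v = x v) \<and>
     (\<forall>v\<in>C. mvec C (wmat G F b) x v = x v) \<and>
     (\<forall>v. x v \<noteq> 0 \<longleftrightarrow> v \<in> up_closure G C)"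

lemma comp_vec_eq: "comp_vec G F b C = (THE x. is_comp_vec F b C x)"
  by (simp add: comp_vec_def is_comp_vec_def mvec_def)

text \<open>
  Two such vectors are proportional on \<open>C\<close>. After scaling, their difference is a harmonic vector supported
  in the subcritical set \<open>up_closure G C - C\<close>.
\<close>

lemma comp_vec_unique:
  assumes C: "critical F b C" and x: "is_comp_vec F b C x" and y: "is_comp_vec F b C y"
  shows "x = y"
proof -
  let ?W = "wmat G F b"
  let ?X = "up_closure G C - C"
  have comp: "component G C" and sub: "subcritical F b ?X" using C by (auto simp: critical_def)
  note bc = backward_closed_up_closure_minus[OF comp]
  have CU: "C \<subseteq> up_closure G C" by (rule subset_up_closure[OF component_subset_verts[OF comp]])
  have pos: "0 < x v" "0 < y v" if "v \<in> C" for v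
    using x y that CU unfolding is_comp_vec_def by (metis less_eq_real_def subsetD)+
  obtain w where w: "w \<in> C" using component_edge[OF comp] by auto
  obtain c where c: "0 < c" "\<And>v. v \<in> C \<Longrightarrow> x v = c * y v"
    by (rule sub_super_invariant_proportional[OF component_irreducible[OF comp, of F b], of y x w])
      (use x y pos w in \<open>auto simp: is_comp_vec_def\<close>)
  define z where "z v = x v - c * y v" for v
  have off: "z v = 0" if "v \<notin> ?X" for v
  proof (cases "v \<in> C")
    case False
    then have "v \<notin> up_closure G C" using that by auto
    then have "x v = 0" "y v = 0" using x y unfolding is_comp_vec_def by blast+
    then show ?thesis by (simp add: z_def)
  qed (simp add: z_def c(2))
  have "mvec ?X ?W z v = z v" if v: "v \<in> ?X" for v
  proof -
    have vV: "v \<in> verts G" using v by (auto simp: up_closure_def)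
    have "mvec ?X ?W z v = mvec (verts G) ?W z v" using mvec_verts_eq[OF bc] off by metis
    also have "\<dots> = mvec (verts G) ?W x v - c * mvec (verts G) ?W y v"
      unfolding z_def by (simp add: mvec_diff mvec_scaleR)
    also have "\<dots> = z v" using x y vV by (simp add: is_comp_vec_def z_def)
    finally show ?thesis .
  qed
  then have "z v = 0" for v
    using subcritical_harmonic_zero[OF bc sub, of z v] off[of v] by (cases "v \<in> ?X") simp_all
  then have eq: "x v = c * y v" for v by (simp add: z_def)
  have "1 = (\<Sum>v\<in>verts G. c * y v)" using x eq by (simp add: is_comp_vec_def)
  also have "\<dots> = c" using y by (simp add: is_comp_vec_def flip: sum_distrib_left)
  finally show ?thesis using eq by auto
qed

text \<open>
  Start with a Perron-Frobenius eigenvector \<open>x\<close> on \<open>C\<close>. On the rest \<open>X\<close> of the closure, harmonicity is an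
  inhomogeneous equation with source term \<open>g = A(b)x\<close>, which is solved by summing the powers of \<open>A(b)\<close>.
\<close>

lemma comp_vec_exists:
  assumes C: "critical F b C"
  shows "\<exists>x. is_comp_vec F b C x"
proof -
  let ?W = "wmat G F b"
  let ?X = "up_closure G C - C"
  have comp: "component G C" and one: "spec F C b = 1" and sub: "subcritical F b ?X" using C by (auto simp: critical_def)
  note bc = backward_closed_up_closure_minus[OF comp] and bcU = backward_closed_up_closure[of C]
  have CV: "C \<subseteq> verts G" by (rule component_subset_verts[OF comp])
  have CU: "C \<subseteq> up_closure G C" by (rule subset_up_closure[OF CV])
  have UV: "up_closure G C \<subseteq> verts G" by (auto simp: up_closure_def)
  have finX: "finite ?X" by (rule backward_closed_finite[OF bc])
  have finC: "finite C" by (rule component_finite[OF comp])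
  obtain x where x: "\<And>v. v \<in> C \<Longrightarrow> 0 < x v" "\<And>v. v \<in> C \<Longrightarrow> mvec C ?W x v = spec F C b * x v"
    by (rule perron_frobenius[OF component_irreducible[OF comp]]) blast
  define g where "g w = mvec C ?W x w" for w
  have g: "0 \<le> g w" for w unfolding g_def mvec_def using x(1) by (intro sum_nonneg mult_nonneg_nonneg wmat_nonneg) (auto intro: less_imp_le)
  define y where "y v = (\<Sum>w\<in>?X. green F b v w * g w)" for v
  define z where "z v = (if v \<in> C then x v else y v)" for v
  have y0: "y v = 0" if "v \<notin> ?X" for v
    unfolding y_def using green_outside[OF bc sub _ that] by (intro sum.neutral) auto
  have y_nonneg: "0 \<le> y v" for v
    unfolding y_def using green_nonneg[OF bc sub] g by (intro sum_nonneg mult_nonneg_nonneg) auto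
  have z_nonneg: "0 \<le> z v" for v using x(1)[of v] y_nonneg[of v] by (auto simp: z_def)
  have z0: "z v = 0" if "v \<notin> up_closure G C" for v
  proof -
    have "v \<notin> C" "v \<notin> ?X" using that CU by auto
    then show ?thesis using y0 by (simp add: z_def)
  qed
  have y_eq: "y v = g v + mvec ?X ?W y v" if v: "v \<in> ?X" for v
  proof -
    have gr: "green F b v u = (if v = u then 1 else 0) + mvec ?X ?W (\<lambda>w. green F b w u) v" if "u \<in> ?X" for u
      using green_eq[OF bc sub that, of v] mvec_verts_eq[OF bc, of "\<lambda>w. green F b w u" F b v] green_outside[OF bc sub that]
      by simp
    have "y v = (\<Sum>u\<in>?X. (if v = u then g u else 0)) + (\<Sum>u\<in>?X. mvec ?X ?W (\<lambda>w. green F b w u) v * g u)"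
      unfolding y_def by (simp add: gr distrib_right sum.distrib if_distrib[of "\<lambda>x. x * _"] cong: if_cong)
    also have "(\<Sum>u\<in>?X. (if v = u then g u else 0)) = g v" using v finX by (subst sum.delta') auto
    also have "(\<Sum>u\<in>?X. mvec ?X ?W (\<lambda>w. green F b w u) v * g u) = (\<Sum>u\<in>?X. \<Sum>w\<in>?X. ?W v w * (green F b w u * g u))"
      by (simp add: mvec_def sum_distrib_right mult.assoc)
    also have "\<dots> = mvec ?X ?W y v"
      by (subst sum.swap) (simp add: mvec_def y_def sum_distrib_left)
    finally show ?thesis .
  qed
  have split: "mvec (verts G) ?W z v = g v + mvec ?X ?W y v" for v
  proof -
    have "mvec (verts G) ?W z v = mvec (up_closure G C) ?W z v" by (rule mvec_verts_eq[OF bcU]) (use z0 in auto)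
    also have "\<dots> = mvec ?X ?W z v + mvec C ?W z v"
      unfolding mvec_def using sum.subset_diff[OF CU, of "\<lambda>w. ?W v w * z w"] UV finite_verts finite_subset by blast
    also have "mvec C ?W z v = g v" unfolding g_def by (rule mvec_cong) (simp add: z_def)
    also have "mvec ?X ?W z v = mvec ?X ?W y v" by (rule mvec_cong) (simp add: z_def)
    finally show ?thesis by simp
  qed
  have onC: "g v = x v" if "v \<in> C" for v using x(2)[OF that] one by (simp add: g_def)
  have noX: "mvec ?X ?W y v = 0" if "v \<notin> ?X" for v
    unfolding mvec_def using wmat_into_backward_closed[OF bc _ that] by (intro sum.neutral) auto
  have harm: "mvec (verts G) ?W z v = z v" for v
  proof (cases "v \<in> C")
    case True
    then show ?thesis using split[of v] onC noX[of v] by (simp add: z_def)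
  next
    case False
    show ?thesis
    proof (cases "v \<in> ?X")
      case True
      then show ?thesis using split[of v] y_eq[OF True] False by (simp add: z_def)
    next
      case out: False
      then have "v \<notin> up_closure G C" using False by simp
      then have "g v = 0"
        unfolding g_def mvec_def using wmat_into_backward_closed[OF bcU, of _ v F b] CU by (intro sum.neutral) auto
      then show ?thesis using split[of v] noX[OF out] z0[OF \<open>v \<notin> up_closure G C\<close>] by simp
    qed
  qed
  have pos: "0 < z v" if v: "v \<in> up_closure G C" for v
  proof -
    obtain w where w: "w \<in> C" "v \<rightarrow>\<^sup>* w" using v by (auto simp: up_closure_def)
    show ?thesis
      by (rule superharmonic_pos[where z = z and F = F and b = b, OF _ _ w(2)])
        (use z_nonneg harm x(1)[OF w(1)] w(1) in \<open>auto simp: z_def\<close>)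
  qed
  define s where "s = (\<Sum>v\<in>verts G. z v)"
  obtain w where "w \<in> C" using component_edge[OF comp] by auto
  then have "0 < s"
    unfolding s_def using pos CU CV z_nonneg by (intro sum_pos2[of _ w]) auto
  define n where "n v = inverse s * z v" for v
  have sc: "mvec Y ?W n v = inverse s * mvec Y ?W z v" for Y v unfolding n_def by (rule mvec_scaleR)
  have "mvec C ?W z v = z v" if "v \<in> C" for v
  proof -
    have "mvec C ?W z v = mvec C ?W x v" by (rule mvec_cong) (simp add: z_def)
    then show ?thesis using onC[OF that] that by (simp add: g_def z_def)
  qed
  moreover have "(\<Sum>v\<in>verts G. n v) = 1"
    using \<open>0 < s\<close> by (simp add: n_def s_def flip: sum_distrib_left)
  moreover have "n v \<noteq> 0 \<longleftrightarrow> v \<in> up_closure G C" for v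
    using pos[of v] z0[of v] \<open>0 < s\<close> by (auto simp: n_def)
  moreover have "0 \<le> n v" for v using z_nonneg[of v] \<open>0 < s\<close> by (simp add: n_def)
  ultimately have "is_comp_vec F b C n"
    unfolding is_comp_vec_def sc harm by (simp add: n_def)
  then show ?thesis by (rule exI[of _ n])
qed

lemma comp_vec_props:
  assumes C: "critical F b C"
  shows "is_comp_vec F b C (comp_vec G F b C)"
proof -
  obtain x where x: "is_comp_vec F b C x" using comp_vec_exists[OF C] by (rule exE)
  show ?thesis
    unfolding comp_vec_eq by (rule theI[of "is_comp_vec F b C", OF x]) (rule comp_vec_unique[OF C _ x])
qed

section \<open>Decomposition of superharmonic vectors\<close>

lemma wmat_row_sink: "sink G s \<Longrightarrow> wmat G F b s w = 0"
  by (simp add: sink_def wmat_def)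

lemma sink_reachable:
  assumes "sink G s" "s \<rightarrow>\<^sup>* w"
  shows "w = s"
  using assms(2)
proof (cases rule: converse_reachable_cases)
  case (step x)
  then obtain e where "e \<in> arcs G" "tail G e = s" by (auto simp: arcs_ends_def arc_to_ends_def)
  with assms(1) have False by (auto simp: sink_def out_arcs_def)
  then show ?thesis ..
qed simp

lemma sink_not_in_component:
  assumes "component G C" "sink G s"
  shows "s \<notin> C"
proof
  assume s: "s \<in> C"
  obtain e where e: "e \<in> arcs G" "tail G e \<in> C" "head G e \<in> C" using component_edge[OF assms(1)] by blast
  have "tail G e = s" using sink_reachable[OF assms(2)] component_reachable[OF assms(1) s e(2)] by simp
  with e(1) assms(2) show False by (auto simp: sink_def out_arcs_def)
qed

context
  fixes F :: "'b \<Rightarrow> real" and b :: real and s :: 'a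
  assumes s: "sink G s" and sub: "subcritical F b (up_closure G {s})"
begin

lemma sink_in_up_closure: "s \<in> up_closure G {s}"
  using s by (auto simp: up_closure_def sink_def)

lemma sink_vec_total_pos: "0 < (\<Sum>w\<in>verts G. green F b w s)"
  by (rule sum_pos2[of _ s])
    (use s green_self_ge_1[OF backward_closed_up_closure sub sink_in_up_closure]
      green_nonneg[OF backward_closed_up_closure sub sink_in_up_closure] in \<open>auto simp: sink_def\<close>)

lemma sink_vec_green: "sink_vec G F b s v = inverse (\<Sum>w\<in>verts G. green F b w s) * green F b v s"
  by (simp add: sink_vec_def green_def divide_inverse mult.commute)

lemma sink_vec_nonneg: "0 \<le> sink_vec G F b s v"
  unfolding sink_vec_green using sink_vec_total_pos green_nonneg[OF backward_closed_up_closure sub sink_in_up_closure]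
  by simp

lemma sink_vec_sum: "(\<Sum>v\<in>verts G. sink_vec G F b s v) = 1"
  unfolding sink_vec_green using sink_vec_total_pos by (simp flip: sum_distrib_left)

lemma sink_vec_outside: "v \<notin> up_closure G {s} \<Longrightarrow> sink_vec G F b s v = 0"
  unfolding sink_vec_green using green_outside[OF backward_closed_up_closure sub sink_in_up_closure] by simp

lemma sink_vec_self_pos: "0 < sink_vec G F b s s"
  unfolding sink_vec_green
  using sink_vec_total_pos green_self_ge_1[OF backward_closed_up_closure sub sink_in_up_closure] by simp

lemma sink_vec_eq:
  "mvec (verts G) (wmat G F b) (sink_vec G F b s) v = sink_vec G F b s v - (if v = s then sink_vec G F b s s else 0)"
proof -
  let ?N = "inverse (\<Sum>w\<in>verts G. green F b w s)"
  have 1: "mvec (verts G) (wmat G F b) (sink_vec G F b s) v = ?N * mvec (verts G) (wmat G F b) (\<lambda>w. green F b w s) v" for v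
    unfolding sink_vec_green by (rule mvec_scaleR)
  have "mvec (verts G) (wmat G F b) (\<lambda>w. green F b w s) v = green F b v s - (if v = s then 1 else 0)" for v
    using green_eq[OF backward_closed_up_closure sub sink_in_up_closure, of v] by simp
  note 2 = this
  show ?thesis
  proof (cases "v = s")
    case True
    have "mvec (verts G) (wmat G F b) (sink_vec G F b s) s = 0"
      by (simp add: mvec_def wmat_row_sink[OF s])
    then show ?thesis using True by simp
  next
    case False
    then show ?thesis by (simp add: 1 2 sink_vec_green)
  qed
qed

end

lemma leaving_edge:
  assumes "v \<rightarrow>\<^sup>* w" "v \<in> D" "w \<notin> D"
  obtains x y where "x \<in> D" "y \<notin> D" "0 < wmat G F b x y" "y \<rightarrow>\<^sup>* w"
proof -
  have "\<exists>x y. x \<in> D \<and> y \<notin> D \<and> 0 < wmat G F b x y \<and> y \<rightarrow>\<^sup>* w"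
    using assms
  proof (induction rule: converse_reachable_induct)
    case (step x y)
    then obtain e where "e \<in> arcs G" "tail G e = x" "head G e = y" by (auto simp: arcs_ends_def arc_to_ends_def)
    then have "0 < wmat G F b x y" by (auto simp: wmat_pos_iff)
    with step show ?case by (cases "y \<in> D") blast+
  qed simp
  with that show thesis by blast
qed

text \<open>
  This makes the vectors \<open>\<phi>\<^sup>C\<close> independent: on a critical component only its own vector is nonzero.
\<close>

lemma critical_disjoint:
  assumes C: "critical F b C" and D: "component G D" "spec F D b = 1" and v: "v \<in> D" "v \<in> up_closure G C"
  shows "D = C"
proof (rule ccontr)
  assume "D \<noteq> C"
  have comp: "component G C" using C by (simp add: critical_def)
  have "D \<subseteq> up_closure G C"
    using component_reachable[OF D(1) _ v(1)] backward_closed_reachable[OF backward_closed_up_closure _ v(2)] by blast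
  then have "D \<in> components_in G (up_closure G C)" using D(1) by (simp add: components_in_def)
  then have "D \<in> components_in G (up_closure G C - C)" using components_in_up_closure[OF comp] \<open>D \<noteq> C\<close> by simp
  then have "spec F D b < 1" using C by (simp add: critical_def subcritical_def)
  with D(2) show False by simp
qed

lemma critical_sink_disjoint:
  assumes sub: "subcritical F b (up_closure G {s})" and D: "component G D" "spec F D b = 1" and v: "v \<in> D"
  shows "v \<notin> up_closure G {s}"
proof
  assume "v \<in> up_closure G {s}"
  then have "D \<subseteq> up_closure G {s}"
    using component_reachable[OF D(1) _ v] backward_closed_reachable[OF backward_closed_up_closure] by blast
  then have "D \<in> components_in G (up_closure G {s})" using D(1) by (simp add: components_in_def)
  then have "spec F D b < 1" using sub by (simp add: subcritical_def)
  with D(2) show False by simp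
qed

lemma sink_not_in_up_closure:
  assumes "component G C" "sink G s"
  shows "s \<notin> up_closure G C"
  using sink_reachable[OF assms(2)] sink_not_in_component[OF assms] by (auto simp: up_closure_def)

definition critical_sink :: "('b \<Rightarrow> real) \<Rightarrow> real \<Rightarrow> 'a \<Rightarrow> bool" where
  "critical_sink F b s \<longleftrightarrow> sink G s \<and> subcritical F b (up_closure G {s})"

lemma finite_critical: "finite {C. critical F b C}"
proof (rule finite_subset)
  show "{C. critical F b C} \<subseteq> components_in G (verts G)"
    using component_subset_verts unfolding critical_def components_in_def by blast
qed (simp add: finite_components_in)

lemma finite_critical_sink: "finite {s. critical_sink F b s}"
  by (rule finite_subset[of _ "verts G"]) (auto simp: critical_sink_def sink_def)

text \<open>
  The vector of \<open>mixed_vec\<close> with the coefficients of \<open>\<C>(b)\<close> and \<open>\<Z>(b)\<close> joined into one function.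
\<close>

definition mix :: "('b \<Rightarrow> real) \<Rightarrow> real \<Rightarrow> ('a set \<Rightarrow> real) \<Rightarrow> ('a \<Rightarrow> real) \<Rightarrow> 'a \<Rightarrow> real" where
  "mix F b f h v = (\<Sum>C | critical F b C. f C * comp_vec G F b C v) + (\<Sum>s | critical_sink F b s. h s * sink_vec G F b s v)"

lemma comp_vec_facts:
  assumes C: "critical F b C"
  shows "0 \<le> comp_vec G F b C v" "(\<Sum>v\<in>verts G. comp_vec G F b C v) = 1"
    "v \<in> verts G \<Longrightarrow> mvec (verts G) (wmat G F b) (comp_vec G F b C) v = comp_vec G F b C v"
    "v \<in> C \<Longrightarrow> mvec C (wmat G F b) (comp_vec G F b C) v = comp_vec G F b C v"
    "v \<notin> up_closure G C \<Longrightarrow> comp_vec G F b C v = 0"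
    "v \<in> C \<Longrightarrow> 0 < comp_vec G F b C v"
proof -
  note p = comp_vec_props[OF C, unfolded is_comp_vec_def]
  have supp: "comp_vec G F b C v \<noteq> 0 \<longleftrightarrow> v \<in> up_closure G C" using p by simp
  show "0 \<le> comp_vec G F b C v" "(\<Sum>v\<in>verts G. comp_vec G F b C v) = 1"
    "v \<in> verts G \<Longrightarrow> mvec (verts G) (wmat G F b) (comp_vec G F b C) v = comp_vec G F b C v"
    "v \<in> C \<Longrightarrow> mvec C (wmat G F b) (comp_vec G F b C) v = comp_vec G F b C v"
    using p by simp_all
  show "v \<notin> up_closure G C \<Longrightarrow> comp_vec G F b C v = 0" using supp by simp
  assume "v \<in> C"
  then have "v \<in> up_closure G C" using C subset_up_closure[of C] component_subset_verts[of C] by (auto simp: critical_def)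
  then have "comp_vec G F b C v \<noteq> 0" using supp by simp
  moreover have "0 \<le> comp_vec G F b C v" using p by simp
  ultimately show "0 < comp_vec G F b C v" by simp
qed

lemma mix_on_critical:
  assumes C: "critical F b C" and v: "v \<in> C"
  shows "mix F b f h v = f C * comp_vec G F b C v"
proof -
  have c: "component G C" "spec F C b = 1" using C by (auto simp: critical_def)
  have "comp_vec G F b D v = 0" if D: "critical F b D" "D \<noteq> C" for D
    using comp_vec_facts(5)[OF D(1)] critical_disjoint[OF D(1) c v] D(2) by blast
  then have "(\<Sum>D | critical F b D. f D * comp_vec G F b D v) = (\<Sum>D\<in>{C}. f D * comp_vec G F b D v)"
    using C by (intro sum.mono_neutral_right finite_critical) auto
  moreover have "sink_vec G F b s v = 0" if "critical_sink F b s" for s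
    using that sink_vec_outside critical_sink_disjoint[OF _ c v] by (auto simp: critical_sink_def)
  ultimately show ?thesis by (simp add: mix_def)
qed

lemma mix_on_sink:
  assumes s: "sink G s"
  shows "mix F b f h s = (if critical_sink F b s then h s * sink_vec G F b s s else 0)"
proof -
  have "comp_vec G F b D s = 0" if D: "critical F b D" for D
    using comp_vec_facts(5)[OF D] sink_not_in_up_closure[OF _ s] D by (auto simp: critical_def)
  moreover have "sink_vec G F b t s = 0" if t: "critical_sink F b t" "t \<noteq> s" for t
  proof -
    have "s \<notin> up_closure G {t}" using sink_reachable[OF s] t(2) by (auto simp: up_closure_def)
    then show ?thesis using t(1) sink_vec_outside by (auto simp: critical_sink_def)
  qed
  then have "(\<Sum>t | critical_sink F b t. h t * sink_vec G F b t s) =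
      (\<Sum>t | critical_sink F b t. if t = s then h s * sink_vec G F b s s else 0)"
    by (intro sum.cong) auto
  ultimately show ?thesis by (simp add: mix_def finite_critical_sink)
qed

text \<open>
  Only the \<open>\<phi>\<^sup>s\<close> fail to be harmonic, and they do so only at \<open>s\<close>.
\<close>

lemma mix_harmonic_defect:
  assumes v: "v \<in> verts G"
  shows "mix F b f h v - mvec (verts G) (wmat G F b) (mix F b f h) v =
    (if critical_sink F b v then h v * sink_vec G F b v v else 0)"
proof -
  let ?M = "mvec (verts G) (wmat G F b)"
  have mix_fun: "mix F b f h = (\<lambda>v. (\<Sum>C | critical F b C. f C * comp_vec G F b C v) +
      (\<Sum>s | critical_sink F b s. h s * sink_vec G F b s v))"
    by (simp add: mix_def fun_eq_iff)
  have "?M (mix F b f h) v = (\<Sum>C | critical F b C. f C * ?M (comp_vec G F b C) v) +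
      (\<Sum>s | critical_sink F b s. h s * ?M (sink_vec G F b s) v)"
    unfolding mix_fun mvec_add
    by (simp add: mvec_def sum_distrib_left sum.swap[of _ "verts G"] mult.left_commute)
  also have "(\<Sum>C | critical F b C. f C * ?M (comp_vec G F b C) v) = (\<Sum>C | critical F b C. f C * comp_vec G F b C v)"
    using comp_vec_facts(3)[OF _ v] by (intro sum.cong) auto
  also have "(\<Sum>s | critical_sink F b s. h s * ?M (sink_vec G F b s) v) =
      (\<Sum>s | critical_sink F b s. h s * sink_vec G F b s v - (if s = v then h v * sink_vec G F b v v else 0))"
    by (intro sum.cong) (auto simp: critical_sink_def sink_vec_eq algebra_simps)
  also have "\<dots> = (\<Sum>s | critical_sink F b s. h s * sink_vec G F b s v) -
      (if critical_sink F b v then h v * sink_vec G F b v v else 0)"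
    by (simp add: sum_subtractf finite_critical_sink)
  finally show ?thesis unfolding mix_def[of F b f h v] by simp
qed

lemma mix_sum:
  "(\<Sum>v\<in>verts G. mix F b f h v) = (\<Sum>C | critical F b C. f C) + (\<Sum>s | critical_sink F b s. h s)"
proof -
  have "(\<Sum>v\<in>verts G. mix F b f h v) = (\<Sum>C | critical F b C. f C * (\<Sum>v\<in>verts G. comp_vec G F b C v)) +
      (\<Sum>s | critical_sink F b s. h s * (\<Sum>v\<in>verts G. sink_vec G F b s v))"
    by (simp add: mix_def sum.distrib sum_distrib_left sum.swap[of _ "verts G"])
  also have "\<dots> = (\<Sum>C | critical F b C. f C) + (\<Sum>s | critical_sink F b s. h s)"
    using comp_vec_facts(2) sink_vec_sum by (intro arg_cong2[of _ _ _ _ "(+)"] sum.cong) (auto simp: critical_sink_def)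
  finally show ?thesis .
qed

text \<open>
  The coefficients can be read off from \<open>\<psi>\<close>: at a sink directly, and on a critical component \<open>C\<close> because
  there \<open>\<psi>\<close> vanishes or is a positive eigenvector, like \<open>\<phi>\<^sup>C\<close>. The remainder \<open>z\<close> is harmonic and lives on the
  part \<open>X\<close> of the support outside the components with spectral radius \<open>1\<close>, which is closed under
  predecessors and subcritical.
\<close>

theorem superharmonic_decomposition:
  assumes \<psi>: "\<And>v. v \<in> verts G \<Longrightarrow> 0 \<le> \<psi> v"
    and harm: "\<And>v. v \<in> verts G \<Longrightarrow> \<not> sink G v \<Longrightarrow> mvec (verts G) (wmat G F b) \<psi> v = \<psi> v"
  obtains f h where "\<And>C. critical F b C \<Longrightarrow> 0 \<le> f C" "\<And>s. critical_sink F b s \<Longrightarrow> 0 \<le> h s"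
    "\<And>v. v \<in> verts G \<Longrightarrow> \<psi> v = mix F b f h v"
proof -
  let ?W = "wmat G F b"
  let ?V = "verts G"
  have super: "mvec ?V ?W \<psi> v \<le> \<psi> v" if "v \<in> ?V" for v
    using harm[OF that] \<psi>[OF that] by (cases "sink G v") (auto simp: mvec_def wmat_row_sink)
  define Y where "Y = {v \<in> ?V. 0 < \<psi> v}"
  have Yreach: "v \<in> Y" if "v \<rightarrow>\<^sup>* w" "w \<in> Y" for v w
    using superharmonic_pos[OF \<psi> super that(1)] that reachable_in_verts(1)[OF that(1)] by (simp add: Y_def)
  have bcY: "backward_closed Y"
    unfolding backward_closed_def
  proof (intro conjI ballI impI)
    show "tail G e \<in> Y" if "e \<in> arcs G" "head G e \<in> Y" for e
      by (rule Yreach[OF arc_reachable]) (rule that)+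
  qed (auto simp: Y_def)
  have sub_le: "mvec D ?W \<psi> v \<le> \<psi> v" if "D \<subseteq> ?V" "v \<in> ?V" for D v
  proof -
    have "mvec D ?W \<psi> v \<le> mvec ?V ?W \<psi> v"
      unfolding mvec_def using that \<psi> by (intro sum_mono2) (auto intro!: mult_nonneg_nonneg wmat_nonneg)
    also have "\<dots> \<le> \<psi> v" by (rule super[OF that(2)])
    finally show ?thesis .
  qed
  have compY: "D \<subseteq> ?V" "v \<in> D \<Longrightarrow> 0 < \<psi> v" "v \<in> D \<Longrightarrow> mvec D ?W \<psi> v \<le> \<psi> v"
    if "D \<in> components_in G Y" for D v
  proof -
    show DV: "D \<subseteq> ?V" using that by (auto simp: components_in_def Y_def)
    show "v \<in> D \<Longrightarrow> 0 < \<psi> v" using that by (auto simp: components_in_def Y_def)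
    show "v \<in> D \<Longrightarrow> mvec D ?W \<psi> v \<le> \<psi> v" using sub_le[OF DV] DV by auto
  qed
  have le1: "spec F D b \<le> 1" if D: "D \<in> components_in G Y" for D
    by (rule spectral_radius_le_subinvariant[where y = \<psi>])
      (use D compY[OF D] component_irreducible in \<open>auto simp: components_in_def\<close>)
  have tight: "mvec D ?W \<psi> v = \<psi> v" if D: "D \<in> components_in G Y" "spec F D b = 1" "v \<in> D" for D v
    by (rule spectral_radius_eq_1_subinvariant[where y = \<psi>])
      (use D compY[OF D(1)] component_irreducible in \<open>auto simp: components_in_def\<close>)
  \<comment> \<open>An edge into the rest of the support would make \<open>A(b)\<psi>\<close> exceed the value on \<open>D\<close>, which is already \<open>\<psi>\<close>.\<close>
  have no_leak: "w \<notin> Y" if D: "D \<in> components_in G Y" "spec F D b = 1" and vw: "v \<in> D" "w \<notin> D" "0 < ?W v w" for D v w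
  proof
    assume w: "w \<in> Y"
    have DV: "D \<subseteq> ?V" by (rule compY(1)[OF D(1)])
    have wV: "w \<in> ?V" using w by (simp add: Y_def)
    have fin: "finite D" using DV finite_verts by (rule finite_subset)
    have "mvec (insert w D) ?W \<psi> v = ?W v w * \<psi> w + mvec D ?W \<psi> v"
      unfolding mvec_def using fin vw(2) by simp
    moreover have "mvec (insert w D) ?W \<psi> v \<le> \<psi> v" by (rule sub_le) (use DV wV vw in auto)
    moreover have "0 < ?W v w * \<psi> w" using vw(3) w by (simp add: Y_def)
    ultimately show False using tight[OF D vw(1)] by linarith
  qed
  have lt1: "spec F D b < 1" if D: "D \<in> components_in G Y" and vw: "v \<in> D" "v \<rightarrow>\<^sup>* w" "w \<notin> D" "w \<in> Y" for D v w
  proof -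
    obtain x y where xy: "x \<in> D" "y \<notin> D" "0 < ?W x y" "y \<rightarrow>\<^sup>* w" by (rule leaving_edge[OF vw(2,1,3)])
    have "y \<in> Y" by (rule Yreach[OF xy(4) vw(4)])
    then have "spec F D b \<noteq> 1" using no_leak[OF D _ xy(1-3)] by blast
    with le1[OF D] show ?thesis by simp
  qed
  have critY: "critical F b C" if C: "C \<in> components_in G Y" "spec F C b = 1" for C
  proof -
    have comp: "component G C" "C \<subseteq> Y" using C(1) by (auto simp: components_in_def)
    have "spec F D b < 1" if D: "D \<in> components_in G (up_closure G C - C)" for D
    proof -
      obtain v where v: "v \<in> D" using D component_edge by (auto simp: components_in_def)
      then have "v \<in> up_closure G C" "v \<notin> C" using D by (auto simp: components_in_def)
      then obtain w where w: "w \<in> C" "v \<rightarrow>\<^sup>* w" by (auto simp: up_closure_def)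
      have "up_closure G C \<subseteq> Y" using comp(2) Yreach by (auto simp: up_closure_def)
      then have DY: "D \<in> components_in G Y" using D by (auto simp: components_in_def)
      have "w \<notin> D" using D w(1) by (auto simp: components_in_def)
      then show ?thesis using lt1[OF DY v w(2)] w(1) comp(2) by blast
    qed
    then show ?thesis using comp(1) C(2) by (simp add: critical_def subcritical_def)
  qed
  have critY': "C \<in> components_in G Y" if C: "critical F b C" and v: "v \<in> C" "0 < \<psi> v" for C v
  proof -
    have comp: "component G C" using C by (simp add: critical_def)
    have "v \<in> Y" using v component_subset_verts[OF comp] by (auto simp: Y_def)
    then have "C \<subseteq> Y" using component_reachable[OF comp _ v(1)] Yreach by blast
    with comp show ?thesis by (simp add: components_in_def)
  qed
  have sinkY: "critical_sink F b s" if s: "sink G s" "0 < \<psi> s" for s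
  proof -
    have sY: "s \<in> Y" using s by (auto simp: Y_def sink_def)
    have "spec F D b < 1" if D: "D \<in> components_in G (up_closure G {s})" for D
    proof -
      obtain v where v: "v \<in> D" using D component_edge by (auto simp: components_in_def)
      have vs: "v \<rightarrow>\<^sup>* s" using D v by (auto simp: components_in_def up_closure_def)
      have "up_closure G {s} \<subseteq> Y" using sY Yreach by (auto simp: up_closure_def)
      then have DY: "D \<in> components_in G Y" using D by (auto simp: components_in_def)
      have "s \<notin> D" using D sink_not_in_component[OF _ s(1)] by (auto simp: components_in_def)
      then show ?thesis using lt1[OF DY v vs] sY by blast
    qed
    then show ?thesis using s(1) by (simp add: critical_sink_def subcritical_def)
  qed
  define f where "f C = \<psi> (SOME v. v \<in> C) / comp_vec G F b C (SOME v. v \<in> C)" for C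
  define h where "h s = \<psi> s / sink_vec G F b s s" for s
  have fC: "\<psi> v = f C * comp_vec G F b C v" if C: "critical F b C" and v: "v \<in> C" for C v
  proof -
    have comp: "component G C" and one: "spec F C b = 1" using C by (auto simp: critical_def)
    define w where "w = (SOME v. v \<in> C)"
    have w: "w \<in> C" unfolding w_def using v by (rule someI)
    have CV: "C \<subseteq> ?V" by (rule component_subset_verts[OF comp])
    show ?thesis
    proof (cases "C \<in> components_in G Y")
      case True
      obtain c where c: "\<And>v. v \<in> C \<Longrightarrow> \<psi> v = c * comp_vec G F b C v"
        by (rule sub_super_invariant_proportional[OF component_irreducible[OF comp, of F b], of "comp_vec G F b C" \<psi> v])
          (use comp_vec_facts(4,6)[OF C] tight[OF True one] compY(2)[OF True] v in auto)
      have "f C = c" using c[OF w] comp_vec_facts(6)[OF C w] by (simp add: f_def w_def[symmetric])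
      with c[OF v] show ?thesis by simp
    next
      case False
      then have "\<psi> u = 0" if "u \<in> C" for u
        using critY'[OF C that] \<psi>[of u] that CV by fastforce
      then show ?thesis using v w by (simp add: f_def w_def[symmetric])
    qed
  qed
  have f_nonneg: "0 \<le> f C" if C: "critical F b C" for C
  proof -
    have comp: "component G C" using C by (simp add: critical_def)
    obtain v where v: "v \<in> C" using component_edge[OF comp] by blast
    have "0 \<le> \<psi> v" using \<psi> v component_subset_verts[OF comp] by blast
    then show ?thesis using fC[OF C v] comp_vec_facts(6)[OF C v] by (simp add: zero_le_mult_iff)
  qed
  have h_nonneg: "0 \<le> h s" if "critical_sink F b s" for s
    unfolding h_def using that \<psi>[of s] sink_vec_nonneg[of s F b s] by (auto simp: critical_sink_def sink_def)
  have hs: "h s * sink_vec G F b s s = \<psi> s" if "critical_sink F b s" for s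
    using that sink_vec_self_pos[of s F b] by (auto simp: h_def critical_sink_def)
  define z where "z v = \<psi> v - mix F b f h v" for v
  have zharm: "mvec ?V ?W z v = z v" if v: "v \<in> ?V" for v
  proof -
    have "mvec ?V ?W z v = mvec ?V ?W \<psi> v - mvec ?V ?W (mix F b f h) v" unfolding z_def by (rule mvec_diff)
    moreover have "mix F b f h v - mvec ?V ?W (mix F b f h) v = \<psi> v - mvec ?V ?W \<psi> v"
    proof (cases "sink G v")
      case True
      then have "\<psi> v = 0" if "\<not> critical_sink F b v" using sinkY[OF True] \<psi>[OF v] that by fastforce
      moreover have "mvec ?V ?W \<psi> v = 0" using True by (simp add: mvec_def wmat_row_sink)
      ultimately show ?thesis using hs[of v] by (simp add: mix_harmonic_defect[OF v])
    next
      case False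
      then show ?thesis using harm[OF v] by (simp add: mix_harmonic_defect[OF v] critical_sink_def)
    qed
    ultimately show ?thesis by (simp add: z_def)
  qed
  define T where "T = {C \<in> components_in G Y. spec F C b = 1}"
  define X where "X = Y - \<Union>T"
  have bcX: "backward_closed X"
    unfolding backward_closed_def
  proof (intro conjI ballI impI)
    show "X \<subseteq> ?V" by (auto simp: X_def Y_def)
    fix e assume e: "e \<in> arcs G" "head G e \<in> X"
    have "tail G e \<in> Y" using e bcY by (auto simp: backward_closed_def X_def)
    moreover have "tail G e \<notin> C" if C: "C \<in> T" for C
    proof
      assume t: "tail G e \<in> C"
      have "head G e \<notin> C" using e(2) C by (auto simp: X_def)
      moreover have "0 < ?W (tail G e) (head G e)" using e(1) by (auto simp: wmat_pos_iff)
      ultimately have "head G e \<notin> Y" using no_leak[of C "tail G e" "head G e"] C t by (auto simp: T_def)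
      with e(2) show False by (simp add: X_def)
    qed
    ultimately show "tail G e \<in> X" by (auto simp: X_def)
  qed
  have subX: "subcritical F b X"
    unfolding subcritical_def
  proof
    fix D assume D: "D \<in> components_in G X"
    then have DY: "D \<in> components_in G Y" by (auto simp: components_in_def X_def)
    obtain v where v: "v \<in> D" using D component_edge by (auto simp: components_in_def)
    then have "D \<notin> T" using D by (auto simp: components_in_def X_def)
    then show "spec F D b < 1" using DY le1[OF DY] by (auto simp: T_def)
  qed
  have zoff: "z v = 0" if v: "v \<in> ?V" "v \<notin> X" for v
  proof (cases "v \<in> Y")
    case True
    then obtain C where C: "C \<in> T" "v \<in> C" using v(2) by (auto simp: X_def)
    then have crit: "critical F b C" using critY by (auto simp: T_def)
    show ?thesis unfolding z_def mix_on_critical[OF crit C(2)] using fC[OF crit C(2)] by simp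
  next
    case False
    then have \<psi>v: "\<psi> v = 0" using \<psi>[OF v(1)] v(1) by (auto simp: Y_def)
    have c0: "f C * comp_vec G F b C v = 0" if C: "critical F b C" for C
    proof (rule ccontr)
      assume ne: "f C * comp_vec G F b C v \<noteq> 0"
      then have "v \<in> up_closure G C" using comp_vec_facts(5)[OF C] by fastforce
      then obtain w where w: "w \<in> C" "v \<rightarrow>\<^sup>* w" by (auto simp: up_closure_def)
      have "f C \<noteq> 0" using ne by simp
      then have "0 < \<psi> w" using fC[OF C w(1)] f_nonneg[OF C] comp_vec_facts(6)[OF C w(1)] by simp
      then have "w \<in> Y" using reachable_in_verts(2)[OF w(2)] by (simp add: Y_def)
      then show False using Yreach[OF w(2)] False by simp
    qed
    have s0: "h s * sink_vec G F b s v = 0" if s: "critical_sink F b s" for s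
    proof (rule ccontr)
      assume ne: "h s * sink_vec G F b s v \<noteq> 0"
      then have "v \<in> up_closure G {s}" using s sink_vec_outside[of s F b v] by (auto simp: critical_sink_def)
      then have vs: "v \<rightarrow>\<^sup>* s" by (auto simp: up_closure_def)
      have "\<psi> s \<noteq> 0" using ne by (auto simp: h_def)
      moreover have "s \<in> ?V" using reachable_in_verts(2)[OF vs] .
      ultimately have "s \<in> Y" using \<psi>[of s] by (simp add: Y_def)
      then show False using Yreach[OF vs] False by simp
    qed
    have "(\<Sum>C | critical F b C. f C * comp_vec G F b C v) = 0" by (rule sum.neutral) (use c0 in blast)
    moreover have "(\<Sum>s | critical_sink F b s. h s * sink_vec G F b s v) = 0" by (rule sum.neutral) (use s0 in blast)
    ultimately have "mix F b f h v = 0" by (simp add: mix_def)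
    then show ?thesis by (simp add: z_def \<psi>v)
  qed
  have zX: "mvec X ?W z v = z v" if "v \<in> X" for v
  proof -
    have "v \<in> ?V" using that bcX by (auto simp: backward_closed_def)
    then show ?thesis using zharm mvec_verts_eq[where F = F and b = b, OF bcX zoff] by simp
  qed
  have "\<psi> v = mix F b f h v" if v: "v \<in> ?V" for v
  proof -
    have "z v = 0"
      using zoff[OF v] subcritical_harmonic_zero[OF bcX subX zX] by (cases "v \<in> X") auto
    then show ?thesis by (simp add: z_def)
  qed
  with f_nonneg h_nonneg show thesis by (rule that)
qed

section \<open>Existence and uniqueness of the coefficients\<close>

lemma C_Z_set_critical:
  assumes "b \<noteq> 0"
  shows "C_set G F b \<union> Z_set G F b = {C. critical F b C}" "C_set G F b \<inter> Z_set G F b = {}"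
    "S_set G F b = {s. critical_sink F b s}"
proof -
  note iff = C_set_iff[OF assms, of _ F] Z_set_iff[OF assms, of _ F] S_set_iff[OF assms, of _ F]
  show "C_set G F b \<union> Z_set G F b = {C. critical F b C}" "C_set G F b \<inter> Z_set G F b = {}"
    "S_set G F b = {s. critical_sink F b s}"
    by (auto simp: set_eq_iff iff critical_def critical_sink_def)
qed

lemma sum_critical:
  assumes "b \<noteq> 0"
  shows "(\<Sum>C | critical F b C. (if C \<in> C_set G F b then p C else q C)) =
    (\<Sum>C\<in>C_set G F b. p C) + (\<Sum>C\<in>Z_set G F b. q C :: real)"
proof -
  note eq = C_Z_set_critical[OF assms, of F]
  have fin: "finite (C_set G F b)" "finite (Z_set G F b)"
    using finite_critical[of F b] unfolding eq(1)[symmetric] by auto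
  have "(\<Sum>C | critical F b C. (if C \<in> C_set G F b then p C else q C)) =
      (\<Sum>C\<in>C_set G F b. (if C \<in> C_set G F b then p C else q C)) +
      (\<Sum>C\<in>Z_set G F b. (if C \<in> C_set G F b then p C else q C))"
    unfolding eq(1)[symmetric] by (rule sum.union_disjoint[OF fin eq(2)])
  also have "(\<Sum>C\<in>Z_set G F b. (if C \<in> C_set G F b then p C else q C)) = (\<Sum>C\<in>Z_set G F b. q C)"
    using eq(2) by (intro sum.cong) auto
  finally show ?thesis by simp
qed

lemma mixed_vec_eq_mix:
  assumes "b \<noteq> 0"
  shows "mixed_vec G F b f g h = mix F b (\<lambda>C. if C \<in> C_set G F b then f C else g C) h"
proof
  fix v
  have "mix F b (\<lambda>C. if C \<in> C_set G F b then f C else g C) h v =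
      (\<Sum>C | critical F b C. if C \<in> C_set G F b then f C * comp_vec G F b C v else g C * comp_vec G F b C v) +
      (\<Sum>s\<in>S_set G F b. h s * sink_vec G F b s v)"
    unfolding mix_def C_Z_set_critical(3)[OF assms] by (simp add: if_distrib[of "\<lambda>x. x * _"] cong: if_cong)
  then show "mixed_vec G F b f g h v = mix F b (\<lambda>C. if C \<in> C_set G F b then f C else g C) h v"
    by (simp add: mixed_vec_def sum_critical[OF assms])
qed

text \<open>
  The bound by \<open>1\<close> holds because all coefficients are nonnegative and each of the vectors \<open>\<phi>\<^sup>C\<close> and \<open>\<phi>\<^sup>s\<close> sums to \<open>1\<close>.
\<close>

theorem superharmonic_mixed_vec:
  assumes b: "b \<noteq> 0" and \<psi>: "\<And>v. v \<in> verts G \<Longrightarrow> 0 \<le> \<psi> v" and total: "(\<Sum>v\<in>verts G. \<psi> v) = 1"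
    and harm: "\<And>v. v \<in> verts G \<Longrightarrow> \<not> sink G v \<Longrightarrow> mvec (verts G) (wmat G F b) \<psi> v = \<psi> v"
  shows "\<exists>!(f, g, h). f \<in> C_set G F b \<rightarrow>\<^sub>E {0..1} \<and> g \<in> Z_set G F b \<rightarrow>\<^sub>E {0..1} \<and> h \<in> S_set G F b \<rightarrow>\<^sub>E {0..1} \<and>
    (\<Sum>C\<in>C_set G F b. f C) + (\<Sum>D\<in>Z_set G F b. g D) + (\<Sum>s\<in>S_set G F b. h s) = 1 \<and>
    (\<forall>v\<in>verts G. \<psi> v = mixed_vec G F b f g h v)"
proof -
  note eq = C_Z_set_critical[OF b, of F]
  have fin: "finite (C_set G F b)" "finite (Z_set G F b)" "finite (S_set G F b)"
    using finite_critical[of F b] finite_critical_sink[of F b] unfolding eq(1)[symmetric] eq(3) by auto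
  have subs: "critical F b C" if "C \<in> C_set G F b \<or> C \<in> Z_set G F b" for C using that eq(1) by auto
  obtain f0 h0 where f0: "\<And>C. critical F b C \<Longrightarrow> 0 \<le> f0 C" and h0: "\<And>s. critical_sink F b s \<Longrightarrow> 0 \<le> h0 s"
    and mix0: "\<And>v. v \<in> verts G \<Longrightarrow> \<psi> v = mix F b f0 h0 v"
    by (rule superharmonic_decomposition[where \<psi> = \<psi> and F = F and b = b, OF \<psi> harm]) auto
  define f where "f = restrict f0 (C_set G F b)"
  define g where "g = restrict f0 (Z_set G F b)"
  define h where "h = restrict h0 (S_set G F b)"
  have "mixed_vec G F b f g h v = mix F b f0 h0 v" for v
    unfolding mixed_vec_eq_mix[OF b] mix_def eq(1)[symmetric] eq(3)[symmetric]
    by (intro arg_cong2[of _ _ _ _ "(+)"] sum.cong) (auto simp: f_def g_def h_def)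
  then have mix: "\<psi> v = mixed_vec G F b f g h v" if "v \<in> verts G" for v using mix0[OF that] by simp
  have "(\<Sum>v\<in>verts G. mixed_vec G F b f g h v) = 1" using mix total by simp
  then have sum1: "(\<Sum>C\<in>C_set G F b. f C) + (\<Sum>D\<in>Z_set G F b. g D) + (\<Sum>s\<in>S_set G F b. h s) = 1"
    unfolding mixed_vec_eq_mix[OF b] mix_sum sum_critical[OF b] eq(3)[symmetric] .
  have nn: "0 \<le> f C" if "C \<in> C_set G F b" for C using that f0 subs by (simp add: f_def)
  have nn2: "0 \<le> g C" if "C \<in> Z_set G F b" for C using that f0 subs by (simp add: g_def)
  have nn3: "0 \<le> h s" if "s \<in> S_set G F b" for s using that h0 eq(3) by (auto simp: h_def)
  have tot: "0 \<le> (\<Sum>C\<in>C_set G F b. f C)" "0 \<le> (\<Sum>D\<in>Z_set G F b. g D)" "0 \<le> (\<Sum>s\<in>S_set G F b. h s)"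
    using nn nn2 nn3 by (auto intro: sum_nonneg)
  have "f C \<le> 1" if "C \<in> C_set G F b" for C
    using member_le_sum[of C "C_set G F b" f] nn fin that tot sum1 by fastforce
  moreover have "g C \<le> 1" if "C \<in> Z_set G F b" for C
    using member_le_sum[of C "Z_set G F b" g] nn2 fin that tot sum1 by fastforce
  moreover have "h s \<le> 1" if "s \<in> S_set G F b" for s
    using member_le_sum[of s "S_set G F b" h] nn3 fin that tot sum1 by fastforce
  ultimately have mem: "f \<in> C_set G F b \<rightarrow>\<^sub>E {0..1}" "g \<in> Z_set G F b \<rightarrow>\<^sub>E {0..1}" "h \<in> S_set G F b \<rightarrow>\<^sub>E {0..1}"
    using nn nn2 nn3 by (auto simp: f_def g_def h_def)
  have coeff: "f1 C * comp_vec G F b C v = \<psi> v" if "C \<in> C_set G F b" "v \<in> C"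
    and m: "\<forall>v\<in>verts G. \<psi> v = mixed_vec G F b f1 g1 h1 v" for f1 g1 h1 C v
  proof -
    have C: "critical F b C" using that(1) subs by blast
    then have "v \<in> verts G" using that(2) component_subset_verts by (auto simp: critical_def)
    then show ?thesis
      using m mix_on_critical[OF C that(2), of "\<lambda>C. if C \<in> C_set G F b then f1 C else g1 C" h1] that(1)
      by (simp add: mixed_vec_eq_mix[OF b])
  qed
  have coeff2: "g1 C * comp_vec G F b C v = \<psi> v" if "C \<in> Z_set G F b" "v \<in> C"
    and m: "\<forall>v\<in>verts G. \<psi> v = mixed_vec G F b f1 g1 h1 v" for f1 g1 h1 C v
  proof -
    have C: "critical F b C" "C \<notin> C_set G F b" using that(1) subs eq(2) by blast+
    then have "v \<in> verts G" using that(2) component_subset_verts by (auto simp: critical_def)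
    then show ?thesis
      using m mix_on_critical[OF C(1) that(2), of "\<lambda>C. if C \<in> C_set G F b then f1 C else g1 C" h1] C(2)
      by (simp add: mixed_vec_eq_mix[OF b])
  qed
  have coeff3: "h1 s * sink_vec G F b s s = \<psi> s" if "s \<in> S_set G F b"
    and m: "\<forall>v\<in>verts G. \<psi> v = mixed_vec G F b f1 g1 h1 v" for f1 g1 h1 s
  proof -
    have s: "critical_sink F b s" using that(1) eq(3) by blast
    then have "sink G s" "s \<in> verts G" by (auto simp: critical_sink_def sink_def)
    then show ?thesis
      using m mix_on_sink[of s F b "\<lambda>C. if C \<in> C_set G F b then f1 C else g1 C" h1] s
      by (simp add: mixed_vec_eq_mix[OF b])
  qed
  have pos: "\<exists>v\<in>C. 0 < comp_vec G F b C v" if "critical F b C" for C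
    using comp_vec_facts(6)[OF that] component_edge[of C] that by (auto simp: critical_def)
  have pos2: "0 < sink_vec G F b s s" if "s \<in> S_set G F b" for s
    using that sink_vec_self_pos eq(3) by (auto simp: critical_sink_def)
  have unique: "f1 = f \<and> g1 = g \<and> h1 = h"
    if ext: "f1 \<in> extensional (C_set G F b)" "g1 \<in> extensional (Z_set G F b)" "h1 \<in> extensional (S_set G F b)"
      and m: "\<forall>v\<in>verts G. \<psi> v = mixed_vec G F b f1 g1 h1 v" for f1 g1 h1
  proof (intro conjI)
    have m0: "\<forall>v\<in>verts G. \<psi> v = mixed_vec G F b f g h v" using mix by blast
    show "f1 = f"
    proof (rule extensionalityI[OF ext(1)])
      show "f \<in> extensional (C_set G F b)" by (simp add: f_def)
      fix C assume C: "C \<in> C_set G F b"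
      obtain v where v: "v \<in> C" "0 < comp_vec G F b C v" using pos subs C by blast
      show "f1 C = f C" using coeff[OF C v(1) m] coeff[OF C v(1) m0] v(2) by (metis less_irrefl mult_right_cancel)
    qed
    show "g1 = g"
    proof (rule extensionalityI[OF ext(2)])
      show "g \<in> extensional (Z_set G F b)" by (simp add: g_def)
      fix C assume C: "C \<in> Z_set G F b"
      obtain v where v: "v \<in> C" "0 < comp_vec G F b C v" using pos subs C by blast
      show "g1 C = g C" using coeff2[OF C v(1) m] coeff2[OF C v(1) m0] v(2) by (metis less_irrefl mult_right_cancel)
    qed
    show "h1 = h"
    proof (rule extensionalityI[OF ext(3)])
      show "h \<in> extensional (S_set G F b)" by (simp add: h_def)
      fix s assume s: "s \<in> S_set G F b"
      show "h1 s = h s" using coeff3[OF s m] coeff3[OF s m0] pos2[OF s] by (metis less_irrefl mult_right_cancel)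
    qed
  qed
  show ?thesis
  proof (rule ex1I[of _ "(f, g, h)"], goal_cases)
    case 1
    show ?case using mem sum1 mix by simp
  next
    case (2 t)
    then show ?case using unique by (cases t) (auto simp: PiE_def)
  qed
qed

end

theorem theorem4p10:
  fixes G :: "('v, 'e) pre_digraph" and F :: "'e \<Rightarrow> real" and \<beta> :: real
    and A :: "'a cstar" and P :: "'v \<Rightarrow> 'a" and S :: "'e \<Rightarrow> 'a"
    and \<phi> :: "'a \<Rightarrow> complex"
  assumes "fin_digraph G"
    and "graph_cstar_algebra G A P S"
    and "\<beta> \<noteq> 0"
    and "kms_state G A P S F \<beta> \<phi>"
    and "gauge_invariant G A P S \<phi>"
  shows "\<exists>!(f, g, h).
    f \<in> C_set G F \<beta> \<rightarrow>\<^sub>E {0..1} \<and> g \<in> Z_set G F \<beta> \<rightarrow>\<^sub>E {0..1} \<and> h \<in> S_set G F \<beta> \<rightarrow>\<^sub>E {0..1} \<and>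
    (\<Sum>C\<in>C_set G F \<beta>. f C) + (\<Sum>D\<in>Z_set G F \<beta>. g D) + (\<Sum>s\<in>S_set G F \<beta>. h s) = 1 \<and>
    (\<forall>\<mu>\<in>fpaths G. \<forall>\<nu>\<in>fpaths G.
       \<phi> (path_elem A P S \<mu> \<otimes>\<^bsub>A\<^esub> adj A (path_elem A P S \<nu>)) =
       (if \<mu> = \<nu>
        then complex_of_real (exp (- \<beta> * path_weight F (snd \<mu>)) * mixed_vec G F \<beta> f g h (path_range G \<mu>))
        else 0))"
proof -
  interpret fin_digraph G by fact
  obtain \<psi> where \<psi>: "\<And>v. v \<in> verts G \<Longrightarrow> 0 \<le> \<psi> v" "(\<Sum>v\<in>verts G. \<psi> v) = 1"
    "\<And>v. v \<in> verts G \<Longrightarrow> \<not> sink G v \<Longrightarrow> (\<Sum>w\<in>verts G. wmat G F \<beta> v w * \<psi> w) = \<psi> v"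
    and path: "\<And>\<mu> \<nu>. \<mu> \<in> fpaths G \<Longrightarrow> \<nu> \<in> fpaths G \<Longrightarrow>
       \<phi> (path_elem A P S \<mu> \<otimes>\<^bsub>A\<^esub> adj A (path_elem A P S \<nu>)) =
       (if \<mu> = \<nu> then complex_of_real (exp (- \<beta> * path_weight F (snd \<mu>)) * \<psi> (path_range G \<mu>)) else 0)"
    by (rule gauge_invariant_kms_state_vector[OF assms(1,2,4,5)]) blast
  have equiv: "(\<forall>\<mu>\<in>fpaths G. \<forall>\<nu>\<in>fpaths G.
       \<phi> (path_elem A P S \<mu> \<otimes>\<^bsub>A\<^esub> adj A (path_elem A P S \<nu>)) =
       (if \<mu> = \<nu> then complex_of_real (exp (- \<beta> * path_weight F (snd \<mu>)) * x (path_range G \<mu>)) else 0))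
    \<longleftrightarrow> (\<forall>v\<in>verts G. \<psi> v = x v)" (is "?L \<longleftrightarrow> ?R") for x :: "'v \<Rightarrow> real"
  proof
    assume L: ?L
    show ?R
    proof
      fix v assume v: "v \<in> verts G"
      then have m: "(v, []) \<in> fpaths G" by (auto simp: fpaths_def awalk_Nil_iff)
      have "complex_of_real (\<psi> v) = complex_of_real (x v)"
        using path[OF m m] L[rule_format, OF m m] by (simp add: path_weight_def path_range_def)
      then show "\<psi> v = x v" by (simp only: of_real_eq_iff)
    qed
  next
    assume R: ?R
    have "path_range G \<mu> \<in> verts G" if "\<mu> \<in> fpaths G" for \<mu>
    proof -
      obtain u p w where "\<mu> = (u, p)" "awalk u p w" using \<open>\<mu> \<in> fpaths G\<close> by (auto simp: fpaths_def)
      then have "path_range G \<mu> = w" "w \<in> verts G" by (auto simp: path_range_def intro: awalk_last_in_verts)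
      then show ?thesis by simp
    qed
    then show ?L using path R by simp
  qed
  show ?thesis
    unfolding equiv
    by (rule superharmonic_mixed_vec[OF assms(3) \<psi>(1,2)]) (simp_all add: mvec_def \<psi>(3))
qed

end
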